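(* Let $M$ be a smooth $m$-manifold, and let $P\colon J^1\tau\to J^1\tau_\Sigma$ denote the composite $P=\mathrm{pr}_2\circ\mathrm{pr}_\Sigma\circ\Upsilon_\omega=\mathrm{pr}_1\circ\overline\Upsilon_\omega\circ p_K^{J^1\tau}$. The metricity forms (the components of $\omega_{\mathfrak p}$) are $P$-horizontal. In fact, $$Tp_K^{LM}\circ\omega_{\mathfrak p}=P^*\overline\omega,$$ where $\overline\omega$ is the contact form on $J^1\tau_\Sigma$.
   Context: $\tau\colon LM\to M$ is the bundle of linear frames of $M$ with its right $GL(m)$-action; $J^1\tau$ is its first jet bundle with projections $\tau_{10}\colon J^1\tau\to LM$, $\tau_1\colon J^1\tau\to M$ and the lifted action. $\eta=\mathrm{diag}(-1,1,\dots,1)$, $K=\{A\in GL(m):\eta_{ij}A^i_kA^j_l=\eta_{kl}\}$ with Lie algebra $\mathfrak k$; $\mathfrak{gl}(m)=\mathfrak k\oplus\mathfrak p$ with projections $\pi_{\mathfrak k}(A)=\frac12(A-\eta A^T\eta)$, $A_{\mathfrak p}=\frac12(A+\eta A^T\eta)$. $p_K^{LM}\colon LM\to\Sigma:=LM/K$, $\tau_\Sigma\colon\Sigma\to M$ (the bundle of metrics of signature $\eta$), and $p_K^{J^1\tau}\colon J^1\tau\to J^1\tau/K$ are the quotient maps. The Cartan form $T_{j^1_xs}\tau_{10}-T_xs\circ T_{j^1_xs}\tau_1$, with values in the vertical bundle $V\tau\simeq LM\times\mathfrak{gl}(m)$ (the pair $(u,A)$ corresponding to $\frac{d}{dt}|_{0}\,u\cdot\exp(tA)$),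 defines a $\mathfrak{gl}(m)$-valued 1-form $\omega$ on $J^1\tau$; $\omega_{\mathfrak p}$ is its $\mathfrak p$-component. In the expression $Tp_K^{LM}\circ\omega_{\mathfrak p}$ the form $\omega_{\mathfrak p}$ is regarded as $V\tau$-valued through the same identification (at the point $\tau_{10}(j^1_xs)$). Fix a principal connection $\omega_0$ on $LM$ and let $\omega_K=\pi_{\mathfrak k}\circ\omega_0$, a connection on the $K$-bundle $p_K^{LM}$. Let $\widetilde{\mathfrak k}=(LM\times\mathfrak k)/K\to\Sigma$ be the adjoint bundle. The bundle isomorphism $$\Upsilon_\omega\colon J^1\tau\to(p_K^{LM})^*\big(J^1\tau_\Sigma\times_\Sigma\mathrm{Lin}(\tau_\Sigma^*TM,\widetilde{\mathfrak k})\big),\quad j^1_xs\mapsto\big(s(x),j^1_x[s]_K,[s(x),\omega_K\circ T_xs]_K\big),$$ where $[s]_K=p_K^{LM}\circ s$, induces $\overline\Upsilon_\omega\colon J^1\tau/K\to J^1\tau_\Sigma\times_\Sigma\mathrm{Lin}(\tau_\Sigma^*TM,\widetilde{\mathfrak k})$. $\mathrm{pr}_\Sigma$ forgets the $\mathrm{Lin}$-component, $(e,j^1_x\overline s,\alpha)\mapsto(e,j^1_x\overline s)$; $\mathrm{pr}_2\colon(p_K^{LM})^*(J^1\tau_\Sigma)\to J^1\tau_\Sigma$ and $\mathrm{pr}_1\colon J^1\tau_\Sigma\times_\Sigma\mathrm{Lin}(\tau_\Sigma^*TM,\widetilde{\mathfrak k})\to J^1\tau_\Sigma$ are the projections. Thus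 $P(j^1_xs)=j^1_x(p_K^{LM}\circ s)$. The contact form on $J^1\tau_\Sigma$ is the $V\tau_\Sigma$-valued 1-form $\overline\omega|_{j^1_x\overline s}=T_{j^1_x\overline s}(\tau_\Sigma)_{10}-T_x\overline s\circ T_{j^1_x\overline s}(\tau_\Sigma)_1$, with $(\tau_\Sigma)_{10}\colon J^1\tau_\Sigma\to\Sigma$, $(\tau_\Sigma)_1\colon J^1\tau_\Sigma\to M$. A form is $P$-horizontal if it vanishes when contracted with any vector in $\ker TP$. *)

theory Defs
  imports "HOL-Analysis.Analysis" "HOL-Library.Uprod"
begin

instance uprod :: (finite) finite
  by standard simp


section \<open>Smooth manifolds and derivations\<close>

primrec Ck_on :: "nat \<Rightarrow> 'v::real_normed_vector set \<Rightarrow> ('v \<Rightarrow> 'w::real_normed_vector) \<Rightarrow> bool" where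
  "Ck_on 0 S f \<longleftrightarrow> continuous_on S f"
| "Ck_on (Suc k) S f \<longleftrightarrow>
     f differentiable_on S \<and> (\<forall>v. Ck_on k S (\<lambda>x. frechet_derivative f (at x) v))"

text \<open>Only used for open \<open>S\<close>.\<close>

definition smooth_on :: "'v::real_normed_vector set \<Rightarrow> ('v \<Rightarrow> 'w::real_normed_vector) \<Rightarrow> bool" where
  "smooth_on S f \<longleftrightarrow> (\<forall>k. Ck_on k S f)"

type_synonym ('p, 'e) atlas = "('p set \<times> ('p \<Rightarrow> 'e)) set"

definition carrier :: "('p, 'e) atlas \<Rightarrow> 'p set" where
  "carrier A = (\<Union>(U, \<phi>)\<in>A. U)"

definition mtop :: "('p, 'e::euclidean_space) atlas \<Rightarrow> 'p topology" where
  "mtop A = topology_generated_by {U \<inter> \<phi> -` W |U \<phi> W. (U, \<phi>) \<in> A \<and> open W}"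

definition smooth_manifold :: "('p, 'e::euclidean_space) atlas \<Rightarrow> bool" where
  "smooth_manifold A \<longleftrightarrow>
     (\<forall>(U, \<phi>)\<in>A. inj_on \<phi> U \<and> open (\<phi> ` U)) \<and>
     (\<forall>(U, \<phi>)\<in>A. \<forall>(V, \<psi>)\<in>A.
        open (\<phi> ` (U \<inter> V)) \<and> smooth_on (\<phi> ` (U \<inter> V)) (\<psi> \<circ> inv_into U \<phi>)) \<and>
     Hausdorff_space (mtop A) \<and>
     (\<exists>\<B>. countable \<B> \<and> openin (mtop A) = arbitrary union_of (\<lambda>W. W \<in> \<B>))"

definition smooth_near :: "('p, 'e::euclidean_space) atlas \<Rightarrow> 'p \<Rightarrow> ('p \<Rightarrow> 'w::real_normed_vector) \<Rightarrow> bool" where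
  "smooth_near A p f \<longleftrightarrow>
     (\<exists>(U, \<phi>)\<in>A. p \<in> U \<and>
        (\<exists>W. open W \<and> \<phi> p \<in> W \<and> W \<subseteq> \<phi> ` U \<and> smooth_on W (f \<circ> inv_into U \<phi>)))"

definition smooth_map_near ::
  "('p, 'e::euclidean_space) atlas \<Rightarrow> ('q, 'f::euclidean_space) atlas \<Rightarrow> 'p \<Rightarrow> ('p \<Rightarrow> 'q) \<Rightarrow> bool" where
  "smooth_map_near A B p f \<longleftrightarrow>
     f p \<in> carrier B \<and>
     (\<forall>(V, \<psi>)\<in>B. f p \<in> V \<longrightarrow>
        (\<exists>N. openin (mtop A) N \<and> p \<in> N \<and> f ` N \<subseteq> V) \<and> smooth_near A p (\<psi> \<circ> f))"

text \<open>
  A tangent vector at \<open>p\<close> is a derivation of the real functions smooth near \<open>p\<close>; such a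
  derivation depends only on germs at \<open>p\<close>. The value \<open>0\<close> on all other functions is a
  convention that makes equality of tangent vectors equality of functionals.
\<close>

type_synonym 'p tvec = "('p \<Rightarrow> real) \<Rightarrow> real"

definition tangent_space :: "('p, 'e::euclidean_space) atlas \<Rightarrow> 'p \<Rightarrow> 'p tvec set" where
  "tangent_space A p = {v.
     (\<forall>f. \<not> smooth_near A p f \<longrightarrow> v f = 0) \<and>
     (\<forall>f g. smooth_near A p f \<longrightarrow> smooth_near A p g \<longrightarrow>
        v (\<lambda>q. f q + g q) = v f + v g \<and>
        v (\<lambda>q. f q * g q) = f p * v g + g p * v f) \<and>
     (\<forall>f c. smooth_near A p f \<longrightarrow> v (\<lambda>q. c * f q) = c * v f)}"

text \<open>The tangent map at \<open>p\<close> of a map \<open>f\<close> into the manifold with atlas \<open>B\<close>.\<close>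

definition tmap :: "('q, 'f::euclidean_space) atlas \<Rightarrow> ('p \<Rightarrow> 'q) \<Rightarrow> 'p \<Rightarrow> 'p tvec \<Rightarrow> 'q tvec" where
  "tmap B f p v = (\<lambda>g. if smooth_near B (f p) g then v (g \<circ> f) else 0)"

definition coord_vec :: "('p, 'e::euclidean_space) atlas \<Rightarrow> 'p set \<times> ('p \<Rightarrow> 'e) \<Rightarrow> 'e \<Rightarrow> 'p \<Rightarrow> 'p tvec" where
  "coord_vec A c b p =
     (\<lambda>f. if smooth_near A p f
          then frechet_derivative (f \<circ> inv_into (fst c) (snd c)) (at (snd c p)) b else 0)"

definition pullback ::
  "('q, 'f::euclidean_space) atlas \<Rightarrow> ('p \<Rightarrow> 'q) \<Rightarrow> ('q \<Rightarrow> 'q tvec \<Rightarrow> 'w) \<Rightarrow> 'p \<Rightarrow> 'p tvec \<Rightarrow> 'w" where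
  "pullback B f \<theta> p v = \<theta> (f p) (tmap B f p v)"

definition horizontal_form ::
  "('p, 'e::euclidean_space) atlas \<Rightarrow> ('q, 'f::euclidean_space) atlas \<Rightarrow> ('p \<Rightarrow> 'q) \<Rightarrow>
   ('p \<Rightarrow> 'p tvec \<Rightarrow> real) \<Rightarrow> bool" where
  "horizontal_form A B f \<theta> \<longleftrightarrow>
     (\<forall>p\<in>carrier A. \<forall>v\<in>tangent_space A p. tmap B f p v = (\<lambda>_. 0) \<longrightarrow> \<theta> p v = 0)"


section \<open>First jets of sections\<close>

text \<open>
  Throughout, \<open>M\<close> is the atlas of the base, and \<open>\<pi>\<close> is a fibration onto it whose total space
  has the atlas \<open>E\<close>; the charts in \<open>E\<close> are fibred, i.e. their first component is a chart
  of \<open>M\<close> composed with \<open>\<pi>\<close>.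
\<close>

definition local_section ::
  "('a, 'e::euclidean_space) atlas \<Rightarrow> ('b, 'f::euclidean_space) atlas \<Rightarrow> ('b \<Rightarrow> 'a) \<Rightarrow> 'a \<Rightarrow> ('a \<Rightarrow> 'b) \<Rightarrow> bool" where
  "local_section M E \<pi> x s \<longleftrightarrow>
     smooth_map_near M E x s \<and> (\<exists>N. openin (mtop M) N \<and> x \<in> N \<and> (\<forall>y\<in>N. \<pi> (s y) = y))"

text \<open>A jet is its source point paired with the class of all local sections representing it.\<close>

type_synonym ('a, 'b) jet = "'a \<times> ('a \<Rightarrow> 'b) set"

definition jet ::
  "('a, 'e::euclidean_space) atlas \<Rightarrow> ('b, 'f::euclidean_space) atlas \<Rightarrow> ('b \<Rightarrow> 'a) \<Rightarrow> 'a \<Rightarrow> ('a \<Rightarrow> 'b) \<Rightarrow> ('a, 'b) jet" where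
  "jet M E \<pi> x s =
     (x, {t. local_section M E \<pi> x t \<and> t x = s x \<and>
             (\<forall>v\<in>tangent_space M x. tmap E t x v = tmap E s x v)})"

definition J1 ::
  "('a, 'e::euclidean_space) atlas \<Rightarrow> ('b, 'f::euclidean_space) atlas \<Rightarrow> ('b \<Rightarrow> 'a) \<Rightarrow> ('a, 'b) jet set" where
  "J1 M E \<pi> = {jet M E \<pi> x s |x s. x \<in> carrier M \<and> local_section M E \<pi> x s}"

definition jrep :: "('a, 'b) jet \<Rightarrow> 'a \<Rightarrow> 'b" where
  "jrep j = (SOME s. s \<in> snd j)"

definition jsource :: "('a, 'b) jet \<Rightarrow> 'a" where
  "jsource j = fst j"

definition jtarget :: "('a, 'b) jet \<Rightarrow> 'b" where
  "jtarget j = jrep j (fst j)"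

text \<open>
  The induced coordinates \<open>(x, y, y\<^sub>\<mu>)\<close> of a jet. They do not depend on the
  representative, because representatives have the same tangent map at the source.
\<close>

definition J1_atlas ::
  "('a, real^'m) atlas \<Rightarrow> ('b, (real^'m) \<times> 'f::euclidean_space) atlas \<Rightarrow> ('b \<Rightarrow> 'a) \<Rightarrow>
   (('a, 'b) jet, ((real^'m) \<times> 'f) \<times> ('f^'m)) atlas" where
  "J1_atlas M E \<pi> =
     {({j \<in> J1 M E \<pi>. jtarget j \<in> V},
       \<lambda>j. (\<psi> (jtarget j),
            \<chi> \<mu>. frechet_derivative (snd \<circ> \<psi> \<circ> jrep j \<circ> inv_into U \<phi>) (at (\<phi> (jsource j))) (axis \<mu> 1)))
      |U \<phi> V \<psi>. (U, \<phi>) \<in> M \<and> (V, \<psi>) \<in> E \<and> (\<forall>e\<in>V. \<pi> e \<in> U \<and> fst (\<psi> e) = \<phi> (\<pi> e))}"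

text \<open>The contact (Cartan) form \<open>T \<pi>\<^sub>1\<^sub>0 - T s \<circ> T \<pi>\<^sub>1\<close> at a jet of \<open>s\<close>.\<close>

definition contact_form ::
  "('a, 'e::euclidean_space) atlas \<Rightarrow> ('b, 'f::euclidean_space) atlas \<Rightarrow> ('a, 'b) jet \<Rightarrow> ('a, 'b) jet tvec \<Rightarrow> 'b tvec" where
  "contact_form M E j W =
     (\<lambda>f. tmap E jtarget j W f - tmap E (jrep j) (jsource j) (tmap M jsource j W) f)"


section \<open>Matrices\<close>

text \<open>The index \<open>i0\<close> is the distinguished (time-like) one; \<open>A $ i $ j\<close> is \<open>A\<^sup>i\<^sub>j\<close>.\<close>

definition \<eta> :: "'m::finite \<Rightarrow> real^'m^'m" where
  "\<eta> i0 = (\<chi> i j. if i = j then (if i = i0 then - 1 else 1) else 0)"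

definition K :: "'m::finite \<Rightarrow> (real^'m^'m) set" where
  "K i0 = {A. invertible A \<and> transpose A ** \<eta> i0 ** A = \<eta> i0}"

definition \<pi>\<^sub>\<kk> :: "'m::finite \<Rightarrow> real^'m^'m \<Rightarrow> real^'m^'m" where
  "\<pi>\<^sub>\<kk> i0 A = (1/2) *\<^sub>R (A - \<eta> i0 ** transpose A ** \<eta> i0)"

definition \<pi>\<^sub>\<pp> :: "'m::finite \<Rightarrow> real^'m^'m \<Rightarrow> real^'m^'m" where
  "\<pi>\<^sub>\<pp> i0 A = (1/2) *\<^sub>R (A + \<eta> i0 ** transpose A ** \<eta> i0)"

text \<open>\<open>*\<close> on \<^typ>\<open>real^'m^'m\<close> is componentwise, so the library's \<open>exp\<close> is of no use here.\<close>

definition mexp :: "real^'m^'m \<Rightarrow> real^'m^'m" where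
  "mexp A = (\<Sum>n. (1 / fact n) *\<^sub>R (((**) A ^^ n) (mat 1)))"


section \<open>The frame bundle\<close>

type_synonym ('a, 'm) frame = "'a \<times> ('m \<Rightarrow> 'a tvec)"

definition LM :: "('a, real^'m) atlas \<Rightarrow> ('a, 'm) frame set" where
  "LM M = {(x, u). x \<in> carrier M \<and> (\<forall>i. u i \<in> tangent_space M x) \<and>
     (\<forall>v\<in>tangent_space M x. \<exists>!c::real^'m. v = (\<lambda>f. \<Sum>i\<in>UNIV. c $ i * u i f))}"

definition frame_matrix :: "('a \<Rightarrow> real^'m) \<Rightarrow> ('a, 'm) frame \<Rightarrow> real^'m^'m" where
  "frame_matrix \<phi> p = (\<chi> i j. snd p j (\<lambda>y. \<phi> y $ i))"

definition LM_atlas :: "('a, real^'m) atlas \<Rightarrow> (('a, 'm) frame, (real^'m) \<times> (real^'m^'m)) atlas" where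
  "LM_atlas M =
     {({p \<in> LM M. fst p \<in> U}, \<lambda>p. (\<phi> (fst p), frame_matrix \<phi> p)) |U \<phi>. (U, \<phi>) \<in> M}"

definition act :: "('a, 'm::finite) frame \<Rightarrow> real^'m^'m \<Rightarrow> ('a, 'm) frame" where
  "act p A = (fst p, \<lambda>j f. \<Sum>i\<in>UNIV. A $ i $ j * snd p i f)"

definition fundamental :: "('a, real^'m) atlas \<Rightarrow> ('a, 'm) frame \<Rightarrow> real^'m^'m \<Rightarrow> ('a, 'm) frame tvec" where
  "fundamental M p A =
     (\<lambda>f. if smooth_near (LM_atlas M) p f then deriv (\<lambda>t. f (act p (mexp (t *\<^sub>R A)))) 0 else 0)"

definition principal_connection ::
  "('a, real^'m) atlas \<Rightarrow> (('a, 'm) frame \<Rightarrow> ('a, 'm) frame tvec \<Rightarrow> real^'m^'m) \<Rightarrow> bool" where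
  "principal_connection M \<omega>\<^sub>0 \<longleftrightarrow>
     (\<forall>p\<in>LM M.
        (\<forall>v\<in>tangent_space (LM_atlas M) p. \<forall>w\<in>tangent_space (LM_atlas M) p. \<forall>a b.
           \<omega>\<^sub>0 p (\<lambda>f. a * v f + b * w f) = a *\<^sub>R \<omega>\<^sub>0 p v + b *\<^sub>R \<omega>\<^sub>0 p w) \<and>
        (\<forall>A. \<omega>\<^sub>0 p (fundamental M p A) = A) \<and>
        (\<forall>g. invertible g \<longrightarrow> (\<forall>v\<in>tangent_space (LM_atlas M) p.
           \<omega>\<^sub>0 (act p g) (tmap (LM_atlas M) (\<lambda>q. act q g) p v) = matrix_inv g ** \<omega>\<^sub>0 p v ** g))) \<and>
     (\<forall>c\<in>LM_atlas M. \<forall>b. \<forall>p\<in>fst c.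
        smooth_near (LM_atlas M) p (\<lambda>q. \<omega>\<^sub>0 q (coord_vec (LM_atlas M) c b q)))"


section \<open>The bundle of metrics \<open>\<Sigma> = LM / K\<close>\<close>

definition p_LM :: "'m::finite \<Rightarrow> ('a, 'm) frame \<Rightarrow> ('a, 'm) frame set" where
  "p_LM i0 p = act p ` K i0"

definition Sig :: "('a, real^'m) atlas \<Rightarrow> 'm \<Rightarrow> ('a, 'm) frame set set" where
  "Sig M i0 = p_LM i0 ` LM M"

definition tau_Sig :: "('a, 'm::finite) frame set \<Rightarrow> 'a" where
  "tau_Sig e = the_elem (fst ` e)"

text \<open>
  The coordinates of an orbit are its base point and the components \<open>g\<^sup>\<mu>\<^sup>\<nu>\<close> of the inverse of
  the metric for which its frames are orthonormal, \<open>U \<eta> U\<^sup>T\<close> for the matrix \<open>U\<close> of a frame.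
  The lemmas \<open>metric_orbit_invariant\<close> and \<open>metric_submersion\<close> below are the reason why these are charts for the quotient manifold: the
  coordinates are a complete invariant of the orbit, and \<open>U \<mapsto> U \<eta> U\<^sup>T\<close> is a submersion into the
  symmetric matrices. Symmetric matrices are encoded by their independent entries.
\<close>

definition sym_entries :: "real^'m^'m \<Rightarrow> real^('m uprod)" where
  "sym_entries S = (\<chi> q. THE c. \<exists>i k. q = Upair i k \<and> c = S $ i $ k)"

definition frame_metric :: "'m \<Rightarrow> ('a \<Rightarrow> real^'m) \<Rightarrow> ('a, 'm) frame \<Rightarrow> real^'m^'m" where
  "frame_metric i0 \<phi> p = frame_matrix \<phi> p ** \<eta> i0 ** transpose (frame_matrix \<phi> p)"

definition Sig_atlas ::
  "('a, real^'m) atlas \<Rightarrow> 'm \<Rightarrow> (('a, 'm) frame set, (real^'m) \<times> (real^('m uprod))) atlas" where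
  "Sig_atlas M i0 =
     {({e \<in> Sig M i0. tau_Sig e \<in> U},
       \<lambda>e. (\<phi> (tau_Sig e), sym_entries (the_elem (frame_metric i0 \<phi> ` e)))) |U \<phi>. (U, \<phi>) \<in> M}"

lemma eta_eta: "\<eta> i0 ** \<eta> i0 = mat 1"
proof -
  have "(\<Sum>k\<in>UNIV. \<eta> i0 $ i $ k * \<eta> i0 $ k $ j) = mat 1 $ i $ j" for i j
  proof -
    have "(\<Sum>k\<in>UNIV. \<eta> i0 $ i $ k * \<eta> i0 $ k $ j)
        = (\<Sum>k\<in>UNIV. if k = i then (if i = j then 1 else 0) else 0)"
      by (rule sum.cong) (auto simp: \<eta>_def)
    then show ?thesis by (simp add: mat_def)
  qed
  then show ?thesis by (simp add: matrix_matrix_mult_def vec_eq_iff)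
qed

lemma transpose_eta: "transpose (\<eta> i0) = \<eta> i0"
  by (auto simp: \<eta>_def transpose_def vec_eq_iff)

lemma K_iff: "k \<in> K i0 \<longleftrightarrow> k ** \<eta> i0 ** transpose k = \<eta> i0"
proof -
  let ?e = "\<eta> i0"
  let ?l = "?e ** transpose k ** ?e"
  have left: "?e ** X = mat 1 \<longleftrightarrow> X = ?e" for X
  proof
    assume "?e ** X = mat 1"
    then have "?e ** (?e ** X) = ?e" by simp
    then show "X = ?e" by (simp add: matrix_mul_assoc eta_eta)
  qed (simp add: eta_eta)
  have right: "X ** ?e = mat 1 \<longleftrightarrow> X = ?e" for X
    using left matrix_left_right_inverse by blast
  have "k \<in> K i0 \<longleftrightarrow> invertible k \<and> ?l ** k = mat 1"
    using left[of "transpose k ** ?e ** k"] by (simp add: K_def matrix_mul_assoc)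
  also have "\<dots> \<longleftrightarrow> k ** ?l = mat 1"
    unfolding invertible_def using matrix_left_right_inverse by blast
  also have "\<dots> \<longleftrightarrow> k ** ?e ** transpose k = ?e"
    using right[of "k ** ?e ** transpose k"] by (simp add: matrix_mul_assoc)
  finally show ?thesis .
qed

lemma metric_orbit_invariant:
  fixes U V :: "real^'m^'m"
  assumes "invertible U" "invertible V"
  shows "U ** \<eta> i0 ** transpose U = V ** \<eta> i0 ** transpose V \<longleftrightarrow> (\<exists>k\<in>K i0. V = U ** k)"
proof
  assume eq: "U ** \<eta> i0 ** transpose U = V ** \<eta> i0 ** transpose V"
  obtain U' where U': "U ** U' = mat 1" "U' ** U = mat 1"
    using assms(1) unfolding invertible_def by blast
  have t: "transpose U ** transpose U' = mat 1"
    using arg_cong[OF U'(2), of transpose] by (simp add: matrix_transpose_mul)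
  have "(U' ** V) ** \<eta> i0 ** transpose (U' ** V) = U' ** (V ** \<eta> i0 ** transpose V) ** transpose U'"
    by (simp add: matrix_transpose_mul matrix_mul_assoc)
  also have "\<dots> = (U' ** U) ** \<eta> i0 ** (transpose U ** transpose U')"
    by (simp add: eq[symmetric] matrix_mul_assoc)
  finally have "U' ** V \<in> K i0" by (simp add: K_iff U' t)
  moreover have "V = U ** (U' ** V)" by (simp add: matrix_mul_assoc U')
  ultimately show "\<exists>k\<in>K i0. V = U ** k" by blast
next
  assume "\<exists>k\<in>K i0. V = U ** k"
  then obtain k where k: "k ** \<eta> i0 ** transpose k = \<eta> i0" and V: "V = U ** k"
    by (auto simp: K_iff)
  have "V ** \<eta> i0 ** transpose V = U ** (k ** \<eta> i0 ** transpose k) ** transpose U"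
    by (simp add: V matrix_transpose_mul matrix_mul_assoc)
  then show "U ** \<eta> i0 ** transpose U = V ** \<eta> i0 ** transpose V" by (simp add: k)
qed

lemma metric_submersion:
  fixes U S :: "real^'m^'m"
  assumes "invertible U" "transpose S = S"
  shows "\<exists>B. B ** \<eta> i0 ** transpose U + U ** \<eta> i0 ** transpose B = S"
proof -
  obtain U' where U': "U ** U' = mat 1" "U' ** U = mat 1"
    using assms(1) unfolding invertible_def by blast
  let ?B = "((1/2) *\<^sub>R S) ** transpose U' ** \<eta> i0"
  have t: "transpose U' ** transpose U = mat 1"
    using arg_cong[OF U'(1), of transpose] by (simp add: matrix_transpose_mul)
  have "?B ** \<eta> i0 ** transpose U = ((1/2) *\<^sub>R S) ** (transpose U' ** (\<eta> i0 ** \<eta> i0) ** transpose U)"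
    by (simp only: matrix_mul_assoc)
  then have "?B ** \<eta> i0 ** transpose U = (1/2) *\<^sub>R S"
    by (simp add: eta_eta t)
  moreover have "U ** \<eta> i0 ** transpose ?B = (U ** (\<eta> i0 ** \<eta> i0) ** U') ** ((1/2) *\<^sub>R S)"
    by (simp only: matrix_transpose_mul transpose_transpose transpose_eta transpose_scalar assms(2)
        matrix_mul_assoc)
  then have "U ** \<eta> i0 ** transpose ?B = (1/2) *\<^sub>R S"
    by (simp add: eta_eta U')
  ultimately have "?B ** \<eta> i0 ** transpose U + U ** \<eta> i0 ** transpose ?B = S"
    by (simp only: scaleR_left_distrib[symmetric]) simp
  then show ?thesis by blast
qed


section \<open>The jet bundle of \<open>LM\<close> and its quotient by \<open>K\<close>\<close>

type_synonym ('a, 'm) adj = "(('a, 'm) frame \<times> (real^'m^'m)) set"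

abbreviation J1_tau :: "('a, real^'m) atlas \<Rightarrow> ('a, ('a, 'm) frame) jet set" where
  "J1_tau M \<equiv> J1 M (LM_atlas M) fst"

abbreviation J1_tau_atlas where
  "J1_tau_atlas M \<equiv> J1_atlas M (LM_atlas M) fst"

abbreviation J1_tau_Sig_atlas where
  "J1_tau_Sig_atlas M i0 \<equiv> J1_atlas M (Sig_atlas M i0) tau_Sig"

definition jact ::
  "('a, real^'m) atlas \<Rightarrow> ('a, ('a, 'm) frame) jet \<Rightarrow> real^'m^'m \<Rightarrow> ('a, ('a, 'm) frame) jet" where
  "jact M j g = jet M (LM_atlas M) fst (jsource j) (\<lambda>y. act (jrep j y) g)"

definition p_J1 ::
  "('a, real^'m) atlas \<Rightarrow> 'm \<Rightarrow> ('a, ('a, 'm) frame) jet \<Rightarrow> ('a, ('a, 'm) frame) jet set" where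
  "p_J1 M i0 j = jact M j ` K i0"

text \<open>
  The gl(m)-valued Cartan form: the contact form of \<open>J\<^sup>1\<tau>\<close> read through
  \<open>V\<tau> \<simeq> LM \<times> gl(m)\<close>.
\<close>

definition cartan ::
  "('a, real^'m) atlas \<Rightarrow> ('a, ('a, 'm) frame) jet \<Rightarrow> ('a, ('a, 'm) frame) jet tvec \<Rightarrow> real^'m^'m" where
  "cartan M j W = (THE A. fundamental M (jtarget j) A = contact_form M (LM_atlas M) j W)"

definition metricity ::
  "('a, real^'m) atlas \<Rightarrow> 'm \<Rightarrow> ('a, ('a, 'm) frame) jet \<Rightarrow> ('a, ('a, 'm) frame) jet tvec \<Rightarrow> real^'m^'m" where
  "metricity M i0 j W = \<pi>\<^sub>\<pp> i0 (cartan M j W)"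

text \<open>The class \<open>[p, B]\<^sub>K\<close> in \<open>(LM \<times> \<kk>) / K\<close>, where \<open>K\<close> acts on \<open>\<kk>\<close> by the adjoint action.\<close>

definition adj_class :: "'m::finite \<Rightarrow> ('a, 'm) frame \<Rightarrow> real^'m^'m \<Rightarrow> ('a, 'm) adj" where
  "adj_class i0 p B = (\<lambda>k. (act p k, matrix_inv k ** B ** k)) ` K i0"

text \<open>An element of \<open>Lin(\<tau>\<^sub>\<Sigma>\<^sup>*TM, ad)\<close> over \<open>x\<close> is a function restricted to the tangent space at \<open>x\<close>.\<close>

definition Upsilon ::
  "('a, real^'m) atlas \<Rightarrow> 'm \<Rightarrow> (('a, 'm) frame \<Rightarrow> ('a, 'm) frame tvec \<Rightarrow> real^'m^'m) \<Rightarrow>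
   ('a, ('a, 'm) frame) jet \<Rightarrow>
   ('a, 'm) frame \<times> ('a, ('a, 'm) frame set) jet \<times> ('a tvec \<Rightarrow> ('a, 'm) adj)" where
  "Upsilon M i0 \<omega>\<^sub>0 j =
     (let x = jsource j; s = jrep j in
      (s x,
       jet M (Sig_atlas M i0) tau_Sig x (p_LM i0 \<circ> s),
       \<lambda>v\<in>tangent_space M x. adj_class i0 (s x) (\<pi>\<^sub>\<kk> i0 (\<omega>\<^sub>0 (s x) (tmap (LM_atlas M) s x v)))))"

text \<open>The map induced on \<open>J\<^sup>1\<tau> / K\<close>: the common value on an orbit, with the frame forgotten.\<close>

definition Upsilon_bar ::
  "('a, real^'m) atlas \<Rightarrow> 'm \<Rightarrow> (('a, 'm) frame \<Rightarrow> ('a, 'm) frame tvec \<Rightarrow> real^'m^'m) \<Rightarrow>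
   ('a, ('a, 'm) frame) jet set \<Rightarrow>
   ('a, ('a, 'm) frame set) jet \<times> ('a tvec \<Rightarrow> ('a, 'm) adj)" where
  "Upsilon_bar M i0 \<omega>\<^sub>0 c = (THE b. \<forall>j\<in>c. snd (Upsilon M i0 \<omega>\<^sub>0 j) = b)"

definition pr_Sig :: "'u \<times> 'j \<times> 'l \<Rightarrow> 'u \<times> 'j" where
  "pr_Sig = (\<lambda>(e, j, \<alpha>). (e, j))"

definition P_map ::
  "('a, real^'m) atlas \<Rightarrow> 'm \<Rightarrow> (('a, 'm) frame \<Rightarrow> ('a, 'm) frame tvec \<Rightarrow> real^'m^'m) \<Rightarrow>
   ('a, ('a, 'm) frame) jet \<Rightarrow> ('a, ('a, 'm) frame set) jet" where
  "P_map M i0 \<omega>\<^sub>0 = snd \<circ> pr_Sig \<circ> Upsilon M i0 \<omega>\<^sub>0"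

end

theory Submission
  imports Defs
begin

text \<open>
  Push the Cartan form at \<open>j = j\<^sup>1\<^sub>xs\<close> forward along \<open>p = p_LM\<close>. Since \<open>\<tau>\<^sub>\<Sigma> \<circ> p = \<tau>\<close>, the map \<open>P\<close>
  covers \<open>p\<close> on targets, preserves sources and sends \<open>j\<close> to the jet of \<open>p \<circ> s\<close>, so both terms of
  \<open>T\<tau>\<^sub>1\<^sub>0 - Ts \<circ> T\<tau>\<^sub>1\<close> are carried to those of the contact form on the jets of metrics; hence
  \<open>Tp \<circ> \<omega> = P\<^sup>* \<omega>'\<close>. In coordinates \<open>p\<close> is \<open>(x, U) \<mapsto> (x, U \<eta> U\<^sup>T)\<close>, so \<open>Tp\<close> sends the vertical vector \<open>U A\<close> to
  \<open>U (A \<eta> + \<eta> A\<^sup>T) U\<^sup>T\<close>, which depends on \<open>A\<close> only through \<open>A\<^sub>\<pp>\<close> and vanishes only if \<open>A\<^sub>\<pp> = 0\<close>. The first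
  fact replaces \<open>\<omega>\<close> by \<open>\<omega>\<^sub>\<pp>\<close>, the second gives horizontality.

  The tangent vectors being derivations, their coordinate expression rests on Hadamard's lemma. Both
  \<open>LM\<close> and \<open>\<Sigma>\<close> are treated as locally trivial bundles whose fibre is an open subset of a Euclidean
  space; for \<open>\<Sigma>\<close> openness is the open mapping property of the submersion \<open>U \<mapsto> U \<eta> U\<^sup>T\<close>.
\<close>

section \<open>Calculus of smooth functions\<close>

text \<open>On jets a tangent vector \<open>W\<close> stays an abstract derivation, evaluated on
  functions that factor through \<open>jtarget\<close> or \<open>jsource\<close>. Such functions are
  smooth because the jet coordinates contain those of the target. So both sides of the identity are
  compared through \<open>W (f \<circ> jtarget \<circ> P) = W (f \<circ> p_LM \<circ>
  jtarget)\<close>. The representative of a jet is an arbitrary choice, known only through its value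
  and its tangent map at the source; the contact form uses nothing else.

  Functions are total on their types, while the identities between them hold only on frames, metrics
  or jets. Locality of derivations reconciles the two, provided that chart images contain enough
  open sets. For jets this holds because an affine section realises any prescribed first-order data.

  The connection affects the \<open>Lin\<close> component of \<open>Upsilon\<close>, which
  \<open>P\<close> forgets. Its equivariance makes that component constant on
  \<open>K\<close>-orbits, so that \<open>Upsilon_bar\<close> has a well-defined value and
  \<open>P\<close> factors through the quotient.\<close>

lemma frechet_derivative_cong_open:
  assumes "open S" "x \<in> S" "\<And>y. y \<in> S \<Longrightarrow> f y = g y"
  shows "frechet_derivative f (at x) = frechet_derivative g (at x)"
proof -
  have "(f has_derivative D) (at x) \<longleftrightarrow> (g has_derivative D) (at x)" for D
    using has_derivative_transform_within_open[of f D x UNIV S g]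
      has_derivative_transform_within_open[of g D x UNIV S f] assms by auto
  then show ?thesis by (simp add: frechet_derivative_def)
qed

lemma Ck_on_SucI:
  assumes "open S" "\<And>x. x \<in> S \<Longrightarrow> (f has_derivative D x) (at x)"
    and "\<And>v. Ck_on k S (\<lambda>x. D x v)"
    and cong: "\<And>f g::'a::real_normed_vector \<Rightarrow> 'b::real_normed_vector.
      (\<And>x. x \<in> S \<Longrightarrow> f x = g x) \<Longrightarrow> Ck_on k S f \<Longrightarrow> Ck_on k S g"
  shows "Ck_on (Suc k) S (f::'a::real_normed_vector \<Rightarrow> 'b::real_normed_vector)"
proof -
  have "D x v = frechet_derivative f (at x) v" if "x \<in> S" for x v
    using frechet_derivative_at[OF assms(2)[OF that]] by simp
  then have "Ck_on k S (\<lambda>x. frechet_derivative f (at x) v)" for v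
    by (rule cong[OF _ assms(3)])
  moreover have "f differentiable_on S"
    using assms(2) by (auto simp: differentiable_on_def differentiable_def intro: has_derivative_at_withinI)
  ultimately show ?thesis by simp
qed

lemma Ck_on_SucD:
  assumes "Ck_on (Suc k) S f" "open S" "x \<in> S"
  shows "(f has_derivative frechet_derivative f (at x)) (at x)"
  using assms by (metis Ck_on.simps(2) differentiable_on_eq_differentiable_at frechet_derivative_works)

lemma Ck_on_cong:
  fixes f g :: "'a::real_normed_vector \<Rightarrow> 'b::real_normed_vector"
  assumes "open S"
  shows "(\<And>x. x \<in> S \<Longrightarrow> f x = g x) \<Longrightarrow> Ck_on k S f \<Longrightarrow> Ck_on k S g"
proof (induction k arbitrary: f g)
  case 0
  then show ?case by (simp cong: continuous_on_cong)
next
  case (Suc k)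
  show ?case
  proof (rule Ck_on_SucI[OF assms])
    show "(g has_derivative frechet_derivative f (at x)) (at x)" if "x \<in> S" for x
      using has_derivative_transform_within_open[OF Ck_on_SucD[OF Suc.prems(2) assms that] assms that]
        Suc.prems(1) by auto
    show "Ck_on k S (\<lambda>x. frechet_derivative f (at x) v)" for v
      using Suc.prems(2) by simp
  qed (use Suc.IH in blast)
qed

lemmas Ck_on_Suc_intro = Ck_on_SucI[OF _ _ _ Ck_on_cong]

lemma Ck_on_Suc_imp: "Ck_on (Suc k) S f \<Longrightarrow> Ck_on k S f"
  by (induction k arbitrary: f) (auto intro: differentiable_imp_continuous_on)

lemma Ck_on_subset: "Ck_on k S f \<Longrightarrow> T \<subseteq> S \<Longrightarrow> Ck_on k T f"
  by (induction k arbitrary: f) (auto intro: continuous_on_subset differentiable_on_subset)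

lemma Ck_on_const: "open S \<Longrightarrow> Ck_on k S (\<lambda>x. c)"
proof (induction k arbitrary: c)
  case (Suc k)
  show ?case
    by (rule Ck_on_Suc_intro[where D = "\<lambda>_ _. 0"]) (use Suc in auto)
qed simp

lemma Ck_on_linear:
  assumes "bounded_linear f" "open S"
  shows "Ck_on k S f"
proof (cases k)
  case 0
  then show ?thesis using assms by (simp add: linear_continuous_on)
next
  case (Suc l)
  show ?thesis unfolding Suc
    by (rule Ck_on_Suc_intro[where D = "\<lambda>_. f"])
      (use assms in \<open>auto intro: bounded_linear_imp_has_derivative Ck_on_const\<close>)
qed

lemma Ck_on_compose_linear:
  assumes "bounded_linear h" "open S"
  shows "Ck_on k S f \<Longrightarrow> Ck_on k S (\<lambda>x. h (f x))"
proof (induction k arbitrary: f)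
  case 0
  then show ?case
    using assms(1) bounded_linear.continuous_on by auto
next
  case (Suc k)
  show ?case
  proof (rule Ck_on_Suc_intro[OF assms(2)])
    show "((\<lambda>x. h (f x)) has_derivative (\<lambda>v. h (frechet_derivative f (at x) v))) (at x)"
      if "x \<in> S" for x
      by (rule bounded_linear.has_derivative[OF assms(1) Ck_on_SucD[OF Suc.prems assms(2) that]])
    show "Ck_on k S (\<lambda>x. h (frechet_derivative f (at x) v))" for v
      using Suc by simp
  qed (use assms(2) in blast)
qed

lemma Ck_on_add:
  assumes "open S"
  shows "Ck_on k S f \<Longrightarrow> Ck_on k S g \<Longrightarrow> Ck_on k S (\<lambda>x. f x + g x)"
proof (induction k arbitrary: f g)
  case 0
  then show ?case by (auto intro: continuous_on_add)
next
  case (Suc k)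
  show ?case
  proof (rule Ck_on_Suc_intro[OF assms])
    show "((\<lambda>x. f x + g x) has_derivative
        (\<lambda>v. frechet_derivative f (at x) v + frechet_derivative g (at x) v)) (at x)" if "x \<in> S" for x
      by (intro has_derivative_add Ck_on_SucD[of k, OF _ assms that] Suc.prems)
    show "Ck_on k S (\<lambda>x. frechet_derivative f (at x) v + frechet_derivative g (at x) v)" for v
      using Suc by simp
  qed (use assms in blast)
qed

lemma Ck_on_sum:
  assumes "open S" "\<And>i. i \<in> I \<Longrightarrow> Ck_on k S (f i)"
  shows "Ck_on k S (\<lambda>x. \<Sum>i\<in>I. f i x)"
  using assms(2)
  by (induction I rule: infinite_finite_induct)
    (auto intro: Ck_on_const Ck_on_add assms(1))

lemma Ck_on_bilinear:
  assumes "bounded_bilinear h" "open S"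
  shows "Ck_on k S f \<Longrightarrow> Ck_on k S g \<Longrightarrow> Ck_on k S (\<lambda>x. h (f x) (g x))"
proof (induction k arbitrary: f g)
  case 0
  then show ?case using assms(1) bounded_bilinear.continuous_on by auto
next
  case (Suc k)
  let ?D = "\<lambda>x v. h (f x) (frechet_derivative g (at x) v) + h (frechet_derivative f (at x) v) (g x)"
  show ?case
  proof (rule Ck_on_Suc_intro[OF assms(2)])
    show "((\<lambda>x. h (f x) (g x)) has_derivative ?D x) (at x)" if "x \<in> S" for x
      by (intro bounded_bilinear.FDERIV[OF assms(1)] Ck_on_SucD[of k, OF _ assms(2) that] Suc.prems)
    show "Ck_on k S (\<lambda>x. ?D x v)" for v
      using Suc.prems Suc.prems[THEN Ck_on_Suc_imp] by (intro Ck_on_add Suc.IH assms(2)) simp_all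
  qed (use assms in blast)
qed

lemma Ck_on_compose:
  fixes f :: "'a::real_normed_vector \<Rightarrow> 'b::euclidean_space" and g :: "'b \<Rightarrow> 'c::real_normed_vector"
  assumes "open S" "open T"
  shows "f ` S \<subseteq> T \<Longrightarrow> Ck_on k S f \<Longrightarrow> Ck_on k T g \<Longrightarrow> Ck_on k S (\<lambda>x. g (f x))"
proof (induction k arbitrary: g)
  case 0
  then show ?case by (auto intro: continuous_on_compose2)
next
  case (Suc k)
  \<comment> \<open>The chain rule expanded over \<open>Basis\<close>: the derivative of
    \<open>g\<close> is applied to fixed vectors \<open>b\<close> only, the form that the induction
    hypothesis covers.\<close>
  let ?D = "\<lambda>x v. \<Sum>b\<in>Basis. (frechet_derivative f (at x) v \<bullet> b) *\<^sub>R frechet_derivative g (at (f x)) b"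
  show ?case
  proof (rule Ck_on_Suc_intro[OF assms(1)])
    show "((\<lambda>x. g (f x)) has_derivative ?D x) (at x)" if x: "x \<in> S" for x
    proof -
      have f: "(f has_derivative frechet_derivative f (at x)) (at x)"
        by (rule Ck_on_SucD[OF Suc.prems(2) assms(1) x])
      have g: "(g has_derivative frechet_derivative g (at (f x))) (at (f x))"
        using x Suc.prems(1) by (intro Ck_on_SucD[OF Suc.prems(3) assms(2)]) auto
      interpret g: bounded_linear "frechet_derivative g (at (f x))"
        using g by (rule has_derivative_bounded_linear)
      have "?D x = (\<lambda>v. frechet_derivative g (at (f x)) (frechet_derivative f (at x) v))"
        by (rule ext, subst (2) euclidean_representation[symmetric])
          (simp only: g.sum g.scaleR)
      then show ?thesis using has_derivative_compose[OF f g] by simp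
    qed
    have "Ck_on k S f" by (rule Ck_on_Suc_imp[OF Suc.prems(2)])
    then show "Ck_on k S (\<lambda>x. ?D x v)" for v
      using Suc.prems
      by (intro Ck_on_sum Ck_on_bilinear[OF bounded_bilinear_scaleR]
          Ck_on_compose_linear[OF bounded_linear_inner_left] Suc.IH assms) auto
  qed (use assms in blast)
qed

lemma smooth_on_cong:
  "open S \<Longrightarrow> smooth_on S f \<Longrightarrow> (\<And>x. x \<in> S \<Longrightarrow> f x = g x) \<Longrightarrow> smooth_on S g"
  unfolding smooth_on_def by (meson Ck_on_cong)

lemma smooth_on_subset: "smooth_on S f \<Longrightarrow> T \<subseteq> S \<Longrightarrow> smooth_on T f"
  by (auto simp: smooth_on_def intro: Ck_on_subset)

lemma smooth_on_const: "open S \<Longrightarrow> smooth_on S (\<lambda>x. c)"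
  by (simp add: smooth_on_def Ck_on_const)

lemma smooth_on_linear: "bounded_linear f \<Longrightarrow> open S \<Longrightarrow> smooth_on S f"
  by (simp add: smooth_on_def Ck_on_linear)

lemma smooth_on_compose_linear:
  "bounded_linear h \<Longrightarrow> open S \<Longrightarrow> smooth_on S f \<Longrightarrow> smooth_on S (\<lambda>x. h (f x))"
  by (simp add: smooth_on_def Ck_on_compose_linear)

lemma smooth_on_add:
  "open S \<Longrightarrow> smooth_on S f \<Longrightarrow> smooth_on S g \<Longrightarrow> smooth_on S (\<lambda>x. f x + g x)"
  by (simp add: smooth_on_def Ck_on_add)

lemma smooth_on_sum:
  "open S \<Longrightarrow> (\<And>i. i \<in> I \<Longrightarrow> smooth_on S (f i)) \<Longrightarrow> smooth_on S (\<lambda>x. \<Sum>i\<in>I. f i x)"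
  by (simp add: smooth_on_def Ck_on_sum)

lemma smooth_on_bilinear:
  "bounded_bilinear h \<Longrightarrow> open S \<Longrightarrow> smooth_on S f \<Longrightarrow> smooth_on S g \<Longrightarrow> smooth_on S (\<lambda>x. h (f x) (g x))"
  by (simp add: smooth_on_def Ck_on_bilinear)

lemmas smooth_on_mult = smooth_on_bilinear[OF bounded_bilinear_mult]
lemmas smooth_on_scaleR = smooth_on_bilinear[OF bounded_bilinear_scaleR]

lemma smooth_on_compose:
  fixes f :: "'a::real_normed_vector \<Rightarrow> 'b::euclidean_space" and g :: "'b \<Rightarrow> 'c::real_normed_vector"
  shows "open S \<Longrightarrow> open T \<Longrightarrow> smooth_on S f \<Longrightarrow> smooth_on T g \<Longrightarrow> f ` S \<subseteq> T \<Longrightarrow> smooth_on S (\<lambda>x. g (f x))"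
  by (auto simp: smooth_on_def intro: Ck_on_compose)

lemma smooth_on_ident: "open S \<Longrightarrow> smooth_on S (\<lambda>x. x)"
  by (rule smooth_on_linear[OF bounded_linear_ident])

lemma smooth_on_Pair:
  assumes "open S" "smooth_on S f" "smooth_on S g"
  shows "smooth_on S (\<lambda>x. (f x, g x))"
proof -
  have l: "bounded_linear (\<lambda>a. (a, 0))" "bounded_linear (\<lambda>b. (0, b))"
    by (auto intro!: bounded_linear_intros)
  show ?thesis
    using smooth_on_add[OF assms(1) smooth_on_compose_linear[OF l(1) assms(1,2)]
        smooth_on_compose_linear[OF l(2) assms(1,3)]] by simp
qed

lemma smooth_on_snd: "open S \<Longrightarrow> smooth_on S f \<Longrightarrow> smooth_on S (\<lambda>x. snd (f x))"
  by (rule smooth_on_compose_linear[OF bounded_linear_snd])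

lemma smooth_on_componentwise:
  fixes f :: "'a::real_normed_vector \<Rightarrow> 'b::euclidean_space"
  assumes "open S" "\<And>b. b \<in> Basis \<Longrightarrow> smooth_on S (\<lambda>x. f x \<bullet> b)"
  shows "smooth_on S f"
proof -
  have "smooth_on S (\<lambda>x. \<Sum>b\<in>Basis. (f x \<bullet> b) *\<^sub>R b)"
    using assms by (intro smooth_on_sum smooth_on_scaleR smooth_on_const)
  then show ?thesis by (simp add: euclidean_representation)
qed

lemma smooth_on_vec:
  fixes f :: "'a::real_normed_vector \<Rightarrow> 'b::euclidean_space ^ 'n"
  assumes "open S" "\<And>i. smooth_on S (\<lambda>x. f x $ i)"
  shows "smooth_on S f"
proof (rule smooth_on_componentwise[OF assms(1)])
  fix b :: "'b^'n" assume "b \<in> Basis"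
  then obtain i u where b: "b = axis i u" by (auto simp: Basis_vec_def)
  show "smooth_on S (\<lambda>x. f x \<bullet> b)"
    unfolding b inner_axis
    by (intro smooth_on_compose_linear[OF bounded_linear_inner_left] assms)
qed

lemma smooth_on_vec_nth: "open S \<Longrightarrow> smooth_on S f \<Longrightarrow> smooth_on S (\<lambda>x. f x $ i)"
  by (rule smooth_on_compose_linear[OF bounded_linear_vec_nth])

lemma smooth_on_derivative:
  "smooth_on S f \<Longrightarrow> smooth_on S (\<lambda>x. frechet_derivative f (at x) v)"
  unfolding smooth_on_def by (metis Ck_on.simps(2))

lemma smooth_on_has_derivative:
  "smooth_on S f \<Longrightarrow> open S \<Longrightarrow> x \<in> S \<Longrightarrow> (f has_derivative frechet_derivative f (at x)) (at x)"
  unfolding smooth_on_def by (metis Ck_on_SucD)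

lemma smooth_on_imp_continuous_on: "smooth_on S f \<Longrightarrow> continuous_on S f"
  unfolding smooth_on_def by (metis Ck_on.simps(1))

lemma bounded_bilinear_matrix_mult:
  "bounded_bilinear ((**) :: real^'n^'k \<Rightarrow> real^'p^'n \<Rightarrow> real^'p^'k)"
proof (rule bilinear_conv_bounded_bilinear[THEN iffD1])
  show "bilinear ((**) :: real^'n^'k \<Rightarrow> real^'p^'n \<Rightarrow> real^'p^'k)"
    unfolding bilinear_def
    by (auto intro!: linearI simp: vec_eq_iff matrix_matrix_mult_def sum_distrib_left sum.distrib algebra_simps)
qed

lemma bounded_linear_transpose: "bounded_linear (transpose :: real^'n^'k \<Rightarrow> real^'k^'n)"
  by (rule linear_conv_bounded_linear[THEN iffD1], rule linearI) (auto simp: transpose_def vec_eq_iff)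

section \<open>Hadamard's lemma\<close>

text \<open>The factor \<open>t ^ n\<close> is there for the induction: each differentiation in
  \<open>x\<close> under the integral brings out one more \<open>t\<close>, so the induction
  hypothesis is used at \<open>Suc n\<close>.\<close>

lemma Ck_on_integral:
  fixes h :: "'a::euclidean_space \<Rightarrow> real"
  assumes S: "convex S" "open S" "a \<in> S"
  shows "Ck_on k S h \<Longrightarrow> Ck_on k S (\<lambda>x. integral (cbox 0 1) (\<lambda>t::real. t ^ n * h (a + t *\<^sub>R (x - a))))"
proof (induction k arbitrary: h n)
  have mem: "a + t *\<^sub>R (x - a) \<in> S" if "t \<in> {0..1}" "x \<in> S" for t :: real and x
  proof -
    have "a + t *\<^sub>R (x - a) = (1 - t) *\<^sub>R a + t *\<^sub>R x" by (simp add: algebra_simps)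
    then show ?thesis using that S convexD[of S a x "1 - t" t] by auto
  qed
  have cont: "continuous_on (S \<times> cbox 0 1) (\<lambda>(x, t::real). t ^ n * h (a + t *\<^sub>R (x - a)))"
    if "continuous_on S h" for h :: "'a \<Rightarrow> real" and n
    unfolding case_prod_beta
    by (intro continuous_intros continuous_on_compose2[OF that]) (auto intro: mem)
  {
    case 0
    then show ?case using integral_continuous_on_param[OF cont] by simp
  next
    case (Suc k)
    define D where "D = (\<lambda>x. frechet_derivative h (at x))"
    have D: "(h has_derivative D x) (at x)" if "x \<in> S" for x
      unfolding D_def by (rule Ck_on_SucD[OF Suc.prems S(2) that])
    have CD: "Ck_on k S (\<lambda>x. D x v)" for v
      using Suc.prems by (simp add: D_def)
    then have cD: "continuous_on S (\<lambda>x. D x v)" for v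
      by (cases k) (auto intro: differentiable_imp_continuous_on)
    have blD: "bounded_linear (D x)" if "x \<in> S" for x
      using D[OF that] by (rule has_derivative_bounded_linear)
    let ?F = "\<lambda>x t::real. t ^ n * h (a + t *\<^sub>R (x - a))"
    \<comment> \<open>\<open>leibniz_rule\<close> wants the derivative as a bounded operator
      depending continuously on \<open>(x, t)\<close>; continuity of the \<open>blinfun\<close> is
      then checked on basis vectors.\<close>
    define B where "B x t = Blinfun (\<lambda>v. t ^ n * D (a + t *\<^sub>R (x - a)) (t *\<^sub>R v))" for x and t :: real
    have Bv: "blinfun_apply (B x t) v = t ^ Suc n * D (a + t *\<^sub>R (x - a)) v"
      and Fd: "((\<lambda>x. ?F x t) has_derivative blinfun_apply (B x t)) (at x within S)"
      if "x \<in> S" "t \<in> cbox 0 1" for x v t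
    proof -
      have m: "a + t *\<^sub>R (x - a) \<in> S" using mem that by simp
      interpret D: bounded_linear "D (a + t *\<^sub>R (x - a))" by (rule blD[OF m])
      have "((\<lambda>x. a + t *\<^sub>R (x - a)) has_derivative (\<lambda>v. t *\<^sub>R v)) (at x)"
        by (auto intro!: derivative_eq_intros)
      from has_derivative_compose[OF this D[OF m]]
      have d: "((\<lambda>x. ?F x t) has_derivative (\<lambda>v. t ^ n * D (a + t *\<^sub>R (x - a)) (t *\<^sub>R v))) (at x)"
        by (auto intro: has_derivative_mult_right)
      then have *: "blinfun_apply (B x t) = (\<lambda>v. t ^ n * D (a + t *\<^sub>R (x - a)) (t *\<^sub>R v))"
        unfolding B_def by (intro bounded_linear_Blinfun_apply has_derivative_bounded_linear)
      show "blinfun_apply (B x t) v = t ^ Suc n * D (a + t *\<^sub>R (x - a)) v"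
        by (simp add: * D.scaleR)
      show "((\<lambda>x. ?F x t) has_derivative blinfun_apply (B x t)) (at x within S)"
        unfolding * using d by (rule has_derivative_at_withinI)
    qed
    have cB: "continuous_on (S \<times> cbox 0 1) (\<lambda>(x, t). B x t)"
    proof (rule continuous_on_blinfun_componentwise)
      fix i :: 'a
      show "continuous_on (S \<times> cbox 0 1) (\<lambda>z. blinfun_apply (case z of (x, t) \<Rightarrow> B x t) i)"
        by (rule continuous_on_eq[OF cont[OF cD[of i], of "Suc n"]]) (auto simp: Bv)
    qed
    have ch: "continuous_on S h"
      using Suc.prems Ck_on_Suc_imp by (metis Ck_on.simps(2) differentiable_imp_continuous_on)
    have slice: "continuous_on (cbox 0 1) (f x)"
      if "continuous_on (S \<times> cbox (0::real) 1) (\<lambda>(x, t). f x t)" "x \<in> S"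
      for f :: "'a \<Rightarrow> real \<Rightarrow> 'c::real_normed_vector" and x
    proof -
      have "continuous_on (cbox 0 1) (Pair x :: real \<Rightarrow> _)" by (intro continuous_intros)
      from continuous_on_compose2[OF that(1) this] that(2) show ?thesis by auto
    qed
    have cint: "f x integrable_on cbox 0 1"
      if "continuous_on (S \<times> cbox (0::real) 1) (\<lambda>(x, t). f x t)" "x \<in> S"
      for f :: "'a \<Rightarrow> real \<Rightarrow> 'c::banach" and x
      by (rule integrable_continuous[OF slice[OF that]])
    show ?case
    proof (rule Ck_on_Suc_intro[OF S(2)])
      fix x assume x: "x \<in> S"
      have "((\<lambda>x. integral (cbox 0 1) (?F x)) has_derivative integral (cbox 0 1) (B x)) (at x within S)"
        by (rule leibniz_rule[OF Fd cint[OF cont[OF ch]] cB x S(1)])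
      then have "((\<lambda>x. integral (cbox 0 1) (?F x)) has_derivative integral (cbox 0 1) (B x)) (at x)"
        by (simp add: at_within_open[OF x S(2)])
      moreover have "blinfun_apply (integral (cbox 0 1) (B x)) =
          (\<lambda>v. integral (cbox 0 1) (\<lambda>t. t ^ Suc n * D (a + t *\<^sub>R (x - a)) v))"
        by (rule ext, subst blinfun_apply_integral[OF cint[OF cB x]], rule integral_cong, rule Bv[OF x])
      ultimately show "((\<lambda>x. integral (cbox 0 1) (?F x)) has_derivative
          (\<lambda>v. integral (cbox 0 1) (\<lambda>t. t ^ Suc n * D (a + t *\<^sub>R (x - a)) v))) (at x)"
        by simp
    next
      show "Ck_on k S (\<lambda>x. integral (cbox 0 1) (\<lambda>t. t ^ Suc n * D (a + t *\<^sub>R (x - a)) v))" for v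
        by (rule Suc.IH[OF CD])
    qed (use S in blast)
  }
qed

text \<open>\<open>g b x\<close> is the mean of the derivative of \<open>h\<close> in direction
  \<open>b\<close> over the segment from \<open>a\<close> to \<open>x\<close>. The expansion is the
  fundamental theorem of calculus on that segment, which convexity keeps inside
  \<open>S\<close>.\<close>

lemma hadamard:
  fixes h :: "'a::euclidean_space \<Rightarrow> real"
  assumes S: "convex S" "open S" "a \<in> S" and h: "smooth_on S h"
  obtains g where "\<And>b. smooth_on S (g b)" "\<And>b. g b a = frechet_derivative h (at a) b"
    "\<And>x. x \<in> S \<Longrightarrow> h x = h a + (\<Sum>b\<in>Basis. ((x - a) \<bullet> b) * g b x)"
proof
  let ?D = "\<lambda>x. frechet_derivative h (at x)"
  \<comment> \<open>The factor \<open>t ^ 0\<close> puts the integral into the form of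
    \<open>Ck_on_integral\<close>.\<close>
  let ?g = "\<lambda>b x. integral (cbox 0 1) (\<lambda>t::real. t ^ 0 * ?D (a + t *\<^sub>R (x - a)) b)"
  show "smooth_on S (?g b)" for b
    using smooth_on_derivative[OF h, of b] Ck_on_integral[OF S, where n = 0] unfolding smooth_on_def by blast
  show "?g b a = ?D a b" for b by simp
  fix x assume x: "x \<in> S"
  have mem: "a + t *\<^sub>R (x - a) \<in> S" if "t \<in> {0..1}" for t :: real
  proof -
    have "a + t *\<^sub>R (x - a) = (1 - t) *\<^sub>R a + t *\<^sub>R x" by (simp add: algebra_simps)
    then show ?thesis using that S x convexD[of S a x "1 - t" t] by auto
  qed
  have "((\<lambda>t. h (a + t *\<^sub>R (x - a))) has_vector_derivative ?D (a + t *\<^sub>R (x - a)) (x - a)) (at t within {0..1})"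
    if t: "t \<in> {0..1}" for t
  proof -
    have d: "((\<lambda>t. a + t *\<^sub>R (x - a)) has_derivative (\<lambda>s. s *\<^sub>R (x - a))) (at t within {0..1})"
      by (auto intro!: derivative_eq_intros)
    have D: "(h has_derivative ?D (a + t *\<^sub>R (x - a))) (at (a + t *\<^sub>R (x - a)))"
      by (rule smooth_on_has_derivative[OF h S(2) mem[OF t]])
    interpret bounded_linear "?D (a + t *\<^sub>R (x - a))" using D by (rule has_derivative_bounded_linear)
    show ?thesis
      using has_derivative_compose[OF d D] by (simp add: has_vector_derivative_def scaleR)
  qed
  from fundamental_theorem_of_calculus[OF _ this]
  have "((\<lambda>t. ?D (a + t *\<^sub>R (x - a)) (x - a)) has_integral h x - h a) {0..1}" by simp
  then have 1: "integral {0..1} (\<lambda>t. ?D (a + t *\<^sub>R (x - a)) (x - a)) = h x - h a"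
    by (rule integral_unique)
  have eq: "?D (a + t *\<^sub>R (x - a)) (x - a) = (\<Sum>b\<in>Basis. ((x - a) \<bullet> b) * ?D (a + t *\<^sub>R (x - a)) b)"
    if t: "t \<in> {0..1}" for t
  proof -
    interpret bounded_linear "?D (a + t *\<^sub>R (x - a))"
      using smooth_on_has_derivative[OF h S(2) mem[OF t]] by (rule has_derivative_bounded_linear)
    show ?thesis
      by (subst (2) euclidean_representation[symmetric]) (simp only: sum scaleR real_scaleR_def)
  qed
  have int: "(\<lambda>t. ?D (a + t *\<^sub>R (x - a)) b) integrable_on {0..1}" for b
    using mem by (intro integrable_continuous_interval
        continuous_on_compose2[OF smooth_on_imp_continuous_on[OF smooth_on_derivative[OF h]]])
      (auto intro!: continuous_intros)
  have "h x - h a = (\<Sum>b\<in>Basis. ((x - a) \<bullet> b) * integral {0..1} (\<lambda>t. ?D (a + t *\<^sub>R (x - a)) b))"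
    unfolding 1[symmetric]
    by (subst integral_cong[OF eq], assumption, subst integral_sum)
      (auto intro!: integrable_on_mult_right int)
  then show "h x = h a + (\<Sum>b\<in>Basis. ((x - a) \<bullet> b) * ?g b x)" by simp
qed


section \<open>Tangent vectors in coordinates\<close>

lemma smooth_nearI:
  assumes "(U, \<phi>) \<in> A" "p \<in> U" "open W" "\<phi> p \<in> W" "W \<subseteq> \<phi> ` U"
    "smooth_on W (\<lambda>z. f (inv_into U \<phi> z))"
  shows "smooth_near A p f"
  unfolding smooth_near_def using assms by (intro bexI[of _ "(U, \<phi>)"]) (auto simp: comp_def)

lemma tangent_space_local:
  assumes v: "v \<in> tangent_space A p" and g: "smooth_near A p g" and p: "f p = g p"
    and W: "(U, \<phi>) \<in> A" "p \<in> U" "open W" "\<phi> p \<in> W" "W \<subseteq> \<phi> ` U"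
    and eq: "\<And>z. z \<in> W \<Longrightarrow> f (inv_into U \<phi> z) = g (inv_into U \<phi> z)"
  shows "v f = v g"
proof -
  \<comment> \<open>No bump function is needed: the discontinuous indicator \<open>?c\<close> is smooth near \<open>p\<close> and \<open>?h * ?c = ?h\<close>.\<close>
  let ?h = "\<lambda>q. f q - g q" and ?c = "\<lambda>q. if f q = g q then 0 else 1 :: real"
  have h: "smooth_near A p ?h"
    by (rule smooth_nearI[OF W], rule smooth_on_cong[OF W(3) smooth_on_const[OF W(3), of 0]])
      (simp add: eq)
  have c: "smooth_near A p ?c"
    by (rule smooth_nearI[OF W], rule smooth_on_cong[OF W(3) smooth_on_const[OF W(3), of 0]])
      (simp add: eq)
  have "v (\<lambda>q. ?h q * ?c q) = ?h p * v ?c + ?c p * v ?h"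
    using v h c unfolding tangent_space_def by blast
  moreover have "(\<lambda>q. ?h q * ?c q) = ?h" by auto
  ultimately have h0: "v ?h = 0" using p by simp
  have "v (\<lambda>q. g q + ?h q) = v g + v ?h"
    using v g h unfolding tangent_space_def by blast
  then show ?thesis using h0 by simp
qed

text \<open>The chart conditions of \<open>smooth_manifold\<close>, isolated because they are what
  is proved for the atlases of \<open>LM\<close> and \<open>\<Sigma>\<close> as well.\<close>

locale smooth_atlas =
  fixes A :: "('p, 'e::euclidean_space) atlas"
  assumes inj: "(U, \<phi>) \<in> A \<Longrightarrow> inj_on \<phi> U"
    and open_image: "(U, \<phi>) \<in> A \<Longrightarrow> open (\<phi> ` U)"
    and open_overlap: "(U, \<phi>) \<in> A \<Longrightarrow> (V, \<psi>) \<in> A \<Longrightarrow> open (\<phi> ` (U \<inter> V))"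
    and smooth_transition: "(U, \<phi>) \<in> A \<Longrightarrow> (V, \<psi>) \<in> A \<Longrightarrow>
      smooth_on (\<phi> ` (U \<inter> V)) (\<lambda>z. \<psi> (inv_into U \<phi> z))"
begin

lemma inv_chart [simp]: "(U, \<phi>) \<in> A \<Longrightarrow> p \<in> U \<Longrightarrow> inv_into U \<phi> (\<phi> p) = p"
  by (simp add: inj)

text \<open>\<open>smooth_near\<close> only provides some chart at \<open>p\<close>; composing with
  the transition map moves the smoothness to the chart at hand.\<close>

lemma smooth_near_chart:
  assumes "smooth_near A p f" "(U, \<phi>) \<in> A" "p \<in> U"
  obtains W where "open W" "\<phi> p \<in> W" "W \<subseteq> \<phi> ` U" "smooth_on W (\<lambda>z. f (inv_into U \<phi> z))"
proof -
  obtain V \<psi> W' where V: "(V, \<psi>) \<in> A" "p \<in> V"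
    and W': "open W'" "\<psi> p \<in> W'" "W' \<subseteq> \<psi> ` V" "smooth_on W' (\<lambda>z. f (inv_into V \<psi> z))"
    using assms(1) unfolding smooth_near_def comp_def by blast
  let ?t = "\<lambda>z. \<psi> (inv_into U \<phi> z)"
  define W where "W = \<phi> ` (U \<inter> V) \<inter> ?t -` W'"
  have W: "open W"
    unfolding W_def
    by (rule continuous_open_preimage[OF smooth_on_imp_continuous_on[OF
          smooth_transition[OF assms(2) V(1)]] open_overlap[OF assms(2) V(1)] W'(1)])
  have "smooth_on W (\<lambda>z. f (inv_into V \<psi> (?t z)))"
    by (rule smooth_on_compose[OF W W'(1) smooth_on_subset[OF smooth_transition[OF assms(2) V(1)]] W'(4)])
      (auto simp: W_def)
  then have "smooth_on W (\<lambda>z. f (inv_into U \<phi> z))"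
    by (rule smooth_on_cong[OF W]) (auto simp: W_def assms(2) V(1))
  moreover have "\<phi> p \<in> W" "W \<subseteq> \<phi> ` U" using assms V W' by (auto simp: W_def)
  ultimately show ?thesis using that W by blast
qed

lemma smooth_near_chart2:
  assumes "smooth_near A p f" "smooth_near A p g" "(U, \<phi>) \<in> A" "p \<in> U"
  obtains W where "open W" "\<phi> p \<in> W" "W \<subseteq> \<phi> ` U" "smooth_on W (\<lambda>z. f (inv_into U \<phi> z))"
    "smooth_on W (\<lambda>z. g (inv_into U \<phi> z))"
proof -
  obtain W1 where W1: "open W1" "\<phi> p \<in> W1" "W1 \<subseteq> \<phi> ` U" "smooth_on W1 (\<lambda>z. f (inv_into U \<phi> z))"
    using smooth_near_chart assms(1,3,4) by metis
  obtain W2 where W2: "open W2" "\<phi> p \<in> W2" "W2 \<subseteq> \<phi> ` U" "smooth_on W2 (\<lambda>z. g (inv_into U \<phi> z))"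
    using smooth_near_chart assms(2-4) by metis
  show ?thesis
    by (rule that[of "W1 \<inter> W2"]) (use W1 W2 in \<open>auto intro: smooth_on_subset\<close>)
qed

lemma smooth_near_domainE:
  assumes "smooth_near A p f"
  obtains U \<phi> where "(U, \<phi>) \<in> A" "p \<in> U"
  using assms unfolding smooth_near_def by blast

lemma smooth_near_add:
  assumes "smooth_near A p f" "smooth_near A p g"
  shows "smooth_near A p (\<lambda>q. f q + g q)"
proof -
  obtain U \<phi> where U: "(U, \<phi>) \<in> A" "p \<in> U" using smooth_near_domainE[OF assms(1)] .
  obtain W where "open W" "\<phi> p \<in> W" "W \<subseteq> \<phi> ` U" "smooth_on W (\<lambda>z. f (inv_into U \<phi> z))"
    "smooth_on W (\<lambda>z. g (inv_into U \<phi> z))"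
    using smooth_near_chart2[OF assms U] .
  then show ?thesis by (intro smooth_nearI[OF U] smooth_on_add)
qed

lemma smooth_near_mult:
  fixes f g :: "'p \<Rightarrow> real"
  assumes "smooth_near A p f" "smooth_near A p g"
  shows "smooth_near A p (\<lambda>q. f q * g q)"
proof -
  obtain U \<phi> where U: "(U, \<phi>) \<in> A" "p \<in> U" using smooth_near_domainE[OF assms(1)] .
  obtain W where "open W" "\<phi> p \<in> W" "W \<subseteq> \<phi> ` U" "smooth_on W (\<lambda>z. f (inv_into U \<phi> z))"
    "smooth_on W (\<lambda>z. g (inv_into U \<phi> z))"
    using smooth_near_chart2[OF assms U] .
  then show ?thesis by (intro smooth_nearI[OF U] smooth_on_mult)
qed

lemma smooth_near_of_chart:
  assumes U: "(U, \<phi>) \<in> A" "p \<in> U" and W: "open W" "\<phi> p \<in> W" and h: "smooth_on W h"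
  shows "smooth_near A p (\<lambda>q. h (\<phi> q))"
proof (rule smooth_nearI[OF U])
  show "open (W \<inter> \<phi> ` U)" using W open_image[OF U(1)] by blast
  then show "smooth_on (W \<inter> \<phi> ` U) (\<lambda>z. h (\<phi> (inv_into U \<phi> z)))"
    by (rule smooth_on_cong[OF _ smooth_on_subset[OF h]]) (auto simp: f_inv_into_f)
qed (use U W in auto)

lemma smooth_near_const: "(U, \<phi>) \<in> A \<Longrightarrow> p \<in> U \<Longrightarrow> smooth_near A p (\<lambda>q. c)"
  using smooth_near_of_chart[of U \<phi> p UNIV "\<lambda>_. c"] smooth_on_const by auto

lemma smooth_near_linear_chart:
  "(U, \<phi>) \<in> A \<Longrightarrow> p \<in> U \<Longrightarrow> bounded_linear h \<Longrightarrow> smooth_near A p (\<lambda>q. h (\<phi> q))"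
  using smooth_near_of_chart[of U \<phi> p UNIV h] smooth_on_linear[of h UNIV] by auto

lemma smooth_near_sum:
  assumes "finite I" "(U, \<phi>) \<in> A" "p \<in> U" "\<And>i. i \<in> I \<Longrightarrow> smooth_near A p (f i)"
  shows "smooth_near A p (\<lambda>q. \<Sum>i\<in>I. f i q)"
  using assms(1,4)
  by (induction I rule: finite_induct) (auto intro: smooth_near_add smooth_near_const[OF assms(2,3)])

lemma smooth_near_has_derivative:
  assumes "smooth_near A p f" "(U, \<phi>) \<in> A" "p \<in> U"
  shows "((\<lambda>z. f (inv_into U \<phi> z)) has_derivative
    frechet_derivative (\<lambda>z. f (inv_into U \<phi> z)) (at (\<phi> p))) (at (\<phi> p))"
  using smooth_near_chart[OF assms] smooth_on_has_derivative by metis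

lemma coord_vec_eq:
  assumes "smooth_near A p f" "((\<lambda>z. f (inv_into U \<phi> z)) has_derivative D) (at (\<phi> p))"
  shows "coord_vec A (U, \<phi>) w p f = D w"
  using assms frechet_derivative_at by (force simp: coord_vec_def comp_def)

lemma coord_vec_tangent_space:
  assumes U: "(U, \<phi>) \<in> A" "p \<in> U"
  shows "coord_vec A (U, \<phi>) w p \<in> tangent_space A p"
proof -
  let ?r = "\<lambda>f z. f (inv_into U \<phi> z)" and ?v = "coord_vec A (U, \<phi>) w p"
  let ?D = "\<lambda>f. frechet_derivative (?r f) (at (\<phi> p))"
  have v: "?v f = ?D f w" if "smooth_near A p f" for f
    by (rule coord_vec_eq[OF that smooth_near_has_derivative[OF that U]])
  have add: "?v (\<lambda>q. f q + g q) = ?v f + ?v g" if "smooth_near A p f" "smooth_near A p g" for f g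
    using coord_vec_eq[OF smooth_near_add[OF that] has_derivative_add[OF
          smooth_near_has_derivative[OF that(1) U] smooth_near_has_derivative[OF that(2) U]]]
    by (simp add: v that)
  have mult: "?v (\<lambda>q. f q * g q) = f p * ?v g + g p * ?v f"
    if "smooth_near A p f" "smooth_near A p g" for f g
    using coord_vec_eq[OF smooth_near_mult[OF that] has_derivative_mult[OF
          smooth_near_has_derivative[OF that(1) U] smooth_near_has_derivative[OF that(2) U]]]
    by (simp add: v that U)
  have const: "?v (\<lambda>q. c) = 0" for c
    using coord_vec_eq[OF smooth_near_const[OF U] has_derivative_const] by simp
  show ?thesis
    unfolding tangent_space_def
    \<comment> \<open>Homogeneity is the product rule against a constant function, on which
      \<open>?v\<close> vanishes.\<close>
    using add mult mult[OF smooth_near_const[OF U]] const by (auto simp: coord_vec_def)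
qed

lemma coord_vec_linear_chart:
  assumes U: "(U, \<phi>) \<in> A" "p \<in> U" and h: "bounded_linear h"
  shows "coord_vec A (U, \<phi>) w p (\<lambda>q. h (\<phi> q)) = h w"
proof (rule coord_vec_eq[OF smooth_near_linear_chart[OF assms]])
  show "((\<lambda>z. h (\<phi> (inv_into U \<phi> z))) has_derivative h) (at (\<phi> p))"
    by (rule has_derivative_transform_within_open[OF bounded_linear_imp_has_derivative[OF h]
          open_image[OF U(1)]]) (use U in \<open>auto simp: f_inv_into_f\<close>)
qed

lemma coord_vec_inject:
  assumes U: "(U, \<phi>) \<in> A" "p \<in> U" and eq: "coord_vec A (U, \<phi>) w p = coord_vec A (U, \<phi>) w' p"
  shows "w = w'"
proof (rule euclidean_eqI)
  fix b
  show "w \<bullet> b = w' \<bullet> b"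
    using coord_vec_linear_chart[OF U bounded_linear_inner_left[of b]] eq by metis
qed

lemma coord_vec_comb:
  assumes U: "(U, \<phi>) \<in> A" "p \<in> U" and "finite I"
  shows "(\<lambda>f. \<Sum>i\<in>I. c i * coord_vec A (U, \<phi>) (w i) p f) = coord_vec A (U, \<phi>) (\<Sum>i\<in>I. c i *\<^sub>R w i) p"
proof (rule ext)
  fix f
  show "(\<Sum>i\<in>I. c i * coord_vec A (U, \<phi>) (w i) p f) = coord_vec A (U, \<phi>) (\<Sum>i\<in>I. c i *\<^sub>R w i) p f"
  proof (cases "smooth_near A p f")
    case True
    interpret bounded_linear "frechet_derivative (\<lambda>z. f (inv_into U \<phi> z)) (at (\<phi> p))"
      using smooth_near_has_derivative[OF True U] by (rule has_derivative_bounded_linear)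
    show ?thesis
      by (simp add: coord_vec_eq[OF True smooth_near_has_derivative[OF True U]] sum scaleR)
  qed (simp add: coord_vec_def)
qed

lemma tangent_space_comb:
  assumes v: "v \<in> tangent_space A p"
  shows "smooth_near A p f \<Longrightarrow> smooth_near A p g \<Longrightarrow> v (\<lambda>q. f q + g q) = v f + v g"
    and "smooth_near A p f \<Longrightarrow> smooth_near A p g \<Longrightarrow> v (\<lambda>q. f q * g q) = f p * v g + g p * v f"
    and "smooth_near A p f \<Longrightarrow> v (\<lambda>q. c * f q) = c * v f"
    and "\<not> smooth_near A p f \<Longrightarrow> v f = 0"
  using v unfolding tangent_space_def by blast+

lemma tangent_space_const:
  assumes v: "v \<in> tangent_space A p" and U: "(U, \<phi>) \<in> A" "p \<in> U"
  shows "v (\<lambda>q. c) = 0"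
proof -
  have "v (\<lambda>q. 1 * 1) = 1 * v (\<lambda>q. 1) + 1 * v (\<lambda>q. 1)"
    by (rule tangent_space_comb(2)[OF v]) (rule smooth_near_const[OF U])+
  then have "v (\<lambda>q. 1) = 0" by simp
  then show ?thesis using tangent_space_comb(3)[OF v smooth_near_const[OF U, of 1], of c] by simp
qed

lemma tangent_space_sum:
  assumes v: "v \<in> tangent_space A p" and U: "(U, \<phi>) \<in> A" "p \<in> U"
    and "finite I" "\<And>i. i \<in> I \<Longrightarrow> smooth_near A p (f i)"
  shows "v (\<lambda>q. \<Sum>i\<in>I. f i q) = (\<Sum>i\<in>I. v (f i))"
  using assms(4,5)
proof (induction I rule: finite_induct)
  case empty
  then show ?case using tangent_space_const[OF v U] by simp
next
  case (insert i I)
  then show ?case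
    using tangent_space_comb(1)[OF v, of "f i" "\<lambda>q. \<Sum>i\<in>I. f i q"] smooth_near_sum[OF insert(1) U, of f]
    by simp
qed

text \<open>In Hadamard's expansion of \<open>f\<close> around \<open>p\<close> every summand is a
  product whose first factor vanishes at \<open>p\<close>. By the Leibniz rule \<open>v\<close>
  leaves of it only \<open>v\<close> of the coordinate times the partial derivative of
  \<open>f\<close> at \<open>p\<close>.\<close>

lemma tangent_eq_coord_vec:
  assumes v: "v \<in> tangent_space A p" and U: "(U, \<phi>) \<in> A" "p \<in> U"
  shows "v = coord_vec A (U, \<phi>) (\<Sum>b\<in>Basis. v (\<lambda>q. \<phi> q \<bullet> b) *\<^sub>R b) p"
proof (rule ext)
  fix f
  show "v f = coord_vec A (U, \<phi>) (\<Sum>b\<in>Basis. v (\<lambda>q. \<phi> q \<bullet> b) *\<^sub>R b) p f"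
  proof (cases "smooth_near A p f")
    case f: True
    let ?h = "\<lambda>z. f (inv_into U \<phi> z)" and ?a = "\<phi> p"
    obtain W where W: "open W" "?a \<in> W" "W \<subseteq> \<phi> ` U" "smooth_on W ?h"
      using smooth_near_chart[OF f U] .
    obtain e where e: "e > 0" "ball ?a e \<subseteq> W" using W openE by metis
    let ?B = "ball ?a e"
    have aB: "?a \<in> ?B" using e by simp
    obtain g where g: "\<And>b. smooth_on ?B (g b)" "\<And>b. g b ?a = frechet_derivative ?h (at ?a) b"
      "\<And>x. x \<in> ?B \<Longrightarrow> ?h x = ?h ?a + (\<Sum>b\<in>Basis. ((x - ?a) \<bullet> b) * g b x)"
      by (rule hadamard[OF convex_ball open_ball aB smooth_on_subset[OF W(4) e(2)]]) blast
    have gs: "smooth_near A p (\<lambda>q. g b (\<phi> q))" for b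
      by (rule smooth_near_of_chart[OF U open_ball aB g(1)])
    have ls: "smooth_near A p (\<lambda>q. \<phi> q \<bullet> b)" for b
      by (rule smooth_near_linear_chart[OF U bounded_linear_inner_left])
    have ds: "smooth_near A p (\<lambda>q. (\<phi> q - ?a) \<bullet> b)"
      and vd: "v (\<lambda>q. (\<phi> q - ?a) \<bullet> b) = v (\<lambda>q. \<phi> q \<bullet> b)" for b
      using smooth_near_add[OF ls smooth_near_const[OF U, of "- (?a \<bullet> b)"]]
        tangent_space_comb(1)[OF v ls smooth_near_const[OF U, of "- (?a \<bullet> b)"]]
        tangent_space_const[OF v U]
      by (simp_all add: inner_diff_left)
    let ?F = "\<lambda>q. \<Sum>b\<in>Basis. ((\<phi> q - ?a) \<bullet> b) * g b (\<phi> q)"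
    have Fs: "smooth_near A p ?F"
      by (intro smooth_near_sum[OF _ U] smooth_near_mult ds gs) auto
    \<comment> \<open>The expansion is valid on the ball \<open>?B\<close> only, hence the appeal to
      locality.\<close>
    have "v f = v (\<lambda>q. f p + ?F q)"
    proof (rule tangent_space_local[OF v smooth_near_add[OF smooth_near_const[OF U] Fs] _ U])
      fix z assume z: "z \<in> ?B"
      then have "\<phi> (inv_into U \<phi> z) = z" using e W by (intro f_inv_into_f) auto
      then show "f (inv_into U \<phi> z) = f p + ?F (inv_into U \<phi> z)"
        using g(3)[OF z] U by simp
    qed (use aB e W in auto)
    also have "\<dots> = v ?F"
      using tangent_space_comb(1)[OF v smooth_near_const[OF U] Fs] tangent_space_const[OF v U] by simp
    also have "\<dots> = (\<Sum>b\<in>Basis. v (\<lambda>q. ((\<phi> q - ?a) \<bullet> b) * g b (\<phi> q)))"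
      by (intro tangent_space_sum[OF v U] smooth_near_mult ds gs) auto
    also have "\<dots> = (\<Sum>b\<in>Basis. v (\<lambda>q. \<phi> q \<bullet> b) * frechet_derivative ?h (at ?a) b)"
      by (intro sum.cong refl) (simp add: tangent_space_comb(2)[OF v ds gs] vd g(2))
    also have "\<dots> = frechet_derivative ?h (at ?a) (\<Sum>b\<in>Basis. v (\<lambda>q. \<phi> q \<bullet> b) *\<^sub>R b)"
    proof -
      interpret bounded_linear "frechet_derivative ?h (at ?a)"
        using smooth_near_has_derivative[OF f U] by (rule has_derivative_bounded_linear)
      show ?thesis by (simp add: sum scaleR)
    qed
    finally show ?thesis
      by (simp add: coord_vec_eq[OF f smooth_near_has_derivative[OF f U]])
  qed (simp add: tangent_space_comb(4)[OF v] coord_vec_def)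
qed

lemma tangent_coordsE:
  assumes "v \<in> tangent_space A p" "(U, \<phi>) \<in> A" "p \<in> U"
  obtains w where "v = coord_vec A (U, \<phi>) w p"
  using tangent_eq_coord_vec[OF assms] by blast

text \<open>Turns the topological neighbourhoods in \<open>local_section\<close> and
  \<open>smooth_map_near\<close> into open sets of coordinates. The topology is given by a
  generating family, so the proof is an induction over the generation of \<open>N\<close>.\<close>

lemma mtop_chart:
  assumes "openin (mtop A) N" "x \<in> N" "(U, \<phi>) \<in> A" "x \<in> U"
  shows "\<exists>W. open W \<and> \<phi> x \<in> W \<and> W \<subseteq> \<phi> ` U \<and> (\<forall>z\<in>W. inv_into U \<phi> z \<in> N)"
proof -
  have "generate_topology_on {U \<inter> \<phi> -` W |U \<phi> W. (U, \<phi>) \<in> A \<and> open W} N"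
    using assms(1) by (simp add: mtop_def openin_topology_generated_by_iff)
  then show ?thesis using assms(2-)
  proof (induction arbitrary: x)
    case (Int a b)
    obtain W1 where "open W1" "\<phi> x \<in> W1" "W1 \<subseteq> \<phi> ` U" "\<forall>z\<in>W1. inv_into U \<phi> z \<in> a"
      using Int.IH(1)[of x] Int.prems by blast
    moreover obtain W2 where "open W2" "\<phi> x \<in> W2" "W2 \<subseteq> \<phi> ` U" "\<forall>z\<in>W2. inv_into U \<phi> z \<in> b"
      using Int.IH(2)[of x] Int.prems by blast
    ultimately show ?case by (intro exI[of _ "W1 \<inter> W2"]) auto
  next
    case (UN k)
    from UN.prems(1) obtain N' where N': "N' \<in> k" "x \<in> N'" by (rule UnionE)
    obtain W where "open W" "\<phi> x \<in> W" "W \<subseteq> \<phi> ` U" "\<forall>z\<in>W. inv_into U \<phi> z \<in> N'"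
      using UN.IH[OF N' UN.prems(2,3)] by (elim exE conjE)
    then show ?case using N'(1) by (intro exI[of _ W]) auto
  next
    case (Basis s)
    then obtain V \<psi> W where s: "s = V \<inter> \<psi> -` W" and V: "(V, \<psi>) \<in> A" and W: "open W" by auto
    let ?W = "\<phi> ` (U \<inter> V) \<inter> (\<lambda>z. \<psi> (inv_into U \<phi> z)) -` W"
    have "open ?W"
      by (rule continuous_open_preimage[OF smooth_on_imp_continuous_on[OF
            smooth_transition[OF Basis(3) V]] open_overlap[OF Basis(3) V] W])
    then show ?case using Basis s by (intro exI[of _ ?W]) auto
  qed simp
qed

lemma mtop_openin_chart:
  "(U, \<phi>) \<in> A \<Longrightarrow> open W \<Longrightarrow> openin (mtop A) (U \<inter> \<phi> -` W)"
  unfolding mtop_def by (rule topology_generated_by_Basis) blast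

end

section \<open>Smooth maps in a pair of charts\<close>

text \<open>\<open>smooth_map_near\<close> speaks of all target charts, with separate neighbourhoods
  for staying in the chart and for smoothness. Here the two charts are fixed and one open set of
  coordinates serves both purposes.\<close>

definition smooth_rep ::
  "'p set \<Rightarrow> ('p \<Rightarrow> 'e::euclidean_space) \<Rightarrow> 'q set \<Rightarrow> ('q \<Rightarrow> 'f::euclidean_space) \<Rightarrow> 'p \<Rightarrow> ('p \<Rightarrow> 'q) \<Rightarrow> bool" where
  "smooth_rep U \<phi> V \<psi> p f \<longleftrightarrow> (\<exists>W. open W \<and> \<phi> p \<in> W \<and> W \<subseteq> \<phi> ` U \<and>
     (\<forall>z\<in>W. f (inv_into U \<phi> z) \<in> V) \<and> smooth_on W (\<lambda>z. \<psi> (f (inv_into U \<phi> z))))"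

locale two_atlases = A: smooth_atlas A + B: smooth_atlas B
  for A :: "('p, 'e::euclidean_space) atlas" and B :: "('q, 'f::euclidean_space) atlas"
begin

context
  fixes U \<phi> V \<psi> p f
  assumes U: "(U, \<phi>) \<in> A" "p \<in> U" and V: "(V, \<psi>) \<in> B" and f: "smooth_rep U \<phi> V \<psi> p f"
begin

lemma smooth_rep_value: "f p \<in> V"
  using f U unfolding smooth_rep_def by (metis A.inv_chart)

lemma smooth_rep_has_derivative:
  "((\<lambda>z. \<psi> (f (inv_into U \<phi> z))) has_derivative
     frechet_derivative (\<lambda>z. \<psi> (f (inv_into U \<phi> z))) (at (\<phi> p))) (at (\<phi> p))"
  using f smooth_on_has_derivative unfolding smooth_rep_def by metis

lemma smooth_near_comp:
  assumes g: "smooth_near B (f p) g"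
  shows "smooth_near A p (\<lambda>q. g (f q))"
proof -
  obtain W where W: "open W" "\<phi> p \<in> W" "W \<subseteq> \<phi> ` U" "\<forall>z\<in>W. f (inv_into U \<phi> z) \<in> V"
    "smooth_on W (\<lambda>z. \<psi> (f (inv_into U \<phi> z)))"
    using f unfolding smooth_rep_def by blast
  obtain X where X: "open X" "\<psi> (f p) \<in> X" "X \<subseteq> \<psi> ` V" "smooth_on X (\<lambda>z. g (inv_into V \<psi> z))"
    using B.smooth_near_chart[OF g V smooth_rep_value] .
  let ?W = "W \<inter> (\<lambda>z. \<psi> (f (inv_into U \<phi> z))) -` X"
  have o: "open ?W"
    by (rule continuous_open_preimage[OF smooth_on_imp_continuous_on[OF W(5)] W(1) X(1)])
  have "smooth_on ?W (\<lambda>z. g (inv_into V \<psi> (\<psi> (f (inv_into U \<phi> z)))))"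
    by (rule smooth_on_compose[OF o X(1) smooth_on_subset[OF W(5)] X(4)]) auto
  then have "smooth_on ?W (\<lambda>z. g (f (inv_into U \<phi> z)))"
    by (rule smooth_on_cong[OF o]) (use W V in auto)
  then show ?thesis
    by (intro smooth_nearI[OF U o]) (use W X U in auto)
qed

text \<open>The chain rule in charts. On functions that are not smooth at \<open>f p\<close> both
  sides take the conventional value \<open>0\<close>.\<close>

lemma tmap_coord_vec:
  "tmap B f p (coord_vec A (U, \<phi>) w p) =
    coord_vec B (V, \<psi>) (frechet_derivative (\<lambda>z. \<psi> (f (inv_into U \<phi> z))) (at (\<phi> p)) w) (f p)"
  (is "_ = coord_vec B _ (?D w) _")
proof (rule ext)
  fix g
  show "tmap B f p (coord_vec A (U, \<phi>) w p) g = coord_vec B (V, \<psi>) (?D w) (f p) g"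
  proof (cases "smooth_near B (f p) g")
    case g: True
    let ?G = "frechet_derivative (\<lambda>z. g (inv_into V \<psi> z)) (at (\<psi> (f p)))"
    note dg = B.smooth_near_has_derivative[OF g V smooth_rep_value]
    obtain W where W: "open W" "\<phi> p \<in> W" "W \<subseteq> \<phi> ` U" "\<forall>z\<in>W. f (inv_into U \<phi> z) \<in> V"
      using f unfolding smooth_rep_def by blast
    have dg': "((\<lambda>z. g (inv_into V \<psi> z)) has_derivative ?G) (at (\<psi> (f (inv_into U \<phi> (\<phi> p)))))"
      using dg U by simp
    have "((\<lambda>z. g (inv_into V \<psi> (\<psi> (f (inv_into U \<phi> z))))) has_derivative (\<lambda>w. ?G (?D w))) (at (\<phi> p))"
      by (rule has_derivative_compose[OF smooth_rep_has_derivative dg'])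
    then have "((\<lambda>z. g (f (inv_into U \<phi> z))) has_derivative (\<lambda>w. ?G (?D w))) (at (\<phi> p))"
      by (rule has_derivative_transform_within_open[OF _ W(1,2)]) (use W V in auto)
    from A.coord_vec_eq[OF smooth_near_comp[OF g] this]
    show ?thesis by (simp add: tmap_def g comp_def B.coord_vec_eq[OF g dg])
  qed (simp add: tmap_def coord_vec_def)
qed

lemma tmap_tangent_space:
  "v \<in> tangent_space A p \<Longrightarrow> tmap B f p v \<in> tangent_space B (f p)"
  using A.tangent_coordsE[OF _ U] tmap_coord_vec B.coord_vec_tangent_space[OF V smooth_rep_value] by metis

lemma smooth_rep_change:
  assumes V': "(V', \<psi>') \<in> B" "f p \<in> V'"
  shows "smooth_rep U \<phi> V' \<psi>' p f"
proof -
  obtain W where W: "open W" "\<phi> p \<in> W" "W \<subseteq> \<phi> ` U" "\<forall>z\<in>W. f (inv_into U \<phi> z) \<in> V"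
    "smooth_on W (\<lambda>z. \<psi> (f (inv_into U \<phi> z)))"
    using f unfolding smooth_rep_def by blast
  let ?W = "W \<inter> (\<lambda>z. \<psi> (f (inv_into U \<phi> z))) -` (\<psi> ` (V \<inter> V'))"
  note oV = B.open_overlap[OF V V'(1)]
  have o: "open ?W"
    by (rule continuous_open_preimage[OF smooth_on_imp_continuous_on[OF W(5)] W(1) oV])
  have "smooth_on ?W (\<lambda>z. \<psi>' (inv_into V \<psi> (\<psi> (f (inv_into U \<phi> z)))))"
    by (rule smooth_on_compose[OF o oV smooth_on_subset[OF W(5)] B.smooth_transition[OF V V'(1)]]) auto
  then have "smooth_on ?W (\<lambda>z. \<psi>' (f (inv_into U \<phi> z)))"
    by (rule smooth_on_cong[OF o]) (use W V in auto)
  moreover have "f (inv_into U \<phi> z) \<in> V'" if "z \<in> ?W" for z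
  proof -
    have "f (inv_into U \<phi> z) \<in> V" using that W by blast
    \<comment> \<open>\<open>\<psi>\<close> is injective on \<open>V\<close>, so a point of
      \<open>V\<close> whose coordinates lie in the image of the overlap lies in the
      overlap.\<close>
    then show ?thesis using that inj_on_image_mem_iff[OF B.inj[OF V], of "f (inv_into U \<phi> z)" "V \<inter> V'"] by auto
  qed
  moreover have "\<phi> p \<in> ?W" using W U V' smooth_rep_value by auto
  ultimately show ?thesis unfolding smooth_rep_def using o W by blast
qed

lemma smooth_map_near_of_rep: "smooth_map_near A B p f"
proof -
  have "(\<exists>N. openin (mtop A) N \<and> p \<in> N \<and> f ` N \<subseteq> V') \<and> smooth_near A p (\<psi>' \<circ> f)"
    if V': "(V', \<psi>') \<in> B" "f p \<in> V'" for V' \<psi>'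
  proof
    obtain W where W: "open W" "\<phi> p \<in> W" "W \<subseteq> \<phi> ` U" "\<forall>z\<in>W. f (inv_into U \<phi> z) \<in> V'"
      "smooth_on W (\<lambda>z. \<psi>' (f (inv_into U \<phi> z)))"
      using smooth_rep_change[OF V'] unfolding smooth_rep_def by blast
    have "f ` (U \<inter> \<phi> -` W) \<subseteq> V'" using W(4) U(1) by force
    then show "\<exists>N. openin (mtop A) N \<and> p \<in> N \<and> f ` N \<subseteq> V'"
      using A.mtop_openin_chart[OF U(1) W(1)] U W by blast
    show "smooth_near A p (\<psi>' \<circ> f)"
      by (rule smooth_nearI[OF U W(1-3)]) (use W in simp)
  qed
  moreover have "f p \<in> carrier B" using V smooth_rep_value by (auto simp: carrier_def)
  ultimately show ?thesis unfolding smooth_map_near_def by auto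
qed

end

lemma smooth_rep_of_map_near:
  assumes f: "smooth_map_near A B p f" and U: "(U, \<phi>) \<in> A" "p \<in> U" and V: "(V, \<psi>) \<in> B" "f p \<in> V"
  shows "smooth_rep U \<phi> V \<psi> p f"
proof -
  obtain N where N: "openin (mtop A) N" "p \<in> N" "f ` N \<subseteq> V" and s: "smooth_near A p (\<psi> \<circ> f)"
    using f V unfolding smooth_map_near_def by blast
  obtain W1 where "open W1" "\<phi> p \<in> W1" "W1 \<subseteq> \<phi> ` U" "\<forall>z\<in>W1. inv_into U \<phi> z \<in> N"
    using A.mtop_chart[OF N(1,2) U] by blast
  moreover obtain W2 where "open W2" "\<phi> p \<in> W2" "W2 \<subseteq> \<phi> ` U" "smooth_on W2 (\<lambda>z. (\<psi> \<circ> f) (inv_into U \<phi> z))"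
    using A.smooth_near_chart[OF s U] .
  ultimately show ?thesis
    unfolding smooth_rep_def using N(3)
    by (intro exI[of _ "W1 \<inter> W2"]) (auto intro: smooth_on_subset)
qed

end

text \<open>The iterated \<open>tmap\<close> tests smoothness twice, at \<open>g (f p)\<close> and,
  for the pulled back function, at \<open>f p\<close>. The hypothesis makes the second test follow
  from the first, so that the default values \<open>0\<close> agree.\<close>

lemma tmap_compose:
  assumes "\<And>h :: _ \<Rightarrow> real. smooth_near C (g (f p)) h \<Longrightarrow> smooth_near B (f p) (\<lambda>q. h (g q))"
  shows "tmap C g (f p) (tmap B f p v) = tmap C (\<lambda>q. g (f q)) p v"
proof (rule ext)
  fix h
  show "tmap C g (f p) (tmap B f p v) h = tmap C (\<lambda>q. g (f q)) p v h"
    using assms[of h] by (simp add: tmap_def comp_def)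
qed

text \<open>Closure of smooth functions under sums and products is used at the target, where an
  atlas is available; the source may thus be \<open>J1_atlas\<close>, whose vectors are treated as
  bare derivations.\<close>

lemma (in smooth_atlas) tmap_in_tangent_space:
  assumes W: "W \<in> tangent_space B q" and f: "\<And>g :: _ \<Rightarrow> real. smooth_near A (f q) g \<Longrightarrow> smooth_near B q (\<lambda>r. g (f r))"
  shows "tmap A f q W \<in> tangent_space A (f q)"
proof -
  have c: "smooth_near A (f q) (\<lambda>r. c * g r)" if g: "smooth_near A (f q) g" for g and c :: real
    by (rule smooth_near_domainE[OF g], rule smooth_near_mult[OF smooth_near_const g])
  have "W (\<lambda>q. a q + b q) = W a + W b" "W (\<lambda>q. a q * b q) = a q * W b + b q * W a" if "smooth_near B q a" "smooth_near B q b" for a b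
    using W that unfolding tangent_space_def by blast+
  moreover have "W (\<lambda>q. k * a q) = k * W a" if "smooth_near B q a" for a k
    using W that unfolding tangent_space_def by blast
  moreover note f
  ultimately show ?thesis
    unfolding tangent_space_def tmap_def comp_def
    by (simp add: smooth_near_add smooth_near_mult c)
qed


section \<open>Jets of sections of a locally trivial bundle\<close>

lemma jsource_jet [simp]: "jsource (jet M E \<pi> x s) = x"
  by (simp add: jsource_def jet_def)

text \<open>The representative picked by \<open>SOME\<close> need not be \<open>s\<close>. Its value
  and its tangent map at \<open>x\<close> are what it shares with \<open>s\<close>, and all that
  later proofs may use of it.\<close>

lemma
  assumes "local_section M E \<pi> x s"
  shows jrep_jet_local_section: "local_section M E \<pi> x (jrep (jet M E \<pi> x s))"
    and jrep_jet_value: "jrep (jet M E \<pi> x s) x = s x"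
    and jrep_jet_tmap: "v \<in> tangent_space M x \<Longrightarrow> tmap E (jrep (jet M E \<pi> x s)) x v = tmap E s x v"
    and jtarget_jet: "jtarget (jet M E \<pi> x s) = s x"
proof -
  have "s \<in> snd (jet M E \<pi> x s)" using assms by (simp add: jet_def)
  then have "jrep (jet M E \<pi> x s) \<in> snd (jet M E \<pi> x s)" 
    unfolding jrep_def by (rule someI[where P = "\<lambda>t. t \<in> snd (jet M E \<pi> x s)"])
  then show "local_section M E \<pi> x (jrep (jet M E \<pi> x s))" "jrep (jet M E \<pi> x s) x = s x"
    "v \<in> tangent_space M x \<Longrightarrow> tmap E (jrep (jet M E \<pi> x s)) x v = tmap E s x v"
    by (auto simp: jet_def)
  then show "jtarget (jet M E \<pi> x s) = s x" by (simp add: jtarget_def jet_def)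
qed

lemma jet_eqI:
  assumes "t x = s x" "\<And>v. v \<in> tangent_space M x \<Longrightarrow> tmap E t x v = tmap E s x v"
  shows "jet M E \<pi> x t = jet M E \<pi> x s"
  using assms by (simp add: jet_def)

lemma J1_jrep:
  assumes "j \<in> J1 M E \<pi>"
  shows "jsource j \<in> carrier M" "local_section M E \<pi> (jsource j) (jrep j)"
    "jet M E \<pi> (jsource j) (jrep j) = j"
proof -
  obtain x s where j: "j = jet M E \<pi> x s" "x \<in> carrier M" "local_section M E \<pi> x s"
    using assms by (auto simp: J1_def)
  then show "jsource j \<in> carrier M" "local_section M E \<pi> (jsource j) (jrep j)"
    by (simp_all add: jrep_jet_local_section)
  show "jet M E \<pi> (jsource j) (jrep j) = j"
    unfolding j(1) jsource_jet by (rule jet_eqI) (simp_all add: jrep_jet_value jrep_jet_tmap j(3))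
qed

lemma jtarget_eq: "jtarget j = jrep j (jsource j)"
  by (simp add: jtarget_def jsource_def)

lemma local_section_base: "local_section M E \<pi> x s \<Longrightarrow> \<pi> (s x) = x"
  by (auto simp: local_section_def)

lemma carrierE:
  assumes "x \<in> carrier M"
  obtains U \<phi> where "(U, \<phi>) \<in> M" "x \<in> U"
  using assms by (auto simp: carrier_def)

text \<open>For \<open>LM\<close> the fibre coordinate \<open>F\<close> is the frame matrix and
  \<open>R\<close> the set of invertible matrices; for \<open>\<Sigma>\<close> they are the entries
  of the inverse metric and their set of values. As \<open>F\<close> is total, its transition law is
  imposed on \<open>T\<close> only.\<close>

locale fibre_bundle = M: smooth_atlas M for M :: "('a, real^'m) atlas" +
  fixes T :: "'b set" and \<pi> :: "'b \<Rightarrow> 'a" and F :: "('a \<Rightarrow> real^'m) \<Rightarrow> 'b \<Rightarrow> 'f::euclidean_space" and R :: "'f set"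
    and E :: "('b, (real^'m) \<times> 'f) atlas"
  assumes base: "e \<in> T \<Longrightarrow> \<pi> e \<in> carrier M"
    and open_fibre: "open R"
    and fibre_bij: "(U, \<phi>) \<in> M \<Longrightarrow> x \<in> U \<Longrightarrow> bij_betw (F \<phi>) {e \<in> T. \<pi> e = x} R"
    and fibre_transition: "(U, \<phi>) \<in> M \<Longrightarrow> (U', \<phi>') \<in> M \<Longrightarrow>
      \<exists>G. smooth_on (\<phi> ` (U \<inter> U') \<times> R) G \<and> (\<forall>e\<in>T. \<pi> e \<in> U \<inter> U' \<longrightarrow> F \<phi>' e = G (\<phi> (\<pi> e), F \<phi> e))"
    and E_def: "E = {({e \<in> T. \<pi> e \<in> U}, \<lambda>e. (\<phi> (\<pi> e), F \<phi> e)) |U \<phi>. (U, \<phi>) \<in> M}"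
begin

abbreviation over :: "'a set \<Rightarrow> 'b set" where "over U \<equiv> {e \<in> T. \<pi> e \<in> U}"
abbreviation chart :: "('a \<Rightarrow> real^'m) \<Rightarrow> 'b \<Rightarrow> (real^'m) \<times> 'f" where "chart \<phi> \<equiv> \<lambda>e. (\<phi> (\<pi> e), F \<phi> e)"

lemma chart_in_E: "(U, \<phi>) \<in> M \<Longrightarrow> (over U, chart \<phi>) \<in> E"
  by (auto simp: E_def)

lemma E_cases:
  assumes "(V, \<psi>) \<in> E"
  obtains U \<phi> where "(U, \<phi>) \<in> M" "V = over U" "\<psi> = chart \<phi>"
  using assms by (auto simp: E_def)

lemma chart_image:
  assumes U: "(U, \<phi>) \<in> M" and "U' \<subseteq> U"
  shows "chart \<phi> ` over U' = \<phi> ` U' \<times> R"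
proof (intro equalityI subsetI)
  fix z assume "z \<in> chart \<phi> ` over U'"
  then obtain e where e: "e \<in> T" "\<pi> e \<in> U'" "z = chart \<phi> e" by auto
  then have "F \<phi> e \<in> R" using fibre_bij[OF U, of "\<pi> e"] assms(2) by (auto simp: bij_betw_def)
  then show "z \<in> \<phi> ` U' \<times> R" using e by auto
next
  fix z assume "z \<in> \<phi> ` U' \<times> R"
  then obtain x y where z: "z = (\<phi> x, y)" "x \<in> U'" "y \<in> R" by auto
  then obtain e where "e \<in> T" "\<pi> e = x" "F \<phi> e = y"
    using fibre_bij[OF U, of x] assms(2) by (auto simp: bij_betw_def image_iff)
  then show "z \<in> chart \<phi> ` over U'" using z by force
qed

lemma chart_inj:
  assumes U: "(U, \<phi>) \<in> M"
  shows "inj_on (chart \<phi>) (over U)"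
proof (rule inj_onI)
  fix e e' assume e: "e \<in> over U" "e' \<in> over U" "chart \<phi> e = chart \<phi> e'"
  then have "\<pi> e = \<pi> e'" using M.inj[OF U] by (auto dest: inj_onD)
  then show "e = e'" using e fibre_bij[OF U, of "\<pi> e"] by (auto simp: bij_betw_def inj_on_def)
qed

lemma smooth_atlas_E: "smooth_atlas E"
proof
  fix V \<psi> assume "(V, \<psi>) \<in> E"
  then obtain U \<phi> where U: "(U, \<phi>) \<in> M" "V = over U" "\<psi> = chart \<phi>" by (rule E_cases)
  show "inj_on \<psi> V" using chart_inj[OF U(1)] U by simp
  show "open (\<psi> ` V)"
    using chart_image[OF U(1) order.refl] U M.open_image[OF U(1)] open_fibre by (simp add: open_Times)
  fix V' \<psi>' assume "(V', \<psi>') \<in> E"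
  then obtain U' \<phi>' where U': "(U', \<phi>') \<in> M" "V' = over U'" "\<psi>' = chart \<phi>'" by (rule E_cases)
  have eq: "V \<inter> V' = over (U \<inter> U')" using U U' by auto
  have im: "\<psi> ` (V \<inter> V') = \<phi> ` (U \<inter> U') \<times> R"
    unfolding eq U(3) by (rule chart_image[OF U(1)]) simp
  note ov = M.open_overlap[OF U(1) U'(1)]
  show op: "open (\<psi> ` (V \<inter> V'))"
    unfolding im by (intro open_Times ov open_fibre)
  obtain G where G: "smooth_on (\<phi> ` (U \<inter> U') \<times> R) G"
    "\<And>e. e \<in> T \<Longrightarrow> \<pi> e \<in> U \<inter> U' \<Longrightarrow> F \<phi>' e = G (\<phi> (\<pi> e), F \<phi> e)"
    using fibre_transition[OF U(1) U'(1)] by blast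
  have "smooth_on (\<psi> ` (V \<inter> V')) (\<lambda>z. (\<phi>' (inv_into U \<phi> (fst z)), G z))"
    by (intro smooth_on_Pair op smooth_on_compose[OF op ov smooth_on_linear[OF bounded_linear_fst op]
          M.smooth_transition[OF U(1) U'(1)]])
      (auto simp: im G(1))
  then show "smooth_on (\<psi> ` (V \<inter> V')) (\<lambda>z. \<psi>' (inv_into V \<psi> z))"
  proof (rule smooth_on_cong[OF op])
    fix z assume "z \<in> \<psi> ` (V \<inter> V')"
    then obtain e where e: "e \<in> T" "\<pi> e \<in> U \<inter> U'" "z = chart \<phi> e" "e \<in> V" using U U' by auto
    have "inv_into V \<psi> z = e"
      using inv_into_f_f[OF chart_inj[OF U(1)], of e] e U by simp
    then show "(\<phi>' (inv_into U \<phi> (fst z)), G z) = \<psi>' (inv_into V \<psi> z)"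
      using e U U' G(2)[OF e(1,2)] by simp
  qed
qed

sublocale E: smooth_atlas E by (rule smooth_atlas_E)
sublocale ME: two_atlases M E ..

lemma carrier_E: "carrier E = T"
proof
  show "T \<subseteq> carrier E"
  proof
    fix e assume e: "e \<in> T"
    then obtain U \<phi> where "(U, \<phi>) \<in> M" "\<pi> e \<in> U" using base carrierE by metis
    then show "e \<in> carrier E"
      unfolding carrier_def using chart_in_E[of U \<phi>] e by (intro UN_I[of "(over U, chart \<phi>)"]) auto
  qed
qed (auto simp: carrier_def E_def)

lemma smooth_near_projection:
  assumes e: "e \<in> T" and g: "smooth_near M (\<pi> e) g"
  shows "smooth_near E e (\<lambda>e. g (\<pi> e))"
proof -
  obtain U \<phi> where U: "(U, \<phi>) \<in> M" "\<pi> e \<in> U" using base[OF e] carrierE by metis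
  obtain W where W: "open W" "\<phi> (\<pi> e) \<in> W" "W \<subseteq> \<phi> ` U" "smooth_on W (\<lambda>z. g (inv_into U \<phi> z))"
    using M.smooth_near_chart[OF g U] .
  let ?W = "W \<times> R" and ?I = "inv_into (over U) (chart \<phi>)"
  have im: "?W \<subseteq> chart \<phi> ` over U" using chart_image[OF U(1) order.refl] W by auto
  have o: "open ?W" by (intro open_Times W open_fibre)
  show ?thesis
  proof (rule smooth_nearI[OF chart_in_E[OF U(1)] _ o _ im])
    show "smooth_on ?W (\<lambda>z. g (\<pi> (?I z)))"
    proof (rule smooth_on_cong[OF o smooth_on_compose[OF o W(1) smooth_on_linear[OF bounded_linear_fst o] W(4)]])
      fix z assume "z \<in> ?W"
      then have "z \<in> chart \<phi> ` over U" using im by blast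
      then have "chart \<phi> (?I z) = z" "?I z \<in> over U" by (rule f_inv_into_f, rule inv_into_into)
      then have "fst z = \<phi> (\<pi> (?I z))" "\<pi> (?I z) \<in> U" by (auto simp: prod_eq_iff)
      then show "g (inv_into U \<phi> (fst z)) = g (\<pi> (?I z))" using U by simp
    qed auto
    have "chart \<phi> e \<in> chart \<phi> ` over U" using e U by auto
    then show "chart \<phi> e \<in> ?W" using W chart_image[OF U(1) order.refl] by auto
  qed (use e U in auto)
qed

lemma local_section_chart:
  assumes s: "local_section M E \<pi> x s" and U: "(U, \<phi>) \<in> M" "x \<in> U"
  obtains W where "open W" "\<phi> x \<in> W" "W \<subseteq> \<phi> ` U"
    "\<And>z. z \<in> W \<Longrightarrow> s (inv_into U \<phi> z) \<in> T" "\<And>z. z \<in> W \<Longrightarrow> \<pi> (s (inv_into U \<phi> z)) = inv_into U \<phi> z"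
    "smooth_on W (\<lambda>z. F \<phi> (s (inv_into U \<phi> z)))"
proof -
  obtain N where N: "openin (mtop M) N" "x \<in> N" "\<And>y. y \<in> N \<Longrightarrow> \<pi> (s y) = y"
    and sm: "smooth_map_near M E x s"
    using s unfolding local_section_def by blast
  have "s x \<in> T" using sm carrier_E unfolding smooth_map_near_def by blast
  then have "s x \<in> over U" using N U by simp
  then have "smooth_rep U \<phi> (over U) (chart \<phi>) x s"
    by (rule ME.smooth_rep_of_map_near[OF sm U chart_in_E[OF U(1)]])
  then obtain W1 where W1: "open W1" "\<phi> x \<in> W1" "W1 \<subseteq> \<phi> ` U" "\<forall>z\<in>W1. s (inv_into U \<phi> z) \<in> over U"
    "smooth_on W1 (\<lambda>z. chart \<phi> (s (inv_into U \<phi> z)))"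
    unfolding smooth_rep_def by blast
  obtain W2 where W2: "open W2" "\<phi> x \<in> W2" "W2 \<subseteq> \<phi> ` U" "\<forall>z\<in>W2. inv_into U \<phi> z \<in> N"
    using M.mtop_chart[OF N(1,2) U] by blast
  show ?thesis
  proof (rule that[of "W1 \<inter> W2"])
    show "smooth_on (W1 \<inter> W2) (\<lambda>z. F \<phi> (s (inv_into U \<phi> z)))"
      using smooth_on_snd[OF W1(1) W1(5)] by (auto intro: smooth_on_subset)
  qed (use W1 W2 N in auto)
qed

lemma
  assumes U: "(U, \<phi>) \<in> M" "x \<in> U" and W: "open W" "\<phi> x \<in> W" "W \<subseteq> \<phi> ` U"
    and s: "\<And>z. z \<in> W \<Longrightarrow> s (inv_into U \<phi> z) \<in> T" "\<And>z. z \<in> W \<Longrightarrow> \<pi> (s (inv_into U \<phi> z)) = inv_into U \<phi> z"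
    "smooth_on W (\<lambda>z. F \<phi> (s (inv_into U \<phi> z)))"
  shows local_sectionI: "local_section M E \<pi> x s"
    and smooth_rep_sectionI: "smooth_rep U \<phi> (over U) (chart \<phi>) x s"
proof -
  have inU: "inv_into U \<phi> z \<in> U" "\<phi> (inv_into U \<phi> z) = z" if "z \<in> W" for z
    using that W(3) by (auto intro: inv_into_into f_inv_into_f)
  have "smooth_on W (\<lambda>z. chart \<phi> (s (inv_into U \<phi> z)))"
    by (rule smooth_on_cong[OF W(1) smooth_on_Pair[OF W(1) smooth_on_ident[OF W(1)] s(3)]])
      (simp add: s inU)
  then show rep: "smooth_rep U \<phi> (over U) (chart \<phi>) x s"
    unfolding smooth_rep_def using W s inU by (intro exI[of _ W]) auto
  have "\<pi> (s y) = y" if "y \<in> U \<inter> \<phi> -` W" for y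
    using s(2)[of "\<phi> y"] that U by simp
  then show "local_section M E \<pi> x s"
    unfolding local_section_def
    using ME.smooth_map_near_of_rep[OF U chart_in_E[OF U(1)] rep] M.mtop_openin_chart[OF U(1) W(1)] U W
    by blast
qed

lemma local_section_rep:
  assumes s: "local_section M E \<pi> x s" and U: "(U, \<phi>) \<in> M" "x \<in> U"
  shows "smooth_rep U \<phi> (over U) (chart \<phi>) x s"
  by (rule local_section_chart[OF s U]) (rule smooth_rep_sectionI[OF U])

lemma local_section_total: "local_section M E \<pi> x s \<Longrightarrow> s x \<in> T"
  using carrier_E unfolding local_section_def smooth_map_near_def by blast

lemma section_tmap_tangent:
  assumes s: "local_section M E \<pi> x s" and v: "v \<in> tangent_space M x"
  shows "tmap E s x v \<in> tangent_space E (s x)"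
proof -
  have "x \<in> carrier M" using local_section_total[OF s] local_section_base[OF s] base by metis
  then obtain U \<phi> where U: "(U, \<phi>) \<in> M" "x \<in> U" by (rule carrierE)
  show ?thesis by (rule ME.tmap_tangent_space[OF U chart_in_E[OF U(1)] local_section_rep[OF s U] v])
qed

text \<open>The jet coordinates \<open>y\<^sub>\<mu>\<close>, in the literal form that they have in
  \<open>J1_atlas\<close>; hence \<open>snd \<circ> chart \<phi>\<close> for
  \<open>F \<phi>\<close>.\<close>

definition fibre_derivative :: "'a set \<Rightarrow> ('a \<Rightarrow> real^'m) \<Rightarrow> ('a \<Rightarrow> 'b) \<Rightarrow> 'a \<Rightarrow> 'f^'m" where
  "fibre_derivative U \<phi> s x =
    (\<chi> \<mu>. frechet_derivative (snd \<circ> chart \<phi> \<circ> s \<circ> inv_into U \<phi>) (at (\<phi> x)) (axis \<mu> 1))"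

text \<open>In charts the tangent map is the derivative of the coordinate expression
  (\<open>tmap_coord_vec\<close>), and a tangent vector determines its coordinates
  (\<open>coord_vec_inject\<close>). So sections with the same tangent map have the same jet
  coordinates.\<close>

lemma fibre_derivative_cong:
  assumes U: "(U, \<phi>) \<in> M" "x \<in> U" and s: "local_section M E \<pi> x s" and t: "local_section M E \<pi> x t"
    and eq: "t x = s x" "\<And>v. v \<in> tangent_space M x \<Longrightarrow> tmap E t x v = tmap E s x v"
  shows "fibre_derivative U \<phi> t x = fibre_derivative U \<phi> s x"
proof -
  let ?D = "\<lambda>s. frechet_derivative (\<lambda>z. chart \<phi> (s (inv_into U \<phi> z))) (at (\<phi> x))"
  note V = chart_in_E[OF U(1)]
  have fd: "fibre_derivative U \<phi> s x = (\<chi> \<mu>. snd (?D s (axis \<mu> 1)))" if s: "local_section M E \<pi> x s" for s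
  proof -
    have "((\<lambda>z. snd (chart \<phi> (s (inv_into U \<phi> z)))) has_derivative (\<lambda>w. snd (?D s w))) (at (\<phi> x))"
      by (rule bounded_linear.has_derivative[OF bounded_linear_snd
            ME.smooth_rep_has_derivative[OF U V local_section_rep[OF s U]]])
    from frechet_derivative_at[OF this, symmetric] show ?thesis by (simp add: fibre_derivative_def comp_def)
  qed
  have "?D t w = ?D s w" for w
  proof (rule E.coord_vec_inject[OF V])
    show "s x \<in> over U" using local_section_total[OF s] local_section_base[OF s] U by simp
    show "coord_vec E (over U, chart \<phi>) (?D t w) (s x) = coord_vec E (over U, chart \<phi>) (?D s w) (s x)"
      using eq(2)[OF M.coord_vec_tangent_space[OF U, of w]]
        ME.tmap_coord_vec[OF U V local_section_rep[OF s U]]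
        ME.tmap_coord_vec[OF U V local_section_rep[OF t U]] eq(1) by simp
  qed
  then show ?thesis by (simp only: fd[OF s] fd[OF t])
qed

text \<open>The section is affine in coordinates, with value \<open>y\<close> and slope
  \<open>Y\<close> at \<open>x\<close>. It shows that the derivative coordinates of jets are
  unrestricted.\<close>

lemma section_through:
  assumes U: "(U, \<phi>) \<in> M" "x \<in> U" and y: "y \<in> R"
  obtains s where "local_section M E \<pi> x s" "chart \<phi> (s x) = (\<phi> x, y)" "fibre_derivative U \<phi> s x = Y"
proof
  define \<sigma> where "\<sigma> z = y + (\<Sum>\<mu>\<in>UNIV. (z - \<phi> x) $ \<mu> *\<^sub>R Y $ \<mu>)" for z
  define I where "I = inv_into (over U) (chart \<phi>)"
  define s where "s q = I (\<phi> q, \<sigma> (\<phi> q))" for q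
  \<comment> \<open>The affine map may leave \<open>R\<close> away from \<open>\<phi> x\<close>;
    since \<open>R\<close> is open, this set is an open neighbourhood on which it stays
    inside.\<close>
  define W where "W = \<phi> ` U \<inter> \<sigma> -` R"
  have lin: "bounded_linear (\<lambda>z. \<Sum>\<mu>\<in>UNIV. z $ \<mu> *\<^sub>R Y $ \<mu>)"
    by (intro bounded_linear_sum bounded_linear_scaleR_const bounded_linear_vec_nth)
  have d: "(\<sigma> has_derivative (\<lambda>z. \<Sum>\<mu>\<in>UNIV. z $ \<mu> *\<^sub>R Y $ \<mu>)) (at z)" for z
    unfolding \<sigma>_def
    by (auto intro!: derivative_eq_intros bounded_linear.has_derivative[OF bounded_linear_vec_nth])
  have sm: "smooth_on UNIV \<sigma>"
    unfolding \<sigma>_def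
    using smooth_on_add[OF open_UNIV smooth_on_const[OF open_UNIV, of "y - (\<Sum>\<mu>\<in>UNIV. \<phi> x $ \<mu> *\<^sub>R Y $ \<mu>)"]
        smooth_on_linear[OF lin open_UNIV]]
    by (simp add: algebra_simps sum_subtractf)
  have W: "open W"
    unfolding W_def
    by (rule continuous_open_preimage[OF continuous_on_subset[OF smooth_on_imp_continuous_on[OF sm]]
          M.open_image[OF U(1)] open_fibre]) simp
  have xW: "\<phi> x \<in> W" using U y by (simp add: W_def \<sigma>_def)
  have I: "I (z, \<sigma> z) \<in> over U" "chart \<phi> (I (z, \<sigma> z)) = (z, \<sigma> z)" if "z \<in> W" for z
  proof -
    have "(z, \<sigma> z) \<in> chart \<phi> ` over U"
      unfolding chart_image[OF U(1) order.refl] using that by (auto simp: W_def)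
    then show "I (z, \<sigma> z) \<in> over U" "chart \<phi> (I (z, \<sigma> z)) = (z, \<sigma> z)"
      unfolding I_def by (rule inv_into_into, rule f_inv_into_f)
  qed
  have s: "s (inv_into U \<phi> z) = I (z, \<sigma> z)" if "z \<in> W" for z
    using that by (auto simp: s_def W_def U(1))
  have pi: "\<pi> (I (z, \<sigma> z)) = inv_into U \<phi> z" if "z \<in> W" for z
    using I[OF that] M.inv_chart[OF U(1), of "\<pi> (I (z, \<sigma> z))"] by auto
  show "local_section M E \<pi> x s"
  proof (rule local_sectionI[OF U W xW])
    show "W \<subseteq> \<phi> ` U" by (auto simp: W_def)
    show "smooth_on W (\<lambda>z. F \<phi> (s (inv_into U \<phi> z)))"
      by (rule smooth_on_cong[OF W smooth_on_subset[OF sm]]) (use I(2) s in auto)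
  qed (use s I pi in auto)
  show "chart \<phi> (s x) = (\<phi> x, y)" using I(2)[OF xW] by (simp add: s_def \<sigma>_def)
  have "frechet_derivative (snd \<circ> chart \<phi> \<circ> s \<circ> inv_into U \<phi>) (at (\<phi> x)) = frechet_derivative \<sigma> (at (\<phi> x))"
    by (rule frechet_derivative_cong_open[OF W xW]) (use s I(2) in auto)
  then show "fibre_derivative U \<phi> s x = Y"
    using frechet_derivative_at[OF d, of "\<phi> x", symmetric]
    by (simp add: fibre_derivative_def vec_eq_iff axis_def if_distrib[of "\<lambda>c. c *\<^sub>R _"] cong: if_cong)
qed

lemma J1_target:
  assumes "j \<in> J1 M E \<pi>"
  shows "jtarget j \<in> T" "\<pi> (jtarget j) = jsource j"
  using J1_jrep(2)[OF assms] by (simp_all add: jtarget_eq local_section_total local_section_base)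

abbreviation "jchart_dom U \<equiv> {j \<in> J1 M E \<pi>. jtarget j \<in> over U}"
abbreviation "jchart U \<phi> \<equiv> \<lambda>j. (chart \<phi> (jtarget j), fibre_derivative U \<phi> (jrep j) (jsource j))"

lemma jchart_in_atlas:
  assumes "(U, \<phi>) \<in> M"
  shows "(jchart_dom U, jchart U \<phi>) \<in> J1_atlas M E \<pi>"
  unfolding J1_atlas_def mem_Collect_eq fibre_derivative_def
  by (intro exI[of _ U] exI[of _ \<phi>] exI[of _ "over U"] exI[of _ "chart \<phi>"]) (use assms chart_in_E[OF assms] in auto)

text \<open>The neighbourhood in \<open>smooth_near\<close> must consist of coordinates of actual
  jets; this provides one with open first factor and arbitrary derivative part.\<close>

lemma jchart_image:
  assumes U: "(U, \<phi>) \<in> M"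
  shows "(\<phi> ` U \<times> R) \<times> UNIV \<subseteq> jchart U \<phi> ` jchart_dom U"
proof clarify
  fix x y Y assume x: "x \<in> U" and y: "y \<in> R"
  obtain s where s: "local_section M E \<pi> x s" "chart \<phi> (s x) = (\<phi> x, y)" "fibre_derivative U \<phi> s x = Y"
    using section_through[OF U x y] .
  let ?j = "jet M E \<pi> x s"
  have "x \<in> carrier M" using U x by (auto simp: carrier_def)
  then have "?j \<in> J1 M E \<pi>" using s(1) by (auto simp: J1_def)
  moreover have "jtarget ?j \<in> over U"
    using local_section_total[OF s(1)] local_section_base[OF s(1)] x by (simp add: jtarget_jet[OF s(1)])
  moreover have "fibre_derivative U \<phi> (jrep ?j) x = fibre_derivative U \<phi> s x"
    by (rule fibre_derivative_cong[OF U x s(1)])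
      (simp_all add: jrep_jet_local_section jrep_jet_value jrep_jet_tmap s(1))
  ultimately show "((\<phi> x, y), Y) \<in> jchart U \<phi> ` jchart_dom U"
    using s jtarget_jet[OF s(1)] by (intro image_eqI[of _ _ ?j]) auto
qed

text \<open>The first component of the jet chart is the chart of the target. \<open>inv_into\<close>
  picks some jet with the given coordinates; its target is determined by them, and on jets
  \<open>h\<close> depends on the target alone.\<close>

lemma smooth_near_J1:
  assumes j: "j \<in> J1 M E \<pi>" and f: "smooth_near E (jtarget j) f"
    and h: "\<And>i. i \<in> J1 M E \<pi> \<Longrightarrow> h i = f (jtarget i)"
  shows "smooth_near (J1_atlas M E \<pi>) j h"
proof -
  obtain U \<phi> where U: "(U, \<phi>) \<in> M" "jsource j \<in> U" using J1_jrep(1)[OF j] by (rule carrierE)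
  note t = J1_target[OF j]
  have tU: "jtarget j \<in> over U" using t U by simp
  obtain W where W: "open W" "chart \<phi> (jtarget j) \<in> W" "W \<subseteq> chart \<phi> ` over U"
    "smooth_on W (\<lambda>z. f (inv_into (over U) (chart \<phi>) z))"
    using E.smooth_near_chart[OF f chart_in_E[OF U(1)] tU] .
  let ?W = "W \<times> (UNIV :: ('f^'m) set)" and ?I = "inv_into (jchart_dom U) (jchart U \<phi>)"
  have im: "?W \<subseteq> jchart U \<phi> ` jchart_dom U"
    using jchart_image[OF U(1)] W(3) chart_image[OF U(1) order.refl] by auto
  have o: "open ?W" by (intro open_Times W(1) open_UNIV)
  show ?thesis
  proof (rule smooth_nearI[OF jchart_in_atlas[OF U(1)] _ o _ im])
    show "smooth_on ?W (\<lambda>z. h (?I z))"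
    proof (rule smooth_on_cong[OF o smooth_on_compose[OF o W(1) smooth_on_linear[OF bounded_linear_fst o] W(4)]])
      fix z assume "z \<in> ?W"
      then have "z \<in> jchart U \<phi> ` jchart_dom U" using im by blast
      then have 1: "jchart U \<phi> (?I z) = z" and 2: "?I z \<in> jchart_dom U"
        by (rule f_inv_into_f, rule inv_into_into)
      have "fst z = chart \<phi> (jtarget (?I z))" by (subst 1[symmetric]) simp
      then have "inv_into (over U) (chart \<phi>) (fst z) = jtarget (?I z)"
        using 2 E.inv_chart[OF chart_in_E[OF U(1)], of "jtarget (?I z)"] by simp
      then show "f (inv_into (over U) (chart \<phi>) (fst z)) = h (?I z)"
        using 2 h by simp
    qed auto
  qed (use W j tU in auto)
qed

text \<open>A tangent vector acts on functions of the whole jet type, whereas identities such as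
  \<open>\<pi> (jtarget i) = jsource i\<close> hold on \<open>J1\<close> only. Locality bridges the
  gap, since an open set of coordinates comes from genuine jets.\<close>

lemma J1_tangent_cong:
  assumes W: "W \<in> tangent_space (J1_atlas M E \<pi>) j" and j: "j \<in> J1 M E \<pi>"
    and g: "smooth_near (J1_atlas M E \<pi>) j g" and eq: "\<And>i. i \<in> J1 M E \<pi> \<Longrightarrow> f i = g i"
  shows "W f = W g"
proof -
  obtain U \<phi> where U: "(U, \<phi>) \<in> M" "jsource j \<in> U" using J1_jrep(1)[OF j] by (rule carrierE)
  note t = J1_target[OF j]
  let ?W = "(\<phi> ` U \<times> R) \<times> UNIV"
  have o: "open ?W" by (intro open_Times M.open_image[OF U(1)] open_fibre open_UNIV)
  have "chart \<phi> (jtarget j) \<in> chart \<phi> ` over U" using t U by (intro imageI) simp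
  then have "jchart U \<phi> j \<in> ?W" using chart_image[OF U(1) order.refl] by auto
  moreover have "f (inv_into (jchart_dom U) (jchart U \<phi>) z) = g (inv_into (jchart_dom U) (jchart U \<phi>) z)"
    if "z \<in> ?W" for z
  proof (rule eq)
    have "z \<in> jchart U \<phi> ` jchart_dom U" using that jchart_image[OF U(1)] by blast
    then have "inv_into (jchart_dom U) (jchart U \<phi>) z \<in> jchart_dom U" by (rule inv_into_into)
    then show "inv_into (jchart_dom U) (jchart U \<phi>) z \<in> J1 M E \<pi>" by blast
  qed
  moreover have "j \<in> jchart_dom U" using j t U by simp
  ultimately show ?thesis
    by (intro tangent_space_local[where f = f and g = g and U = "jchart_dom U" and \<phi> = "jchart U \<phi>" and W = ?W,
          OF W g eq[OF j] jchart_in_atlas[OF U(1)] _ o _ jchart_image[OF U(1)]])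
qed

lemma carrier_J1: "carrier (J1_atlas M E \<pi>) \<subseteq> J1 M E \<pi>"
  by (auto simp: carrier_def J1_atlas_def)

lemma smooth_near_jsource:
  assumes "j \<in> J1 M E \<pi>" "smooth_near M (jsource j) g"
  shows "smooth_near (J1_atlas M E \<pi>) j (\<lambda>i. g (jsource i))"
  using assms
  by (intro smooth_near_J1[OF assms(1) smooth_near_projection]) (simp_all add: J1_target)

lemma tmap_jtarget_tangent:
  assumes "j \<in> J1 M E \<pi>" "W \<in> tangent_space (J1_atlas M E \<pi>) j"
  shows "tmap E jtarget j W \<in> tangent_space E (jtarget j)"
  by (rule E.tmap_in_tangent_space[OF assms(2) smooth_near_J1[OF assms(1)]]) auto

lemma tmap_jsource_tangent:
  assumes "j \<in> J1 M E \<pi>" "W \<in> tangent_space (J1_atlas M E \<pi>) j"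
  shows "tmap M jsource j W \<in> tangent_space M (jsource j)"
  by (rule M.tmap_in_tangent_space[OF assms(2) smooth_near_jsource[OF assms(1)]])

end


section \<open>The frame bundle and the bundle of metrics\<close>

lemma smooth_manifold_atlas: "smooth_manifold M \<Longrightarrow> smooth_atlas M"
  unfolding smooth_manifold_def smooth_atlas_def comp_def by fast

section \<open>Invertible matrices and the group \<open>K\<close>\<close>

lemma open_invertible: "open {A :: real^'m^'m. invertible A}"
proof -
  have "continuous_on UNIV (\<lambda>A :: real^'m^'m. det A)"
    unfolding det_def by (intro continuous_intros)
  then have "open ((\<lambda>A :: real^'m^'m. det A) -` (- {0}))"
    by (intro open_vimage) auto
  then show ?thesis by (simp add: vimage_def invertible_det_nz)
qed

text \<open>Stated in the shape of the basis condition in \<open>LM\<close>, for use in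
  \<open>LM_iff\<close>.\<close>

lemma invertible_iff_ex1: "invertible (A :: real^'m^'m) \<longleftrightarrow> (\<forall>w. \<exists>!c. w = A *v c)"
  unfolding invertible_eq_bij bij_iff by (simp add: eq_commute)

lemma K_invertible: "k \<in> K i0 \<Longrightarrow> invertible k"
  by (simp add: K_def)

lemma K_one: "mat 1 \<in> K i0"
  by (simp add: K_iff transpose_mat)

lemma K_mult:
  assumes "k \<in> K i0" "l \<in> K i0"
  shows "k ** l \<in> K i0"
proof -
  have "(k ** l) ** \<eta> i0 ** transpose (k ** l) = k ** (l ** \<eta> i0 ** transpose l) ** transpose k"
    by (simp add: matrix_transpose_mul matrix_mul_assoc)
  then show ?thesis using assms by (simp add: K_iff)
qed

lemma
  assumes "invertible (k :: real^'m^'m)"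
  shows matrix_inv_mult: "k ** matrix_inv k = mat 1" "matrix_inv k ** k = mat 1"
proof -
  have "\<exists>A'. k ** A' = mat 1 \<and> A' ** k = mat 1" using assms by (simp add: invertible_def)
  then have "k ** matrix_inv k = mat 1 \<and> matrix_inv k ** k = mat 1"
    unfolding matrix_inv_def by (rule someI_ex)
  then show "k ** matrix_inv k = mat 1" "matrix_inv k ** k = mat 1" by auto
qed

lemma K_matrix_inv:
  assumes "k \<in> K i0"
  shows "matrix_inv k = \<eta> i0 ** transpose k ** \<eta> i0"
proof -
  have "transpose k ** \<eta> i0 ** k = \<eta> i0" using assms by (simp add: K_def)
  then have "\<eta> i0 ** transpose k ** \<eta> i0 ** k = mat 1"
    by (metis eta_eta matrix_mul_assoc)
  then show ?thesis
    by (metis K_invertible assms matrix_inv_mult(1) matrix_mul_assoc matrix_mul_lid matrix_mul_rid)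
qed

lemma K_inv:
  assumes "k \<in> K i0"
  shows "matrix_inv k \<in> K i0"
proof -
  note k = K_matrix_inv[OF assms] and i = matrix_inv_mult[OF K_invertible[OF assms]]
  have "transpose (matrix_inv k) = \<eta> i0 ** k ** \<eta> i0"
    by (simp add: k matrix_transpose_mul transpose_eta matrix_mul_assoc)
  then have "matrix_inv k ** \<eta> i0 ** transpose (matrix_inv k) = matrix_inv k ** (\<eta> i0 ** \<eta> i0) ** k ** \<eta> i0"
    by (simp add: matrix_mul_assoc)
  then show ?thesis by (simp add: K_iff eta_eta i)
qed

lemma fst_act [simp]: "fst (act p g) = fst p"
  by (simp add: act_def)

lemma act_act: "act (act p g) h = act p (g ** h)"
  by (auto simp: act_def matrix_matrix_mult_def fun_eq_iff sum_distrib_left sum_distrib_right mult_ac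
      intro: sum.swap)

lemma p_LM_act:
  assumes k: "k \<in> K i0"
  shows "p_LM i0 (act p k) = p_LM i0 p"
proof -
  have "act p l \<in> act (act p k) ` K i0" if "l \<in> K i0" for l
    by (rule image_eqI[of _ _ "matrix_inv k ** l"])
      (simp_all add: act_act matrix_mul_assoc matrix_inv_mult K_invertible[OF k] K_mult K_inv k that)
  then show ?thesis
    unfolding p_LM_def by (intro equalityI image_subsetI) (simp_all add: act_act K_mult k)
qed

lemma tau_Sig_p_LM [simp]: "tau_Sig (p_LM i0 p) = fst p"
proof -
  have "fst ` p_LM i0 p = {fst p}"
    unfolding p_LM_def image_image fst_act using K_one[of i0] by auto
  then show ?thesis by (simp add: tau_Sig_def)
qed

lemma frame_matrix_act: "frame_matrix \<phi> (act p g) = frame_matrix \<phi> p ** g"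
  by (simp add: frame_matrix_def act_def matrix_matrix_mult_def vec_eq_iff mult.commute)

lemma frame_metric_p_LM: "the_elem (frame_metric i0 \<phi> ` p_LM i0 p) = frame_metric i0 \<phi> p"
proof -
  have "frame_metric i0 \<phi> (act p k) = frame_metric i0 \<phi> p" if "k \<in> K i0" for k
  proof -
    have "frame_metric i0 \<phi> (act p k) =
        frame_matrix \<phi> p ** (k ** \<eta> i0 ** transpose k) ** transpose (frame_matrix \<phi> p)"
      by (simp add: frame_metric_def frame_matrix_act matrix_transpose_mul matrix_mul_assoc)
    then show ?thesis using that by (simp add: K_iff frame_metric_def)
  qed
  then have "frame_metric i0 \<phi> ` p_LM i0 p = (\<lambda>k. frame_metric i0 \<phi> p) ` K i0"
    unfolding p_LM_def image_image by (rule image_cong[OF refl])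
  then have "frame_metric i0 \<phi> ` p_LM i0 p = {frame_metric i0 \<phi> p}"
    using K_one[of i0] by auto
  then show ?thesis by simp
qed

text \<open>A linear map agreeing with \<open>sym_entries\<close> on symmetric matrices, the only ones where \<open>sym_entries\<close> is not junk.\<close>

definition sym_lin :: "real^'m^'m \<Rightarrow> real^('m uprod)" where
  "sym_lin S = (\<chi> q. S $ fst (SOME r. q = Upair (fst r) (snd r)) $ snd (SOME r. q = Upair (fst r) (snd r)))"

definition unsym :: "real^('m uprod) \<Rightarrow> real^'m^'m" where
  "unsym y = (\<chi> i k. y $ Upair i k)"

text \<open>An unordered pair has two orderings; symmetry of \<open>S\<close> makes both give the
  same entry, so the \<open>THE\<close> in \<open>sym_entries\<close> is meaningful.\<close>

lemma sym_entries_Upair: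
  assumes "transpose S = S"
  shows "sym_entries S $ Upair i k = S $ i $ k"
proof -
  have S: "S $ a $ b = S $ b $ a" for a b
    using assms by (metis transpose_def vec_lambda_beta)
  show ?thesis
    unfolding sym_entries_def vec_lambda_beta
    by (rule the_equality) (auto simp: S)
qed

lemma bounded_linear_sym_lin: "bounded_linear sym_lin"
  by (rule linear_conv_bounded_linear[THEN iffD1], rule linearI) (auto simp: sym_lin_def vec_eq_iff)

lemma bounded_linear_unsym: "bounded_linear unsym"
  by (rule linear_conv_bounded_linear[THEN iffD1], rule linearI) (auto simp: unsym_def vec_eq_iff)

lemma Upair_exists: "\<exists>r. q = Upair (fst r) (snd r)"
  by (cases q rule: uprod_exhaust) auto

lemma sym_lin_eq:
  assumes "transpose S = S"
  shows "sym_entries S = sym_lin S"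
proof -
  have "sym_entries S $ q = sym_lin S $ q" for q
  proof -
    let ?r = "SOME r. q = Upair (fst r) (snd r)"
    have q: "q = Upair (fst ?r) (snd ?r)" by (rule someI_ex[OF Upair_exists])
    have "sym_entries S $ q = S $ fst ?r $ snd ?r"
      by (subst q) (rule sym_entries_Upair[OF assms])
    then show ?thesis by (simp add: sym_lin_def)
  qed
  then show ?thesis by (simp add: vec_eq_iff)
qed

lemma unsym_sym_lin: "transpose S = S \<Longrightarrow> unsym (sym_lin S) = S"
  by (simp add: unsym_def sym_entries_Upair vec_eq_iff flip: sym_lin_eq)

lemma transpose_unsym: "transpose (unsym y) = unsym (y :: real^('m::finite uprod))"
proof -
  have "Upair i k = Upair k i" for i k :: 'm by simp
  then have "y $ Upair i k = y $ Upair k i" for i k by (rule arg_cong)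
  then show ?thesis unfolding unsym_def transpose_def vec_eq_iff by simp
qed

lemma sym_lin_unsym: "sym_lin (unsym y) = y"
proof -
  have "sym_lin (unsym y) $ q = y $ q" for q
    using someI_ex[OF Upair_exists[of q]] by (simp add: sym_lin_def unsym_def)
  then show ?thesis by (simp add: vec_eq_iff)
qed

lemma transpose_conjugate:
  fixes S :: "real^'m^'m"
  shows "transpose S = S \<Longrightarrow> transpose (A ** S ** transpose A) = A ** S ** transpose A"
  by (simp add: matrix_transpose_mul matrix_mul_assoc)

section \<open>The inverse metric as a function of the frame matrix\<close>

text \<open>Written with the linear \<open>sym_lin\<close>, so that smoothness and derivatives come
  from the calculus rules; \<open>metric_coord_eq\<close> links it to the charts of
  \<open>\<Sigma>\<close>.\<close>

definition metric_coord :: "'m \<Rightarrow> real^'m^'m \<Rightarrow> real^('m uprod)" where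
  "metric_coord i0 A = sym_lin (A ** \<eta> i0 ** transpose A)"

lemma metric_coord_eq: "sym_entries (A ** \<eta> i0 ** transpose A) = metric_coord i0 A"
  by (simp add: metric_coord_def sym_lin_eq transpose_conjugate transpose_eta)

lemma unsym_metric_coord: "unsym (metric_coord i0 A) = A ** \<eta> i0 ** transpose A"
  by (simp add: metric_coord_def unsym_sym_lin transpose_conjugate transpose_eta)

lemma smooth_on_metric_coord:
  assumes S: "open S" and f: "smooth_on S f"
  shows "smooth_on S (\<lambda>x. metric_coord i0 (f x))"
  unfolding metric_coord_def
  by (rule smooth_on_compose_linear[OF bounded_linear_sym_lin S
        smooth_on_bilinear[OF bounded_bilinear_matrix_mult S
          smooth_on_bilinear[OF bounded_bilinear_matrix_mult S f smooth_on_const[OF S]]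
          smooth_on_compose_linear[OF bounded_linear_transpose S f]]])

lemma metric_coord_has_derivative:
  assumes f: "(f has_derivative D) (at x)"
  shows "((\<lambda>x. metric_coord i0 (f x)) has_derivative
    (\<lambda>v. sym_lin (D v ** \<eta> i0 ** transpose (f x) + f x ** \<eta> i0 ** transpose (D v)))) (at x)"
proof -
  note mm = bounded_bilinear_matrix_mult and t = bounded_linear_transpose
  have "((\<lambda>x. f x ** \<eta> i0) has_derivative (\<lambda>v. D v ** \<eta> i0)) (at x)"
    by (rule bounded_linear.has_derivative[OF bounded_bilinear.bounded_linear_left[OF mm] f])
  from bounded_bilinear.FDERIV[OF mm this bounded_linear.has_derivative[OF t f]]
  have "((\<lambda>x. f x ** \<eta> i0 ** transpose (f x)) has_derivative
      (\<lambda>v. D v ** \<eta> i0 ** transpose (f x) + f x ** \<eta> i0 ** transpose (D v))) (at x)"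
    by (simp add: add.commute)
  from bounded_linear.has_derivative[OF bounded_linear_sym_lin this]
  show ?thesis by (simp add: metric_coord_def)
qed

lemma open_metric_coords: "open (metric_coord i0 ` {A :: real^'m^'m. invertible A})"
proof (rule interior_eq[THEN iffD1], rule equalityI[OF interior_subset], rule image_subsetI)
  let ?S = "{A :: real^'m^'m. invertible A}"
  fix A :: "real^'m^'m" assume A: "A \<in> ?S"
  let ?D = "\<lambda>B. sym_lin (B ** \<eta> i0 ** transpose A + A ** \<eta> i0 ** transpose B)"
  have D: "(metric_coord i0 has_derivative ?D) (at A)"
    using metric_coord_has_derivative[OF has_derivative_ident, of i0 A] .
  \<comment> \<open>\<open>metric_submersion\<close> solves the equation for any symmetric
    right-hand side, and \<open>unsym y\<close> is the symmetric matrix with independent entries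
    \<open>y\<close>.\<close>
  have "\<exists>B. ?D B = y" for y
  proof -
    obtain B where "B ** \<eta> i0 ** transpose A + A ** \<eta> i0 ** transpose B = unsym y"
      using metric_submersion[OF _ transpose_unsym] A by blast
    then have "?D B = y" by (simp add: sym_lin_unsym)
    then show ?thesis ..
  qed
  then have "surj ?D" unfolding surj_def by metis
  then obtain g where g: "linear g" "?D \<circ> g = id"
    using linear_surjective_right_inverse[OF has_derivative_linear[OF D]] by blast
  show "metric_coord i0 A \<in> interior (metric_coord i0 ` ?S)"
  proof (rule sussmann_open_mapping[OF open_invertible _ A D _ g(2) order.refl])
    show "continuous_on ?S (metric_coord i0)"
      using smooth_on_metric_coord[OF open_invertible smooth_on_ident[OF open_invertible]]
      by (rule smooth_on_imp_continuous_on)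
    show "bounded_linear g" using g(1) by (simp add: linear_conv_bounded_linear)
    show "A \<in> interior ?S" using A unfolding interior_open[OF open_invertible] .
  qed
qed

section \<open>Frames in coordinates, and the bundle structures of \<open>LM\<close> and
  \<open>\<Sigma>\<close>\<close>

locale frame_geometry = M: smooth_atlas M for M :: "('a, real^'m) atlas" +
  fixes i0 :: 'm
begin

lemma frame_eq_coord_vec:
  assumes U: "(U, \<phi>) \<in> M" "fst p \<in> U" and u: "snd p j \<in> tangent_space M (fst p)"
  shows "snd p j = coord_vec M (U, \<phi>) (column j (frame_matrix \<phi> p)) (fst p)"
proof -
  obtain w where w: "snd p j = coord_vec M (U, \<phi>) w (fst p)" using M.tangent_coordsE[OF u U] .
  have "frame_matrix \<phi> p $ i $ j = w $ i" for i
    using M.coord_vec_linear_chart[OF U bounded_linear_vec_nth[of i], of w]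
    by (simp add: frame_matrix_def w)
  then have "column j (frame_matrix \<phi> p) = w" by (simp add: column_def vec_eq_iff)
  then show ?thesis using w by simp
qed

lemma frame_matrix_coord_vec:
  assumes U: "(U, \<phi>) \<in> M" "x \<in> U"
  shows "frame_matrix \<phi> (x, \<lambda>j. coord_vec M (U, \<phi>) (column j A) x) = A"
proof -
  have "coord_vec M (U, \<phi>) w x (\<lambda>y. \<phi> y $ i) = w $ i" for w i
    using M.coord_vec_linear_chart[OF U bounded_linear_vec_nth[of i]] .
  then show ?thesis by (simp add: frame_matrix_def column_def vec_eq_iff)
qed

text \<open>In coordinates the combination of the frame vectors with coefficients \<open>c\<close>
  is the frame matrix applied to \<open>c\<close>. Unique solvability over the tangent space
  therefore means that this matrix is invertible.\<close>

lemma LM_iff: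
  assumes U: "(U, \<phi>) \<in> M" "fst p \<in> U"
  shows "p \<in> LM M \<longleftrightarrow> (\<forall>j. snd p j \<in> tangent_space M (fst p)) \<and> invertible (frame_matrix \<phi> p)"
proof -
  obtain x u where p: "p = (x, u)" by (cases p)
  let ?A = "frame_matrix \<phi> p" and ?c = "\<lambda>w. coord_vec M (U, \<phi>) w x"
  have x: "x \<in> U" "x \<in> carrier M" using U by (auto simp: p carrier_def)
  have "(\<forall>v\<in>tangent_space M x. \<exists>!c::real^'m. v = (\<lambda>f. \<Sum>i\<in>UNIV. c $ i * u i f)) \<longleftrightarrow> invertible ?A"
    if u: "\<forall>j. u j \<in> tangent_space M x"
  proof -
    have "(\<lambda>f. \<Sum>i\<in>UNIV. c $ i * u i f) = ?c (?A *v c)" for c :: "real^'m"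
    proof -
      have "u i = ?c (column i ?A)" for i
        using frame_eq_coord_vec[OF U, of i] u by (simp add: p)
      then have "(\<lambda>f. \<Sum>i\<in>UNIV. c $ i * u i f) = (\<lambda>f. \<Sum>i\<in>UNIV. c $ i * ?c (column i ?A) f)"
        by simp
      also have "\<dots> = ?c (\<Sum>i\<in>UNIV. c $ i *\<^sub>R column i ?A)"
        by (rule M.coord_vec_comb[OF U(1) x(1)]) simp
      finally show ?thesis by (simp add: matrix_mult_sum scalar_mult_eq_scaleR)
    qed
    moreover have "?c w = ?c w' \<longleftrightarrow> w = w'" for w w'
      using M.coord_vec_inject[OF U(1) x(1)] by blast
    moreover have "(\<forall>v\<in>tangent_space M x. Q v) \<longleftrightarrow> (\<forall>w. Q (?c w))" for Q
      using M.coord_vec_tangent_space[OF U(1) x(1)] M.tangent_coordsE[OF _ U(1) x(1)] by metis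
    ultimately show ?thesis unfolding invertible_iff_ex1 by simp
  qed
  then show ?thesis using x by (auto simp: p LM_def)
qed

lemma LM_tangent: "p \<in> LM M \<Longrightarrow> snd p j \<in> tangent_space M (fst p)"
  by (auto simp: LM_def)

lemma LM_base: "p \<in> LM M \<Longrightarrow> fst p \<in> carrier M"
  by (auto simp: LM_def)

lemma LM_invertible: "p \<in> LM M \<Longrightarrow> (U, \<phi>) \<in> M \<Longrightarrow> fst p \<in> U \<Longrightarrow> invertible (frame_matrix \<phi> p)"
  using LM_iff by blast

lemma LM_fibre_bij:
  assumes U: "(U, \<phi>) \<in> M" "x \<in> U"
  shows "bij_betw (frame_matrix \<phi>) {p \<in> LM M. fst p = x} {A. invertible A}"
proof (rule bij_betw_imageI)
  show "inj_on (frame_matrix \<phi>) {p \<in> LM M. fst p = x}"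
  proof (rule inj_onI, clarsimp)
    fix u v assume u: "(x, u) \<in> LM M" and v: "(x, v) \<in> LM M"
      and eq: "frame_matrix \<phi> (x, u) = frame_matrix \<phi> (x, v)"
    have "u j = v j" for j
      using frame_eq_coord_vec[OF U(1), of "(x, u)" j] frame_eq_coord_vec[OF U(1), of "(x, v)" j]
        LM_tangent[OF u, of j] LM_tangent[OF v, of j] U eq by simp
    then show "u = v" by auto
  qed
  show "frame_matrix \<phi> ` {p \<in> LM M. fst p = x} = {A. invertible A}"
  proof (intro equalityI subsetI)
    fix A assume A: "A \<in> {A :: real^'m^'m. invertible A}"
    let ?p = "(x, \<lambda>j. coord_vec M (U, \<phi>) (column j A) x)"
    have "?p \<in> LM M"
      using LM_iff[OF U(1), of ?p] A U M.coord_vec_tangent_space[OF U]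
      by (simp add: frame_matrix_coord_vec[OF U])
    then show "A \<in> frame_matrix \<phi> ` {p \<in> LM M. fst p = x}"
      by (intro image_eqI[of _ _ ?p]) (simp_all add: frame_matrix_coord_vec[OF U])
  qed (use LM_invertible U in auto)
qed

definition jacobian :: "'a set \<Rightarrow> ('a \<Rightarrow> real^'m) \<Rightarrow> ('a \<Rightarrow> real^'m) \<Rightarrow> real^'m \<Rightarrow> real^'m^'m" where
  "jacobian U \<phi> \<phi>' z = (\<chi> i k. frechet_derivative (\<lambda>z. \<phi>' (inv_into U \<phi> z)) (at z) (axis k 1) $ i)"

lemma smooth_on_jacobian:
  assumes "(U, \<phi>) \<in> M" "(U', \<phi>') \<in> M"
  shows "smooth_on (\<phi> ` (U \<inter> U')) (jacobian U \<phi> \<phi>')"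
proof -
  note o = M.open_overlap[OF assms]
  show ?thesis
    by (intro smooth_on_vec o)
      (simp add: jacobian_def, rule smooth_on_vec_nth[OF o smooth_on_derivative[OF M.smooth_transition[OF assms]]])
qed

lemma frame_matrix_transition:
  assumes U: "(U, \<phi>) \<in> M" "(U', \<phi>') \<in> M" and p: "p \<in> LM M" "fst p \<in> U" "fst p \<in> U'"
  shows "frame_matrix \<phi>' p = jacobian U \<phi> \<phi>' (\<phi> (fst p)) ** frame_matrix \<phi> p"
proof -
  let ?D = "frechet_derivative (\<lambda>z. \<phi>' (inv_into U \<phi> z)) (at (\<phi> (fst p)))"
  have D: "((\<lambda>z. \<phi>' (inv_into U \<phi> z)) has_derivative ?D) (at (\<phi> (fst p)))"
    by (rule smooth_on_has_derivative[OF M.smooth_transition[OF U] M.open_overlap[OF U]])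
      (use p in blast)
  interpret D: bounded_linear ?D using D by (rule has_derivative_bounded_linear)
  have "frame_matrix \<phi>' p $ i $ j = (jacobian U \<phi> \<phi>' (\<phi> (fst p)) ** frame_matrix \<phi> p) $ i $ j" for i j
  proof -
    have "frame_matrix \<phi>' p $ i $ j = coord_vec M (U, \<phi>) (column j (frame_matrix \<phi> p)) (fst p) (\<lambda>y. \<phi>' y $ i)"
      using frame_eq_coord_vec[OF U(1) p(2) LM_tangent[OF p(1)], of j] by (simp add: frame_matrix_def)
    also have "\<dots> = ?D (column j (frame_matrix \<phi> p)) $ i"
      by (rule M.coord_vec_eq[OF M.smooth_near_linear_chart[OF U(2) p(3) bounded_linear_vec_nth]])
        (rule bounded_linear.has_derivative[OF bounded_linear_vec_nth D])
    also have "\<dots> = ?D (\<Sum>k\<in>UNIV. frame_matrix \<phi> p $ k $ j *\<^sub>R axis k 1) $ i"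
      using basis_expansion[of "column j (frame_matrix \<phi> p)"]
      by (simp add: column_def scalar_mult_eq_scaleR)
    also have "\<dots> = (jacobian U \<phi> \<phi>' (\<phi> (fst p)) ** frame_matrix \<phi> p) $ i $ j"
      by (simp add: D.sum D.scaleR jacobian_def matrix_matrix_mult_def mult.commute)
    finally show ?thesis .
  qed
  then show ?thesis by (simp add: vec_eq_iff)
qed

sublocale LM: fibre_bundle M "LM M" fst frame_matrix "{A. invertible A}" "LM_atlas M"
proof
  fix U U' \<phi> \<phi>' assume U: "(U, \<phi>) \<in> M" "(U', \<phi>') \<in> M"
  note ov = M.open_overlap[OF U]
  have o: "open (\<phi> ` (U \<inter> U') \<times> {A :: real^'m^'m. invertible A})"
    by (intro open_Times ov open_invertible)
  show "\<exists>G. smooth_on (\<phi> ` (U \<inter> U') \<times> {A. invertible A}) G \<and>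
      (\<forall>e\<in>LM M. fst e \<in> U \<inter> U' \<longrightarrow> frame_matrix \<phi>' e = G (\<phi> (fst e), frame_matrix \<phi> e))"
  proof (intro exI[of _ "\<lambda>z. jacobian U \<phi> \<phi>' (fst z) ** snd z"] conjI)
    have "smooth_on (\<phi> ` (U \<inter> U') \<times> {A :: real^'m^'m. invertible A}) (\<lambda>z. jacobian U \<phi> \<phi>' (fst z))"
      by (rule smooth_on_compose[OF o ov smooth_on_linear[OF bounded_linear_fst o] smooth_on_jacobian[OF U]]) auto
    then show "smooth_on (\<phi> ` (U \<inter> U') \<times> {A :: real^'m^'m. invertible A}) (\<lambda>z. jacobian U \<phi> \<phi>' (fst z) ** snd z)"
      by (rule smooth_on_bilinear[OF bounded_bilinear_matrix_mult o _ smooth_on_linear[OF bounded_linear_snd o]])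
  qed (use frame_matrix_transition[OF U] in simp)
qed (use LM_fibre_bij in \<open>auto simp: LM_base LM_atlas_def open_invertible\<close>)

lemma metric_coord_frame:
  "sym_entries (the_elem (frame_metric i0 \<phi> ` p_LM i0 p)) = metric_coord i0 (frame_matrix \<phi> p)"
  unfolding frame_metric_p_LM unfolding frame_metric_def metric_coord_eq ..

lemma act_in_LM:
  assumes p: "p \<in> LM M" and g: "invertible g"
  shows "act p g \<in> LM M"
proof -
  obtain U \<phi> where U: "(U, \<phi>) \<in> M" "fst p \<in> U" using LM_base[OF p] by (rule carrierE)
  have "snd (act p g) j \<in> tangent_space M (fst p)" for j
  proof -
    have "snd (act p g) j = (\<lambda>f. \<Sum>i\<in>UNIV. g $ i $ j * coord_vec M (U, \<phi>) (column i (frame_matrix \<phi> p)) (fst p) f)"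
      using frame_eq_coord_vec[OF U LM_tangent[OF p]] by (simp add: act_def)
    also have "\<dots> = coord_vec M (U, \<phi>) (\<Sum>i\<in>UNIV. g $ i $ j *\<^sub>R column i (frame_matrix \<phi> p)) (fst p)"
      by (rule M.coord_vec_comb[OF U finite])
    finally show ?thesis using M.coord_vec_tangent_space[OF U] by simp
  qed
  then show ?thesis
    using LM_iff[OF U(1), of "act p g"] U g LM_invertible[OF p U]
    by (simp add: frame_matrix_act invertible_mult)
qed

lemma frame_eqI:
  assumes "p \<in> LM M" "q \<in> LM M" "fst p = fst q" "(U, \<phi>) \<in> M" "fst p \<in> U"
    "frame_matrix \<phi> p = frame_matrix \<phi> q"
  shows "p = q"
  by (rule inj_onD[OF bij_betw_imp_inj_on[OF LM_fibre_bij[OF assms(4,5)]]]) (use assms in auto)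

sublocale Sig: fibre_bundle M "Sig M i0" tau_Sig "\<lambda>\<phi> e. sym_entries (the_elem (frame_metric i0 \<phi> ` e))"
  "metric_coord i0 ` {A. invertible A}" "Sig_atlas M i0"
proof
  show "tau_Sig e \<in> carrier M" if "e \<in> Sig M i0" for e
    using that LM_base by (auto simp: Sig_def)
  show "open (metric_coord i0 ` {A :: real^'m^'m. invertible A})" by (rule open_metric_coords)
  show "Sig_atlas M i0 = {({e \<in> Sig M i0. tau_Sig e \<in> U},
      \<lambda>e. (\<phi> (tau_Sig e), sym_entries (the_elem (frame_metric i0 \<phi> ` e)))) |U \<phi>. (U, \<phi>) \<in> M}"
    by (simp add: Sig_atlas_def)
next
  fix U \<phi> x assume U: "(U, \<phi>) \<in> M" "x \<in> U"
  let ?F = "\<lambda>e. sym_entries (the_elem (frame_metric i0 \<phi> ` e))"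
  have fib: "{e \<in> Sig M i0. tau_Sig e = x} = p_LM i0 ` {p \<in> LM M. fst p = x}"
    by (auto simp: Sig_def)
  show "bij_betw ?F {e \<in> Sig M i0. tau_Sig e = x} (metric_coord i0 ` {A. invertible A})"
  proof (rule bij_betw_imageI)
    show "?F ` {e \<in> Sig M i0. tau_Sig e = x} = metric_coord i0 ` {A. invertible A}"
      unfolding fib LM_fibre_bij[OF U, THEN bij_betw_imp_surj_on, symmetric] image_image metric_coord_frame ..
    show "inj_on ?F {e \<in> Sig M i0. tau_Sig e = x}"
      unfolding fib
    proof (rule inj_onI)
      fix e e' assume "e \<in> p_LM i0 ` {p \<in> LM M. fst p = x}" "e' \<in> p_LM i0 ` {p \<in> LM M. fst p = x}"
        and eq: "?F e = ?F e'"
      then obtain p q where p: "e = p_LM i0 p" "p \<in> LM M" "fst p = x"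
        and q: "e' = p_LM i0 q" "q \<in> LM M" "fst q = x" by blast
      have pU: "fst p \<in> U" "fst q \<in> U" using p q U by auto
      \<comment> \<open>Frames with equal metric lie in one \<open>K\<close>-orbit by
        \<open>metric_orbit_invariant\<close>, so the coordinates separate the points of the
        fibre.\<close>
      have "metric_coord i0 (frame_matrix \<phi> p) = metric_coord i0 (frame_matrix \<phi> q)"
        using eq by (simp add: p q metric_coord_frame)
      then obtain k where k: "k \<in> K i0" "frame_matrix \<phi> q = frame_matrix \<phi> p ** k"
        using metric_orbit_invariant[OF LM_invertible[OF p(2) U(1) pU(1)] LM_invertible[OF q(2) U(1) pU(2)]]
        by (metis unsym_metric_coord)
      have "q = act p k"
        using k(2) p q act_in_LM[OF p(2) K_invertible[OF k(1)]] pU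
        by (intro frame_eqI[OF q(2) _ _ U(1)]) (simp_all add: frame_matrix_act)
      then show "e = e'" by (simp add: p q p_LM_act[OF k(1)])
    qed
  qed
next
  fix U U' \<phi> \<phi>' assume U: "(U, \<phi>) \<in> M" "(U', \<phi>') \<in> M"
  let ?R = "metric_coord i0 ` {A :: real^'m^'m. invertible A}"
  let ?J = "\<lambda>z :: (real^'m) \<times> (real^'m uprod). jacobian U \<phi> \<phi>' (fst z)"
  \<comment> \<open>An inverse metric \<open>S\<close> transforms into \<open>J S J\<^sup>T\<close>,
    with \<open>J\<close> the Jacobian. The translations \<open>unsym\<close> and
    \<open>sym_lin\<close> between \<open>S\<close> and its entries are linear, which makes
    \<open>?G\<close> smooth.\<close>
  let ?G = "\<lambda>z. sym_lin (?J z ** unsym (snd z) ** transpose (?J z))"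
  note ov = M.open_overlap[OF U]
  have o: "open (\<phi> ` (U \<inter> U') \<times> ?R)" by (intro open_Times ov open_metric_coords)
  show "\<exists>G. smooth_on (\<phi> ` (U \<inter> U') \<times> ?R) G \<and> (\<forall>e\<in>Sig M i0. tau_Sig e \<in> U \<inter> U' \<longrightarrow>
      sym_entries (the_elem (frame_metric i0 \<phi>' ` e)) =
        G (\<phi> (tau_Sig e), sym_entries (the_elem (frame_metric i0 \<phi> ` e))))"
  proof (intro exI[of _ ?G] conjI ballI impI)
    have J: "smooth_on (\<phi> ` (U \<inter> U') \<times> ?R) ?J"
      by (rule smooth_on_compose[OF o ov smooth_on_linear[OF bounded_linear_fst o] smooth_on_jacobian[OF U]]) auto
    show "smooth_on (\<phi> ` (U \<inter> U') \<times> ?R) ?G"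
      by (rule smooth_on_compose_linear[OF bounded_linear_sym_lin o
          smooth_on_bilinear[OF bounded_bilinear_matrix_mult o
            smooth_on_bilinear[OF bounded_bilinear_matrix_mult o J
              smooth_on_compose_linear[OF bounded_linear_unsym o smooth_on_linear[OF bounded_linear_snd o]]]
            smooth_on_compose_linear[OF bounded_linear_transpose o J]]])
    fix e assume "e \<in> Sig M i0" and x: "tau_Sig e \<in> U \<inter> U'"
    then obtain p where p: "e = p_LM i0 p" "p \<in> LM M" by (auto simp: Sig_def)
    let ?j = "jacobian U \<phi> \<phi>' (\<phi> (fst p))"
    have "metric_coord i0 (frame_matrix \<phi>' p) =
        sym_lin (?j ** (frame_matrix \<phi> p ** \<eta> i0 ** transpose (frame_matrix \<phi> p)) ** transpose ?j)"
      using frame_matrix_transition[OF U p(2)] x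
      by (simp add: p metric_coord_def matrix_transpose_mul matrix_mul_assoc)
    then show "sym_entries (the_elem (frame_metric i0 \<phi>' ` e)) =
        ?G (\<phi> (tau_Sig e), sym_entries (the_elem (frame_metric i0 \<phi> ` e)))"
      by (simp add: p metric_coord_frame unsym_metric_coord)
  qed
qed

end


section \<open>Vertical vectors and fundamental vector fields\<close>

lemma tangent_space_diff:
  assumes "v \<in> tangent_space A p" "w \<in> tangent_space A p"
  shows "(\<lambda>f. v f - w f) \<in> tangent_space A p"
  using assms unfolding tangent_space_def by (simp add: algebra_simps)

context fibre_bundle
begin

lemma tangent_section_projection:
  assumes s: "local_section M E \<pi> x s" and v: "v \<in> tangent_space M x" and g: "smooth_near M x g"
  shows "v (\<lambda>y. g (\<pi> (s y))) = v g"
proof -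
  obtain U \<phi> where U: "(U, \<phi>) \<in> M" "x \<in> U" using M.smooth_near_domainE[OF g] .
  obtain W where W: "open W" "\<phi> x \<in> W" "W \<subseteq> \<phi> ` U"
    and p: "\<And>z. z \<in> W \<Longrightarrow> \<pi> (s (inv_into U \<phi> z)) = inv_into U \<phi> z"
    using local_section_chart[OF s U] by metis
  show ?thesis
    by (rule tangent_space_local[OF v g _ U W]) (simp_all only: p local_section_base[OF s])
qed

text \<open>Applied to \<open>g \<circ> \<pi>\<close>, both terms of the contact form give
  \<open>W (g \<circ> jsource)\<close>: the first because \<open>\<pi> \<circ> jtarget\<close> is
  \<open>jsource\<close> on jets, the second because \<open>\<pi> \<circ> s\<close> is the identity
  near the source. Verticality is what lets \<open>cartan\<close> read the form as a matrix.\<close>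

lemma
  assumes j: "j \<in> J1 M E \<pi>" and W: "W \<in> tangent_space (J1_atlas M E \<pi>) j"
  shows contact_form_tangent: "contact_form M E j W \<in> tangent_space E (jtarget j)"
    and contact_form_vertical: "tmap M \<pi> (jtarget j) (contact_form M E j W) = (\<lambda>_. 0)"
proof -
  let ?x = "jsource j" and ?s = "jrep j" and ?v = "tmap M jsource j W"
  note s = J1_jrep(2)[OF j] and v = tmap_jsource_tangent[OF j W] and t = J1_target[OF j]
  show "contact_form M E j W \<in> tangent_space E (jtarget j)"
    unfolding contact_form_def
    using tangent_space_diff[OF tmap_jtarget_tangent[OF j W]] section_tmap_tangent[OF s v]
    by (simp add: jtarget_eq)
  show "tmap M \<pi> (jtarget j) (contact_form M E j W) = (\<lambda>_. 0)"
  proof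
    fix g
    show "tmap M \<pi> (jtarget j) (contact_form M E j W) g = 0"
    proof (cases "smooth_near M ?x g")
      case g: True
      have gp: "smooth_near E (jtarget j) (\<lambda>e. g (\<pi> e))"
        using smooth_near_projection[OF t(1)] g t by simp
      have "W (\<lambda>i. g (\<pi> (jtarget i))) = W (\<lambda>i. g (jsource i))"
        by (rule J1_tangent_cong[OF W j smooth_near_jsource[OF j g]]) (simp add: J1_target)
      then have 1: "tmap E jtarget j W (\<lambda>e. g (\<pi> e)) = W (\<lambda>i. g (jsource i))"
        using gp by (simp add: tmap_def comp_def)
      have 2: "tmap E ?s ?x ?v (\<lambda>e. g (\<pi> e)) = ?v g"
        using tangent_section_projection[OF s v g] gp
        by (simp add: tmap_def[of E ?s] comp_def jtarget_eq)
      have "?v g = W (\<lambda>i. g (jsource i))" using g by (simp add: tmap_def comp_def)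
      moreover have "tmap M \<pi> (jtarget j) (contact_form M E j W) g = contact_form M E j W (\<lambda>e. g (\<pi> e))"
        using g t by (simp add: tmap_def[of M \<pi>] comp_def)
      ultimately show ?thesis by (simp only: contact_form_def 1 2)
    qed (simp add: tmap_def t)
  qed
qed

text \<open>The base components of a vector are its values on coordinate functions pulled back from
  \<open>M\<close>, and these vanish on a vertical vector.\<close>

lemma vertical_coords:
  assumes U: "(U, \<phi>) \<in> M" and e: "e \<in> over U" and v: "v \<in> tangent_space E e"
    and 0: "tmap M \<pi> e v = (\<lambda>_. 0)"
  obtains b where "v = coord_vec E (over U, chart \<phi>) (0, b) e"
proof -
  note V = chart_in_E[OF U]
  obtain w where w: "v = coord_vec E (over U, chart \<phi>) w e" using E.tangent_coordsE[OF v V e] .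
  have "fst w \<bullet> b = 0" for b
  proof -
    have h: "bounded_linear (\<lambda>z :: (real^'m) \<times> 'f. fst z \<bullet> b)"
      by (rule bounded_linear_compose[OF bounded_linear_inner_left bounded_linear_fst])
    have "v (\<lambda>q. \<phi> (\<pi> q) \<bullet> b) = fst w \<bullet> b"
      using E.coord_vec_linear_chart[OF V e h] by (simp add: w)
    moreover have "smooth_near M (\<pi> e) (\<lambda>y. \<phi> y \<bullet> b)"
      using M.smooth_near_linear_chart[OF U _ bounded_linear_inner_left] e by simp
    ultimately show ?thesis
      using fun_cong[OF 0, of "\<lambda>y. \<phi> y \<bullet> b"] by (simp add: tmap_def comp_def)
  qed
  from this[of "fst w"] have "w = (0, snd w)" by (simp add: prod_eq_iff)
  with w have "v = coord_vec E (over U, chart \<phi>) (0, snd w) e" by simp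
  then show ?thesis by (rule that)
qed

end

section \<open>The matrix exponential and the fundamental vectors\<close>

text \<open>Each entry of \<open>mexp (t *\<^sub>R A)\<close> is a real power series in
  \<open>t\<close> whose coefficients are the entries of the powers of \<open>A\<close> over
  factorials. Value and derivative at \<open>0\<close> are its first two coefficients.\<close>

lemma
  fixes A :: "real^'m^'m"
  shows mexp_zero: "mexp (0 *\<^sub>R A) = mat 1"
    and mexp_has_derivative: "((\<lambda>t. mexp (t *\<^sub>R A)) has_derivative (\<lambda>t. t *\<^sub>R A)) (at 0)"
proof -
  define P where "P n = ((**) A ^^ n) (mat 1 :: real^'m^'m)" for n
  have P0: "P 0 = mat 1" and PS: "P (Suc n) = A ** P n" for n by (simp_all add: P_def)
  have pow: "((**) (t *\<^sub>R A) ^^ n) (mat 1) = t ^ n *\<^sub>R P n" for t n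
    by (induction n) (simp_all add: P0 PS bounded_bilinear.scaleR_left[OF bounded_bilinear_matrix_mult]
        bounded_bilinear.scaleR_right[OF bounded_bilinear_matrix_mult] mult.commute)
  \<comment> \<open>\<open>C\<close> bounds the matrix product as a bilinear map. The
    \<open>n\<close>-th power of \<open>A\<close> is then at most a constant times
    \<open>(norm A * C) ^ n\<close>, and a scalar exponential series dominates.\<close>
  obtain C where C: "\<And>(X :: real^'m^'m) (Y :: real^'m^'m). norm (X ** Y) \<le> norm X * norm Y * C" "C \<ge> 0"
    using bounded_bilinear.nonneg_bounded[OF bounded_bilinear_matrix_mult] by blast
  have nP: "norm (P n) \<le> norm (mat 1 :: real^'m^'m) * (norm A * C) ^ n" for n
  proof (induction n)
    case (Suc n)
    have "norm (P (Suc n)) \<le> (norm A * C) * norm (P n)" using C(1)[of A "P n"] by (simp add: PS mult_ac)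
    also have "\<dots> \<le> (norm A * C) * (norm (mat 1 :: real^'m^'m) * (norm A * C) ^ n)"
      by (rule mult_left_mono[OF Suc]) (use C in simp)
    finally show ?case by (simp add: mult_ac)
  qed (simp add: P0)
  have summ: "summable (\<lambda>n. (1 / fact n) *\<^sub>R (t ^ n *\<^sub>R P n))" for t
  proof (rule summable_comparison_test')
    show "summable (\<lambda>n. norm (mat 1 :: real^'m^'m) * (inverse (fact n) * (\<bar>t\<bar> * (norm A * C)) ^ n))"
      by (intro summable_mult summable_exp)
    show "norm ((1 / fact n) *\<^sub>R (t ^ n *\<^sub>R P n))
        \<le> norm (mat 1 :: real^'m^'m) * (inverse (fact n) * (\<bar>t\<bar> * (norm A * C)) ^ n)" if "n \<ge> 0" for n
    proof -
      have "norm ((1 / fact n) *\<^sub>R (t ^ n *\<^sub>R P n)) = (inverse (fact n) * \<bar>t\<bar> ^ n) * norm (P n)"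
        by (simp add: power_abs divide_simps)
      also have "\<dots> \<le> (inverse (fact n) * \<bar>t\<bar> ^ n) * (norm (mat 1 :: real^'m^'m) * (norm A * C) ^ n)"
        by (rule mult_left_mono[OF nP]) simp
      finally show ?thesis by (simp add: power_mult_distrib mult_ac)
    qed
  qed
  define c where "c i j n = P n $ i $ j / fact n" for i j n
  have bl: "bounded_linear (\<lambda>X :: real^'m^'m. X $ i $ j)" for i j
    by (rule bounded_linear_compose[OF bounded_linear_vec_nth bounded_linear_vec_nth])
  have sc: "summable (\<lambda>n. c i j n * t ^ n)" for i j t
    using bounded_linear.summable[OF bl summ] by (simp add: c_def mult.commute)
  have entry: "mexp (t *\<^sub>R A) $ i $ j = (\<Sum>n. c i j n * t ^ n)" for i j t
    using bounded_linear.suminf[OF bl summ] by (simp add: mexp_def pow c_def mult.commute)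
  have "mexp (0 *\<^sub>R A) $ i $ j = mat 1 $ i $ j" for i j
    unfolding entry powser_zero by (simp add: c_def P0)
  then show "mexp (0 *\<^sub>R A) = mat 1" by (simp add: vec_eq_iff)
  have d: "((\<lambda>t. mexp (t *\<^sub>R A) $ i $ j) has_derivative (\<lambda>t. (t *\<^sub>R A) $ i $ j)) (at 0)" for i j
  proof -
    have "((\<lambda>t. mexp (t *\<^sub>R A) $ i $ j) has_field_derivative (\<Sum>n. diffs (c i j) n * 0 ^ n)) (at 0)"
      unfolding entry by (rule termdiffs_strong_converges_everywhere[OF sc])
    then show ?thesis
      unfolding powser_zero has_field_derivative_def
      by (simp add: diffs_def c_def PS P0 mult_commute_abs)
  qed
  show "((\<lambda>t. mexp (t *\<^sub>R A)) has_derivative (\<lambda>t. t *\<^sub>R A)) (at 0)"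
  proof (rule has_derivative_componentwise_within[THEN iffD2], rule ballI)
    fix b :: "real^'m^'m" assume "b \<in> Basis"
    then obtain i j where "b = axis i (axis j 1)" by (auto simp: Basis_vec_def)
    then show "((\<lambda>t. mexp (t *\<^sub>R A) \<bullet> b) has_derivative (\<lambda>t. t *\<^sub>R A \<bullet> b)) (at 0)"
      using d[of i j] by (simp add: inner_axis)
  qed
qed

context frame_geometry
begin

text \<open>Serves both \<open>p_LM\<close> and the right action. The chart is onto an open product,
  so a coordinate formula \<open>h\<close> is the local representative of \<open>f\<close> on the
  whole chart domain.\<close>

lemma smooth_rep_of_LM:
  assumes U: "(U, \<phi>) \<in> M" and h: "smooth_on (\<phi> ` U \<times> {A. invertible A}) h"
    and f: "\<And>q. q \<in> LM.over U \<Longrightarrow> f q \<in> V" "\<And>q. q \<in> LM.over U \<Longrightarrow> \<psi> (f q) = h (LM.chart \<phi> q)"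
    and q: "q \<in> LM.over U"
  shows "smooth_rep (LM.over U) (LM.chart \<phi>) V \<psi> q f"
    and "frechet_derivative (\<lambda>z. \<psi> (f (inv_into (LM.over U) (LM.chart \<phi>) z))) (at (LM.chart \<phi> q))
      = frechet_derivative h (at (LM.chart \<phi> q))"
proof -
  let ?W = "\<phi> ` U \<times> {A :: real^'m^'m. invertible A}" and ?I = "inv_into (LM.over U) (LM.chart \<phi>)"
  have im: "LM.chart \<phi> ` LM.over U = ?W" by (rule LM.chart_image[OF U order.refl])
  have o: "open ?W" by (intro open_Times M.open_image[OF U] open_invertible)
  have I: "?I z \<in> LM.over U" "LM.chart \<phi> (?I z) = z" if "z \<in> ?W" for z
    using that unfolding im[symmetric] by (rule inv_into_into, rule f_inv_into_f)
  have eq: "h z = \<psi> (f (?I z))" if "z \<in> ?W" for z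
    using f(2)[OF I(1)[OF that]] I(2)[OF that] by simp
  have qW: "LM.chart \<phi> q \<in> ?W" using im q by blast
  show "smooth_rep (LM.over U) (LM.chart \<phi>) V \<psi> q f"
    unfolding smooth_rep_def
    using o qW im f(1)[OF I(1)] smooth_on_cong[OF o h eq] by (intro exI[of _ ?W]) auto
  show "frechet_derivative (\<lambda>z. \<psi> (f (?I z))) (at (LM.chart \<phi> q)) = frechet_derivative h (at (LM.chart \<phi> q))"
    by (rule frechet_derivative_cong_open[OF o qW eq[symmetric]])
qed

lemma open_LM_chart: "(U, \<phi>) \<in> M \<Longrightarrow> open (\<phi> ` U \<times> {A :: real^'m^'m. invertible A})"
  by (intro open_Times M.open_image open_invertible)

sublocale LS: two_atlases "LM_atlas M" "Sig_atlas M i0" ..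
sublocale LL: two_atlases "LM_atlas M" "LM_atlas M" ..

lemma Sig_chart_p_LM: "Sig.chart \<phi> (p_LM i0 q) = (\<phi> (fst q), metric_coord i0 (frame_matrix \<phi> q))"
  by (simp add: metric_coord_frame)

lemma p_LM_in_over: "q \<in> LM.over U \<Longrightarrow> p_LM i0 q \<in> Sig.over U"
  by (auto simp: Sig_def)

lemma
  assumes U: "(U, \<phi>) \<in> M" and q: "q \<in> LM.over U"
  shows p_LM_rep: "smooth_rep (LM.over U) (LM.chart \<phi>) (Sig.over U) (Sig.chart \<phi>) q (p_LM i0)"
    and tmap_p_LM: "tmap (Sig_atlas M i0) (p_LM i0) q (coord_vec (LM_atlas M) (LM.over U, LM.chart \<phi>) (w, B) q) =
      coord_vec (Sig_atlas M i0) (Sig.over U, Sig.chart \<phi>)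
        (w, sym_lin (B ** \<eta> i0 ** transpose (frame_matrix \<phi> q) + frame_matrix \<phi> q ** \<eta> i0 ** transpose B)) (p_LM i0 q)"
proof -
  note o = open_LM_chart[OF U]
  let ?h = "\<lambda>z :: (real^'m) \<times> (real^'m^'m). (fst z, metric_coord i0 (snd z))"
  have h: "smooth_on (\<phi> ` U \<times> {A. invertible A}) ?h"
    by (rule smooth_on_Pair[OF o smooth_on_linear[OF bounded_linear_fst o]
          smooth_on_metric_coord[OF o smooth_on_linear[OF bounded_linear_snd o]]])
  have eq: "Sig.chart \<phi> (p_LM i0 r) = ?h (LM.chart \<phi> r)" for r
    by (simp only: Sig_chart_p_LM fst_conv snd_conv)
  show rep: "smooth_rep (LM.over U) (LM.chart \<phi>) (Sig.over U) (Sig.chart \<phi>) q (p_LM i0)"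
    by (rule smooth_rep_of_LM(1)[OF U h p_LM_in_over eq q])
  have "(?h has_derivative (\<lambda>v. (fst v, sym_lin (snd v ** \<eta> i0 ** transpose (snd (LM.chart \<phi> q)) +
      snd (LM.chart \<phi> q) ** \<eta> i0 ** transpose (snd v))))) (at (LM.chart \<phi> q))"
    by (rule has_derivative_Pair[OF bounded_linear_imp_has_derivative[OF bounded_linear_fst]
          metric_coord_has_derivative[OF bounded_linear_imp_has_derivative[OF bounded_linear_snd]]])
  note D = fun_cong[OF frechet_derivative_at[OF this, symmetric], of "(w, B)", unfolded fst_conv snd_conv]
  show "tmap (Sig_atlas M i0) (p_LM i0) q (coord_vec (LM_atlas M) (LM.over U, LM.chart \<phi>) (w, B) q) =
      coord_vec (Sig_atlas M i0) (Sig.over U, Sig.chart \<phi>)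
        (w, sym_lin (B ** \<eta> i0 ** transpose (frame_matrix \<phi> q) + frame_matrix \<phi> q ** \<eta> i0 ** transpose B)) (p_LM i0 q)"
    using LS.tmap_coord_vec[OF LM.chart_in_E[OF U] q Sig.chart_in_E[OF U] rep, of "(w, B)"] D
      fun_cong[where x = "(w, B)", OF smooth_rep_of_LM(2)[where \<psi> = "Sig.chart \<phi>" and f = "p_LM i0",
          OF U h p_LM_in_over eq q]]
    by (simp only:)
qed

lemma act_rep:
  assumes U: "(U, \<phi>) \<in> M" and q: "q \<in> LM.over U" and g: "invertible g"
  shows "smooth_rep (LM.over U) (LM.chart \<phi>) (LM.over U) (LM.chart \<phi>) q (\<lambda>r. act r g)"
proof (rule smooth_rep_of_LM(1)[OF U _ _ _ q])
  note o = open_LM_chart[OF U]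
  show "smooth_on (\<phi> ` U \<times> {A :: real^'m^'m. invertible A}) (\<lambda>z. (fst z, snd z ** g))"
    by (rule smooth_on_Pair[OF o smooth_on_linear[OF bounded_linear_fst o]
          smooth_on_bilinear[OF bounded_bilinear_matrix_mult o smooth_on_linear[OF bounded_linear_snd o]
            smooth_on_const[OF o]]])
qed (use act_in_LM g in \<open>auto simp: frame_matrix_act\<close>)

lemma LM_overE:
  assumes "q \<in> LM M"
  obtains U \<phi> where "(U, \<phi>) \<in> M" "q \<in> LM.over U"
  using LM_base[OF assms] assms carrierE[of "fst q" M] by blast

lemma smooth_near_p_LM:
  "q \<in> LM M \<Longrightarrow> smooth_near (Sig_atlas M i0) (p_LM i0 q) f \<Longrightarrow> smooth_near (LM_atlas M) q (\<lambda>r. f (p_LM i0 r))"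
  by (erule LM_overE) (rule LS.smooth_near_comp[OF LM.chart_in_E _ Sig.chart_in_E p_LM_rep])

lemma smooth_near_act:
  "q \<in> LM M \<Longrightarrow> invertible g \<Longrightarrow> smooth_near (LM_atlas M) (act q g) f \<Longrightarrow> smooth_near (LM_atlas M) q (\<lambda>r. f (act r g))"
  by (erule LM_overE) (rule LL.smooth_near_comp[OF LM.chart_in_E _ LM.chart_in_E act_rep])

text \<open>In coordinates the curve of frames keeps its base point and has matrix \<open>U\<close>
  times \<open>mexp (t *\<^sub>R A)\<close>, whose velocity at \<open>0\<close> is
  \<open>U ** A\<close>.\<close>

lemma fundamental_coord_vec:
  assumes U: "(U, \<phi>) \<in> M" and q: "q \<in> LM.over U"
  shows "fundamental M q A = coord_vec (LM_atlas M) (LM.over U, LM.chart \<phi>) (0, frame_matrix \<phi> q ** A) q"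
proof
  fix f
  note V = LM.chart_in_E[OF U]
  let ?c = "LM.chart \<phi>" and ?I = "inv_into (LM.over U) (LM.chart \<phi>)" and ?U = "frame_matrix \<phi> q"
  show "fundamental M q A f = coord_vec (LM_atlas M) (LM.over U, ?c) (0, ?U ** A) q f"
  proof (cases "smooth_near (LM_atlas M) q f")
    case f: True
    let ?D = "frechet_derivative (\<lambda>z. f (?I z)) (at (?c q))"
    define h where "h t = (\<phi> (fst q), ?U ** mexp (t *\<^sub>R A))" for t
    note D = LM.E.smooth_near_has_derivative[OF f V q]
    interpret D: bounded_linear ?D using D by (rule has_derivative_bounded_linear)
    have h0: "h 0 = ?c q" unfolding h_def mexp_zero by simp
    have dh: "(h has_derivative (\<lambda>t. (0, ?U ** (t *\<^sub>R A)))) (at 0)"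
      unfolding h_def
      by (rule has_derivative_Pair[OF has_derivative_const bounded_linear.has_derivative[OF
            bounded_bilinear.bounded_linear_right[OF bounded_bilinear_matrix_mult] mexp_has_derivative]])
    have eqD: "?D (0, ?U ** (t *\<^sub>R A)) = ?D (0, ?U ** A) * t" for t
      using D.scaleR[of t "(0, ?U ** A)"] by (simp add: bounded_bilinear.scaleR_right[OF bounded_bilinear_matrix_mult] mult.commute)
    have "((\<lambda>t. f (?I (h t))) has_derivative (\<lambda>t. ?D (0, ?U ** (t *\<^sub>R A)))) (at 0)"
      by (rule has_derivative_compose[OF dh]) (use D h0 in simp)
    then have der: "((\<lambda>t. f (?I (h t))) has_field_derivative ?D (0, ?U ** A)) (at 0)"
      unfolding eqD has_field_derivative_def .
    have inv1: "invertible (mat 1 :: real^'m^'m)" by (simp add: invertible_det_nz)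
    \<comment> \<open>The chart can be inverted at \<open>act q (mexp (t *\<^sub>R A))\<close> only
      where this is a frame. Near \<open>t = 0\<close> it is, as the exponential tends to the
      identity and invertible matrices form an open set.\<close>
    have "((\<lambda>t. mexp (t *\<^sub>R A)) \<longlongrightarrow> mexp (0 *\<^sub>R A)) (nhds 0)"
      using has_derivative_continuous[OF mexp_has_derivative[of A]]
        tendsto_at_iff_tendsto_nhds[of "\<lambda>t. mexp (t *\<^sub>R A)" 0]
      by (simp add: continuous_within)
    then have "\<forall>\<^sub>F t in nhds 0. mexp (t *\<^sub>R A) \<in> {A. invertible A}"
      by (rule topological_tendstoD[OF _ open_invertible])
        (simp only: mexp_zero mem_Collect_eq inv1)
    then have ev: "\<forall>\<^sub>F t in nhds 0. f (?I (h t)) = f (act q (mexp (t *\<^sub>R A)))"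
    proof (rule eventually_mono)
      fix t assume "mexp (t *\<^sub>R A) \<in> {A. invertible A}"
      then have "act q (mexp (t *\<^sub>R A)) \<in> LM.over U" using q act_in_LM by simp
      moreover have "h t = ?c (act q (mexp (t *\<^sub>R A)))" by (simp add: h_def frame_matrix_act)
      ultimately show "f (?I (h t)) = f (act q (mexp (t *\<^sub>R A)))"
        using LM.E.inv_chart[OF V] by (simp only:)
    qed
    have "((\<lambda>t. f (act q (mexp (t *\<^sub>R A)))) has_field_derivative ?D (0, ?U ** A)) (at 0)"
      using DERIV_cong_ev[OF refl ev refl] der by blast
    then show ?thesis
      by (simp add: fundamental_def f DERIV_imp_deriv LM.E.coord_vec_eq[OF f D])
  qed (simp add: fundamental_def coord_vec_def)
qed

text \<open>In coordinates the equation is \<open>U ** A = B\<close> with \<open>U\<close>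
  invertible. This makes the \<open>THE\<close> in \<open>cartan\<close> well defined.\<close>

lemma vertical_fundamental:
  assumes q: "q \<in> LM M" and v: "v \<in> tangent_space (LM_atlas M) q" and 0: "tmap M fst q v = (\<lambda>_. 0)"
  shows "\<exists>!A. fundamental M q A = v"
proof -
  obtain U \<phi> where U: "(U, \<phi>) \<in> M" and qU: "q \<in> LM.over U" using LM_overE[OF q] .
  let ?U = "frame_matrix \<phi> q"
  have inv: "invertible ?U" using LM_invertible[OF q U] qU by simp
  obtain B where B: "v = coord_vec (LM_atlas M) (LM.over U, LM.chart \<phi>) (0, B) q"
    using LM.vertical_coords[OF U qU v 0] .
  have "fundamental M q A = v \<longleftrightarrow> ?U ** A = B" for A
    unfolding fundamental_coord_vec[OF U qU] B
    using LM.E.coord_vec_inject[OF LM.chart_in_E[OF U] qU] by blast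
  moreover have "?U ** A = B \<longleftrightarrow> A = matrix_inv ?U ** B" for A
    by (metis inv matrix_inv_mult matrix_mul_assoc matrix_mul_lid)
  ultimately show ?thesis by simp
qed

lemma fundamental_cartan:
  assumes j: "j \<in> J1_tau M" and W: "W \<in> tangent_space (J1_tau_atlas M) j"
  shows "fundamental M (jtarget j) (cartan M j W) = contact_form M (LM_atlas M) j W"
  unfolding cartan_def
  by (rule theI', rule vertical_fundamental[OF LM.J1_target(1)[OF j] LM.contact_form_tangent[OF j W]
        LM.contact_form_vertical[OF j W]])

lemma eta_cancel: "\<eta> i0 ** (\<eta> i0 ** X) = X" "X ** \<eta> i0 ** \<eta> i0 = X"
  by (simp_all add: matrix_mul_assoc eta_eta flip: matrix_mul_assoc[of X])

text \<open>\<open>\<pi>\<^sub>\<pp> i0 A ** \<eta> i0\<close> is half of the right-hand side, hence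
  symmetric; the second summand is its transpose and contributes the other half.\<close>

lemma pi_p_metric: "\<pi>\<^sub>\<pp> i0 A ** \<eta> i0 + \<eta> i0 ** transpose (\<pi>\<^sub>\<pp> i0 A) = A ** \<eta> i0 + \<eta> i0 ** transpose A"
proof -
  let ?B = "\<eta> i0 ** transpose A ** \<eta> i0"
  have 1: "?B ** \<eta> i0 = \<eta> i0 ** transpose A" by (simp add: eta_cancel)
  have "transpose ?B = \<eta> i0 ** (A ** \<eta> i0)"
    by (simp add: matrix_transpose_mul transpose_eta)
  then have 2: "\<eta> i0 ** transpose ?B = A ** \<eta> i0" by (simp add: eta_cancel)
  have "\<pi>\<^sub>\<pp> i0 A ** \<eta> i0 = (1/2) *\<^sub>R (A ** \<eta> i0 + ?B ** \<eta> i0)"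
    unfolding \<pi>\<^sub>\<pp>_def
    by (simp only: bounded_bilinear.scaleR_left[OF bounded_bilinear_matrix_mult]
        bounded_bilinear.add_left[OF bounded_bilinear_matrix_mult])
  moreover have "\<eta> i0 ** transpose (\<pi>\<^sub>\<pp> i0 A) = (1/2) *\<^sub>R (\<eta> i0 ** transpose A + \<eta> i0 ** transpose ?B)"
    unfolding \<pi>\<^sub>\<pp>_def
    by (simp only: linear_simps[OF bounded_linear_transpose]
        linear_simps[OF bounded_bilinear.bounded_linear_right[OF bounded_bilinear_matrix_mult]])
  ultimately show ?thesis unfolding 1 2
    by (simp add: add.commute flip: scaleR_add_right scaleR_add_left) (simp add: algebra_simps flip: scaleR_add_left)
qed

lemma tmap_p_LM_fundamental:
  assumes U: "(U, \<phi>) \<in> M" and q: "q \<in> LM.over U"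
  shows "tmap (Sig_atlas M i0) (p_LM i0) q (fundamental M q A) =
    coord_vec (Sig_atlas M i0) (Sig.over U, Sig.chart \<phi>) (0, sym_lin (frame_matrix \<phi> q **
      (A ** \<eta> i0 + \<eta> i0 ** transpose A) ** transpose (frame_matrix \<phi> q))) (p_LM i0 q)"
proof -
  let ?U = "frame_matrix \<phi> q"
  have "(?U ** A) ** \<eta> i0 ** transpose ?U + ?U ** \<eta> i0 ** transpose (?U ** A) =
      ?U ** (A ** \<eta> i0 + \<eta> i0 ** transpose A) ** transpose ?U"
    by (simp add: matrix_transpose_mul matrix_mul_assoc matrix_add_ldistrib
        bounded_bilinear.add_left[OF bounded_bilinear_matrix_mult])
  then show ?thesis unfolding fundamental_coord_vec[OF U q] tmap_p_LM[OF U q] by simp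
qed

lemma tmap_p_LM_pi_p:
  assumes "q \<in> LM M"
  shows "tmap (Sig_atlas M i0) (p_LM i0) q (fundamental M q (\<pi>\<^sub>\<pp> i0 A)) =
    tmap (Sig_atlas M i0) (p_LM i0) q (fundamental M q A)"
  using assms by (rule LM_overE) (simp add: tmap_p_LM_fundamental pi_p_metric)

lemma tmap_p_LM_pi_p_zero:
  assumes q: "q \<in> LM M"
    and 0: "tmap (Sig_atlas M i0) (p_LM i0) q (fundamental M q (\<pi>\<^sub>\<pp> i0 A)) = (\<lambda>_. 0)"
  shows "\<pi>\<^sub>\<pp> i0 A = 0"
proof -
  obtain U \<phi> where U: "(U, \<phi>) \<in> M" and qU: "q \<in> LM.over U" using LM_overE[OF q] .
  let ?U = "frame_matrix \<phi> q" and ?S = "A ** \<eta> i0 + \<eta> i0 ** transpose A"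
  have inv: "invertible ?U" using LM_invertible[OF q U] qU by simp
  note V = Sig.chart_in_E[OF U] and pq = p_LM_in_over[OF qU]
  \<comment> \<open>The empty linear combination exhibits the zero functional as the coordinate
    vector of \<open>0\<close>, so that \<open>coord_vec_inject\<close> applies.\<close>
  have zero: "coord_vec (Sig_atlas M i0) (Sig.over U, Sig.chart \<phi>) 0 (p_LM i0 q) = (\<lambda>_. 0)"
    using Sig.E.coord_vec_comb[OF V pq finite.emptyI] by simp
  have "(0, sym_lin (?U ** ?S ** transpose ?U)) = (0 :: (real^'m) \<times> (real^'m uprod))"
    by (rule Sig.E.coord_vec_inject[OF V pq])
      (use 0[unfolded tmap_p_LM_fundamental[OF U qU] pi_p_metric] zero in simp)
  then have "sym_lin (?U ** ?S ** transpose ?U) = 0" by (simp add: zero_prod_def)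
  moreover have tS: "transpose ?S = ?S"
    by (simp add: linear_simps[OF bounded_linear_transpose] matrix_transpose_mul transpose_eta add.commute)
  ultimately have "?U ** ?S ** transpose ?U = unsym 0"
    using unsym_sym_lin[OF transpose_conjugate[OF tS]] by metis
  then have z: "?U ** ?S ** transpose ?U = 0" by (simp add: unsym_def vec_eq_iff)
  have t: "transpose ?U ** transpose (matrix_inv ?U) = mat 1"
    by (simp add: matrix_inv_mult[OF inv] transpose_mat flip: matrix_transpose_mul)
  have "?S = matrix_inv ?U ** (?U ** ?S ** transpose ?U) ** transpose (matrix_inv ?U)"
    by (simp add: matrix_mul_assoc matrix_inv_mult[OF inv])
      (simp add: t flip: matrix_mul_assoc)
  then have "?S = 0" unfolding z
    by (simp add: bounded_bilinear.zero_left[OF bounded_bilinear_matrix_mult]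
        bounded_bilinear.zero_right[OF bounded_bilinear_matrix_mult])
  \<comment> \<open>\<open>?S ** \<eta> i0\<close> is twice the component
    \<open>\<pi>\<^sub>\<pp> i0 A\<close>.\<close>
  then have "?S ** \<eta> i0 = 0" by (simp add: bounded_bilinear.zero_left[OF bounded_bilinear_matrix_mult])
  then have "A + \<eta> i0 ** transpose A ** \<eta> i0 = 0"
    by (simp add: bounded_bilinear.add_left[OF bounded_bilinear_matrix_mult] eta_cancel)
  then show ?thesis by (simp add: \<pi>\<^sub>\<pp>_def)
qed

end


section \<open>The projection to the jets of metrics\<close>

lemma matrix_inv_K_mult:
  assumes "k \<in> K i0" "l \<in> K i0"
  shows "matrix_inv (k ** l) = matrix_inv l ** matrix_inv k"
proof -
  have "matrix_inv (k ** l) = \<eta> i0 ** transpose l ** (transpose k ** \<eta> i0)"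
    by (simp add: K_matrix_inv[OF K_mult[OF assms]] matrix_transpose_mul matrix_mul_assoc)
  also have "\<dots> = \<eta> i0 ** transpose l ** (\<eta> i0 ** \<eta> i0) ** (transpose k ** \<eta> i0)"
    by (simp add: eta_eta)
  finally show ?thesis by (simp add: assms[THEN K_matrix_inv] matrix_mul_assoc)
qed

text \<open>For \<open>k\<close> in \<open>K\<close> the inverse is the
  \<open>\<eta>\<close>-adjoint, so conjugation by \<open>k\<close> commutes with taking the
  \<open>\<eta>\<close>-adjoint, from which the projection is built.\<close>

lemma pi_k_conjugate:
  assumes k: "k \<in> K i0"
  shows "\<pi>\<^sub>\<kk> i0 (matrix_inv k ** B ** k) = matrix_inv k ** \<pi>\<^sub>\<kk> i0 B ** k"
proof -
  note mm = bounded_bilinear_matrix_mult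
  have i: "matrix_inv k = \<eta> i0 ** transpose k ** \<eta> i0" by (rule K_matrix_inv[OF k])
  have t: "transpose (matrix_inv k) = \<eta> i0 ** k ** \<eta> i0"
    by (simp add: i matrix_transpose_mul transpose_eta matrix_mul_assoc)
  have "\<eta> i0 ** transpose (matrix_inv k ** B ** k) ** \<eta> i0 =
      \<eta> i0 ** transpose k ** transpose B ** \<eta> i0 ** k ** (\<eta> i0 ** \<eta> i0)"
    by (simp add: t matrix_transpose_mul matrix_mul_assoc)
  also have "\<dots> = \<eta> i0 ** transpose k ** (\<eta> i0 ** \<eta> i0) ** transpose B ** \<eta> i0 ** k"
    by (simp add: eta_eta)
  also have "\<dots> = matrix_inv k ** (\<eta> i0 ** transpose B ** \<eta> i0) ** k"
    by (simp add: i matrix_mul_assoc)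
  finally show ?thesis
    unfolding \<pi>\<^sub>\<kk>_def
    by (simp only: bounded_bilinear.scaleR_left[OF mm] bounded_bilinear.scaleR_right[OF mm]
        bounded_bilinear.diff_left[OF mm] bounded_bilinear.diff_right[OF mm])
qed

text \<open>Moving the base point of an orbit by \<open>k\<close> only reindexes it: left
  translation by \<open>k\<close> permutes \<open>K\<close>.\<close>

lemma adj_class_act:
  assumes k: "k \<in> K i0"
  shows "adj_class i0 (act p k) (matrix_inv k ** B ** k) = adj_class i0 p B"
proof -
  have 1: "(act (act p k) l, matrix_inv l ** (matrix_inv k ** B ** k) ** l) =
      (act p (k ** l), matrix_inv (k ** l) ** B ** (k ** l))" if "l \<in> K i0" for l
    by (simp add: act_act matrix_inv_K_mult[OF k that] matrix_mul_assoc)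
  have 2: "k ** (matrix_inv k ** l) = l" for l
    by (simp add: matrix_mul_assoc matrix_inv_mult[OF K_invertible[OF k]])
  have "(\<lambda>l. k ** l) ` K i0 = K i0"
  proof (intro equalityI image_subsetI subsetI)
    fix l assume "l \<in> K i0"
    then show "l \<in> (\<lambda>l. k ** l) ` K i0"
      by (intro image_eqI[of _ _ "matrix_inv k ** l"]) (simp_all add: 2 K_mult K_inv k)
  qed (simp add: K_mult k)
  then have "adj_class i0 p B =
      (\<lambda>l. (act p (k ** l), matrix_inv (k ** l) ** B ** (k ** l))) ` K i0"
    unfolding adj_class_def by (metis (no_types, lifting) image_cong image_image)
  then show ?thesis unfolding adj_class_def using 1 by (simp cong: image_cong)
qed

context frame_geometry
begin

lemma P_map_eq: "P_map M i0 \<omega>\<^sub>0 j = jet M (Sig_atlas M i0) tau_Sig (jsource j) (\<lambda>y. p_LM i0 (jrep j y))"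
  by (simp add: P_map_def pr_Sig_def Upsilon_def Let_def comp_def)

lemma jsource_P_map [simp]: "jsource (P_map M i0 \<omega>\<^sub>0 j) = jsource j"
  by (simp add: P_map_eq)

text \<open>Ensures that \<open>P_map\<close> and \<open>jact\<close> form jets of genuine local
  sections; only then is anything known about the representative that \<open>jrep\<close>
  returns.\<close>

lemma
  assumes s: "local_section M (LM_atlas M) fst x s"
  shows local_section_p_LM: "local_section M (Sig_atlas M i0) tau_Sig x (\<lambda>y. p_LM i0 (s y))"
    and local_section_act: "invertible g \<Longrightarrow> local_section M (LM_atlas M) fst x (\<lambda>y. act (s y) g)"
proof -
  have "x \<in> carrier M"
    using LM_base[OF LM.local_section_total[OF s]] local_section_base[OF s] by simp
  then obtain U \<phi> where U: "(U, \<phi>) \<in> M" "x \<in> U" by (rule carrierE)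
  obtain W where W: "open W" "\<phi> x \<in> W" "W \<subseteq> \<phi> ` U"
    and T: "\<And>z. z \<in> W \<Longrightarrow> s (inv_into U \<phi> z) \<in> LM M"
    and p: "\<And>z. z \<in> W \<Longrightarrow> fst (s (inv_into U \<phi> z)) = inv_into U \<phi> z"
    and F: "smooth_on W (\<lambda>z. frame_matrix \<phi> (s (inv_into U \<phi> z)))"
    using LM.local_section_chart[OF s U] by blast
  show "local_section M (Sig_atlas M i0) tau_Sig x (\<lambda>y. p_LM i0 (s y))"
    by (rule Sig.local_sectionI[OF U W])
      (simp_all add: T p Sig_def metric_coord_frame smooth_on_metric_coord[OF W(1) F])
  show "local_section M (LM_atlas M) fst x (\<lambda>y. act (s y) g)" if "invertible g"
    by (rule LM.local_sectionI[OF U W])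
      (simp_all add: T p act_in_LM that frame_matrix_act
        smooth_on_bilinear[OF bounded_bilinear_matrix_mult W(1) F smooth_on_const[OF W(1)]])
qed

context
  fixes j assumes j: "j \<in> J1_tau M"
begin

lemma section_jrep: "local_section M (LM_atlas M) fst (jsource j) (jrep j)"
  by (rule J1_jrep(2)[OF j])

lemma P_map_in_J1: "P_map M i0 \<omega>\<^sub>0 j \<in> J1 M (Sig_atlas M i0) tau_Sig"
  using J1_jrep(1)[OF j] local_section_p_LM[OF section_jrep] unfolding P_map_eq J1_def by blast

lemma jtarget_P_map: "jtarget (P_map M i0 \<omega>\<^sub>0 j) = p_LM i0 (jtarget j)"
  unfolding P_map_eq jtarget_jet[OF local_section_p_LM[OF section_jrep]] unfolding jtarget_eq ..

text \<open>\<open>jrep\<close> chooses a new representative of the image jet, which need not be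
  \<open>p_LM i0 \<circ> jrep j\<close>; the two agree in their tangent maps at the source.\<close>

lemma tmap_jrep_P_map:
  assumes "v \<in> tangent_space M (jsource j)"
  shows "tmap (Sig_atlas M i0) (jrep (P_map M i0 \<omega>\<^sub>0 j)) (jsource j) v =
    tmap (Sig_atlas M i0) (p_LM i0) (jtarget j) (tmap (LM_atlas M) (jrep j) (jsource j) v)"
proof -
  have "tmap (Sig_atlas M i0) (p_LM i0) (jrep j (jsource j)) (tmap (LM_atlas M) (jrep j) (jsource j) v) =
      tmap (Sig_atlas M i0) (\<lambda>y. p_LM i0 (jrep j y)) (jsource j) v"
    by (rule tmap_compose) (rule smooth_near_p_LM[OF LM.local_section_total[OF section_jrep]])
  then show ?thesis
    unfolding P_map_eq jrep_jet_tmap[OF local_section_p_LM[OF section_jrep] assms] jtarget_eq ..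
qed

lemma contact_form_P_map:
  assumes W: "W \<in> tangent_space (J1_tau_atlas M) j"
  shows "pullback (J1_tau_Sig_atlas M i0) (P_map M i0 \<omega>\<^sub>0) (contact_form M (Sig_atlas M i0)) j W =
    tmap (Sig_atlas M i0) (p_LM i0) (jtarget j) (contact_form M (LM_atlas M) j W)"
proof
  fix f
  let ?P = "P_map M i0 \<omega>\<^sub>0" and ?S = "Sig_atlas M i0" and ?L = "LM_atlas M"
  let ?TW = "tmap (J1_tau_Sig_atlas M i0) ?P j W" and ?v = "tmap M jsource j W"
  let ?u = "jtarget j" and ?x = "jsource j"
  note Pj = P_map_in_J1[of \<omega>\<^sub>0] and Pt = jtarget_P_map[of \<omega>\<^sub>0]
  have v: "tmap M jsource (?P j) ?TW = ?v"
  proof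
    fix g
    show "tmap M jsource (?P j) ?TW g = ?v g"
      using Sig.smooth_near_jsource[OF Pj, of g] by (simp add: tmap_def comp_def)
  qed
  have vT: "?v \<in> tangent_space M ?x" by (rule LM.tmap_jsource_tangent[OF j W])
  show "pullback (J1_tau_Sig_atlas M i0) ?P (contact_form M ?S) j W f =
      tmap ?S (p_LM i0) ?u (contact_form M ?L j W) f"
  proof (cases "smooth_near ?S (p_LM i0 ?u) f")
    case f: True
    have fu: "smooth_near ?L ?u (\<lambda>r. f (p_LM i0 r))"
      by (rule smooth_near_p_LM[OF LM.J1_target(1)[OF j] f])
    have fP: "smooth_near (J1_tau_Sig_atlas M i0) (?P j) (\<lambda>i. f (jtarget i))"
      by (rule Sig.smooth_near_J1[OF Pj]) (simp_all add: Pt f)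
    have "tmap ?S jtarget (?P j) ?TW f = W (\<lambda>i. f (jtarget (?P i)))"
      using f fP by (simp add: tmap_def comp_def Pt)
    \<comment> \<open>\<open>P\<close> and \<open>p_LM\<close> are compatible at every jet
      \<open>i\<close>, not just at the fixed \<open>j\<close>, hence the exported form of
      \<open>jtarget_P_map\<close>; off the jets the functions may differ.\<close>
    also have "\<dots> = W (\<lambda>i. f (p_LM i0 (jtarget i)))"
      by (rule LM.J1_tangent_cong[OF W j LM.smooth_near_J1[OF j fu refl]])
        (simp add: frame_geometry.jtarget_P_map[OF frame_geometry_axioms])
    also have "\<dots> = tmap ?L jtarget j W (\<lambda>r. f (p_LM i0 r))"
      using fu by (simp add: tmap_def comp_def)
    finally have 1: "tmap ?S jtarget (?P j) ?TW f = tmap ?L jtarget j W (\<lambda>r. f (p_LM i0 r))" .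
    have 2: "tmap ?S (jrep (?P j)) ?x ?v f = tmap ?L (jrep j) ?x ?v (\<lambda>r. f (p_LM i0 r))"
      unfolding tmap_jrep_P_map[OF vT] using f by (simp add: tmap_def[of ?S] comp_def)
    show ?thesis
      using f by (simp add: pullback_def contact_form_def v 1 2 tmap_def[of ?S "p_LM i0"] comp_def)
  next
    case False
    \<comment> \<open>Every term is \<open>0\<close> by the convention in \<open>tmap\<close>; to
      see this for the second one, the value of the chosen representative has to be known.\<close>
    moreover have "jrep (?P j) ?x = p_LM i0 ?u"
      using Pt jtarget_eq[of "?P j"] by simp
    ultimately show ?thesis
      by (simp add: pullback_def contact_form_def tmap_def[of ?S] Pt)
  qed
qed

lemma metricity_pullback:
  assumes W: "W \<in> tangent_space (J1_tau_atlas M) j"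
  shows "tmap (Sig_atlas M i0) (p_LM i0) (jtarget j) (fundamental M (jtarget j) (metricity M i0 j W)) =
    pullback (J1_tau_Sig_atlas M i0) (P_map M i0 \<omega>\<^sub>0) (contact_form M (Sig_atlas M i0)) j W"
  unfolding metricity_def contact_form_P_map[OF W] fundamental_cartan[OF j W, symmetric]
  by (rule tmap_p_LM_pi_p[OF LM.J1_target(1)[OF j]])

lemma metricity_zero:
  assumes W: "W \<in> tangent_space (J1_tau_atlas M) j"
    and 0: "tmap (J1_tau_Sig_atlas M i0) (P_map M i0 \<omega>\<^sub>0) j W = (\<lambda>_. 0)"
  shows "metricity M i0 j W = 0"
proof -
  have "pullback (J1_tau_Sig_atlas M i0) (P_map M i0 \<omega>\<^sub>0) (contact_form M (Sig_atlas M i0)) j W = (\<lambda>_. 0)"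
    unfolding pullback_def 0 contact_form_def by (simp add: tmap_def)
  then have "tmap (Sig_atlas M i0) (p_LM i0) (jtarget j) (fundamental M (jtarget j) (metricity M i0 j W)) = (\<lambda>_. 0)"
    using metricity_pullback[OF W, of \<omega>\<^sub>0] by simp
  then show ?thesis
    unfolding metricity_def by (rule tmap_p_LM_pi_p_zero[OF LM.J1_target(1)[OF j]])
qed

text \<open>\<open>p_LM\<close> absorbs the action of \<open>k\<close>, so the jet component is
  unchanged. In the \<open>Lin\<close> component, equivariance of the connection conjugates its
  value by \<open>k\<close>, the projection \<open>\<pi>\<^sub>\<kk>\<close> commutes with this, and
  \<open>adj_class\<close> absorbs the conjugation together with the move of the frame.\<close>

lemma Upsilon_jact:
  assumes conn: "principal_connection M \<omega>\<^sub>0" and k: "k \<in> K i0"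
  shows "snd (Upsilon M i0 \<omega>\<^sub>0 (jact M j k)) = snd (Upsilon M i0 \<omega>\<^sub>0 j)"
proof -
  let ?x = "jsource j" and ?s = "jrep j" and ?s' = "jrep (jact M j k)" and ?L = "LM_atlas M"
  let ?u = "?s ?x" and ?S = "Sig_atlas M i0"
  note s = section_jrep and g = K_invertible[OF k]
  note sk = local_section_act[OF s g]
  note u = LM.local_section_total[OF s]
  have j': "jsource (jact M j k) = ?x" by (simp add: jact_def)
  have s': "local_section M ?L fst ?x ?s'" and val: "?s' ?x = act ?u k"
    unfolding jact_def by (rule jrep_jet_local_section[OF sk], rule jrep_jet_value[OF sk])
  have tm: "tmap ?L ?s' ?x v = tmap ?L (\<lambda>y. act (?s y) k) ?x v" if "v \<in> tangent_space M ?x" for v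
    unfolding jact_def by (rule jrep_jet_tmap[OF sk that])
  have P: "jet M ?S tau_Sig ?x (\<lambda>y. p_LM i0 (?s' y)) = jet M ?S tau_Sig ?x (\<lambda>y. p_LM i0 (?s y))"
  proof (rule jet_eqI)
    show "p_LM i0 (?s' ?x) = p_LM i0 ?u" by (simp add: val p_LM_act[OF k])
    fix v assume v: "v \<in> tangent_space M ?x"
    \<comment> \<open>The representative \<open>?s'\<close> is known through its tangent map only:
      \<open>p_LM\<close> is split off, the tangent map exchanged, and \<open>p_LM\<close> composed
      again.\<close>
    have "tmap ?S (\<lambda>y. p_LM i0 (?s' y)) ?x v = tmap ?S (p_LM i0) (?s' ?x) (tmap ?L ?s' ?x v)"
      by (rule tmap_compose[symmetric]) (rule smooth_near_p_LM[OF LM.local_section_total[OF s']])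
    also have "\<dots> = tmap ?S (p_LM i0) (act ?u k) (tmap ?L (\<lambda>y. act (?s y) k) ?x v)"
      by (simp add: val tm[OF v])
    also have "\<dots> = tmap ?S (\<lambda>y. p_LM i0 (act (?s y) k)) ?x v"
      by (rule tmap_compose) (rule smooth_near_p_LM[OF LM.local_section_total[OF sk]])
    finally show "tmap ?S (\<lambda>y. p_LM i0 (?s' y)) ?x v = tmap ?S (\<lambda>y. p_LM i0 (?s y)) ?x v"
      by (simp add: p_LM_act[OF k])
  qed
  have A: "adj_class i0 (?s' ?x) (\<pi>\<^sub>\<kk> i0 (\<omega>\<^sub>0 (?s' ?x) (tmap ?L ?s' ?x v))) =
      adj_class i0 ?u (\<pi>\<^sub>\<kk> i0 (\<omega>\<^sub>0 ?u (tmap ?L ?s ?x v)))" if v: "v \<in> tangent_space M ?x" for v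
  proof -
    let ?w = "tmap ?L ?s ?x v"
    have w: "?w \<in> tangent_space ?L ?u" by (rule LM.section_tmap_tangent[OF s v])
    have "tmap ?L ?s' ?x v = tmap ?L (\<lambda>q. act q k) ?u ?w"
      unfolding tm[OF v] by (rule tmap_compose[symmetric]) (rule smooth_near_act[OF u g])
    moreover have "\<omega>\<^sub>0 (act ?u k) (tmap ?L (\<lambda>q. act q k) ?u ?w) = matrix_inv k ** \<omega>\<^sub>0 ?u ?w ** k"
      using conn u w g unfolding principal_connection_def by blast
    ultimately show ?thesis by (simp add: val pi_k_conjugate[OF k] adj_class_act[OF k])
  qed
  show ?thesis
    unfolding Upsilon_def Let_def j' snd_conv comp_def P
    by (rule arg_cong[where f = "Pair _"], rule restrict_ext, rule A)
qed

text \<open>\<open>Upsilon_jact\<close> gives a common value on the orbit, and the orbit is nonempty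
  because \<open>K\<close> contains the identity; together they determine the \<open>THE\<close> in
  \<open>Upsilon_bar\<close>.\<close>

lemma P_map_Upsilon_bar:
  assumes conn: "principal_connection M \<omega>\<^sub>0"
  shows "P_map M i0 \<omega>\<^sub>0 j = (fst \<circ> Upsilon_bar M i0 \<omega>\<^sub>0 \<circ> p_J1 M i0) j"
proof -
  have "Upsilon_bar M i0 \<omega>\<^sub>0 (p_J1 M i0 j) = snd (Upsilon M i0 \<omega>\<^sub>0 j)"
    unfolding Upsilon_bar_def p_J1_def
    using Upsilon_jact[OF conn] K_one[of i0] by (intro the_equality) auto
  then show ?thesis by (simp add: P_map_def pr_Sig_def case_prod_beta)
qed

end

end

theorem proposition7p4:
  fixes M :: "('a, real^'m) atlas" and i0 :: 'm
    and \<omega>\<^sub>0 :: "('a, 'm) frame \<Rightarrow> ('a, 'm) frame tvec \<Rightarrow> real^'m^'m"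
  assumes "smooth_manifold M" and "principal_connection M \<omega>\<^sub>0"
  shows "(\<forall>j\<in>J1_tau M. P_map M i0 \<omega>\<^sub>0 j = (fst \<circ> Upsilon_bar M i0 \<omega>\<^sub>0 \<circ> p_J1 M i0) j) \<and>
    (\<forall>a b. horizontal_form (J1_tau_atlas M) (J1_tau_Sig_atlas M i0) (P_map M i0 \<omega>\<^sub>0)
              (\<lambda>j W. metricity M i0 j W $ a $ b)) \<and>
    (\<forall>j\<in>J1_tau M. \<forall>W\<in>tangent_space (J1_tau_atlas M) j.
       tmap (Sig_atlas M i0) (p_LM i0) (jtarget j) (fundamental M (jtarget j) (metricity M i0 j W))
       = pullback (J1_tau_Sig_atlas M i0) (P_map M i0 \<omega>\<^sub>0) (contact_form M (Sig_atlas M i0)) j W)"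
proof -
  interpret frame_geometry M i0
    unfolding frame_geometry_def by (rule smooth_manifold_atlas[OF assms(1)])
  have "horizontal_form (J1_tau_atlas M) (J1_tau_Sig_atlas M i0) (P_map M i0 \<omega>\<^sub>0)
      (\<lambda>j W. metricity M i0 j W $ a $ b)" for a b
    unfolding horizontal_form_def using LM.carrier_J1 metricity_zero by fastforce
  then show ?thesis
    using P_map_Upsilon_bar[OF _ assms(2)] metricity_pullback by blast
qed

end
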